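(* In Kerr spacetime, let $\Sigma_R:=\{t=t_0,\ r=R\}$ be a Boyer–Lindquist coordinate sphere outside the horizon ($R>r_+$). Every such coordinate sphere with $H\neq0$ (everywhere) is Willmore critical in the dual mean-curvature direction $\vec H^\star$. Moreover, $\Sigma_R$ is time-flat. In particular, every normal direction generated by $\vec H+\beta\vec H^\star$ is connection-compatible.
   Context: Kerr metric with mass $m>0$ and rotation parameter $a$, $|a|\le m$, in Boyer–Lindquist coordinates $(t,r,\theta,\varphi)$: with $\rho^2=r^2+a^2\cos^2\theta$, $\Delta=r^2-2mr+a^2$, $$\mathbf g=-\Big(1-\frac{2mr}{\rho^2}\Big)dt^2-\frac{4mar\sin^2\theta}{\rho^2}\,dt\,d\varphi+\frac{\rho^2}{\Delta}dr^2+\rho^2d\theta^2+\Big(r^2+a^2+\frac{2ma^2r\sin^2\theta}{\rho^2}\Big)\sin^2\theta\,d\varphi^2,$$ and $r_+=m+\sqrt{m^2-a^2}$. Write $\langle\cdot,\cdot\rangle=\mathbf g$, $\nabla$ for its Levi-Civita connection. $H$ denotes the mean curvature of $\Sigma_R$ inside the slice $\{t=t_0\}$ with respect to the unit normal $\nu$ pointing in the direction of $\partial_r$. For a closed spacelike surface $\Sigma$ with induced metric $h$ and area measure $d\mu$: mean curvature vector $\vec H=\operatorname{tr}_h\chi$ where $\chi(X,Y)=-(\nabla_XY)^\perp$; $|\vec H|^2=\langle\vec H,\vec H\rangle$ (for $\Sigma_R$ one has $|\vec H|^2=H^2$). When $|\vec H|^2>0$, $\vec H^\star$ is the unique future-directed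 timelike normal field with $\langle\vec H,\vec H^\star\rangle=0$ and $\langle\vec H^\star,\vec H^\star\rangle=-|\vec H|^2$; the canonical mean-curvature null frame is $\ell_{\vec H}=(\vec H^\star+\vec H)/|\vec H|$, $k_{\vec H}=(\vec H^\star-\vec H)/|\vec H|$ with normal connection one-form $s_{\ell_{\vec H}}(X)=-\frac12\langle k_{\vec H},\nabla_X\ell_{\vec H}\rangle$, $X\in T\Sigma$. $\Sigma$ is Willmore critical in the direction $\vec H^\star$ if $\delta_{\alpha\vec H^\star}\int_\Sigma|\vec H|^2\,d\mu=0$ for every $\alpha\in C^\infty(\Sigma)$, where $\delta_V$ is the first variation along normal variations with initial velocity $V$ (such variations are automatically area-preserving to first order). $\Sigma$ is time-flat if $\operatorname{div}_hs_{\ell_{\vec H}}=0$. For $\beta\in C^\infty(\Sigma)$, the direction generated by $\vec H+\beta\vec H^\star$ is connection-compatible if $\int_\Sigma\beta\operatorname{div}_hs_{\ell_{\vec H}}\,d\mu\leq0$. *)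

theory Defs
  imports "HOL-Analysis.Analysis"
begin

section \<open>Smooth maps\<close>

primrec Ck_on :: "nat \<Rightarrow> 'a::real_normed_vector set \<Rightarrow> ('a \<Rightarrow> 'b::real_normed_vector) \<Rightarrow> bool" where
  "Ck_on 0 S f \<longleftrightarrow> continuous_on S f"
| "Ck_on (Suc k) S f \<longleftrightarrow>
     (\<forall>x\<in>S. f differentiable (at x)) \<and> (\<forall>v. Ck_on k S (\<lambda>x. frechet_derivative f (at x) v))"

definition smooth_on :: "'a::real_normed_vector set \<Rightarrow> ('a \<Rightarrow> 'b::real_normed_vector) \<Rightarrow> bool" where
  "smooth_on S f \<longleftrightarrow> open S \<and> (\<forall>k. Ck_on k S f)"

text \<open>All surfaces below are of the type of the unit sphere in real 3-space and are given by a map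
  on it. A map on the sphere is identified with its extension to the punctured space that is
  homogeneous of degree 0; it is smooth on the sphere iff this extension is smooth, and its
  differential at a unit vector x, on the tangent space (the orthogonal complement of x), is that of
  the extension. The extension has zero radial derivative, so the differential at x applied to an
  arbitrary vector w is the differential applied to the tangential part of w. In particular, for
  fixed w, the assignment of the differential at y of X applied to w is a vector field along X
  tangent to the surface.\<close>

abbreviation S2 :: "(real^3) set" where "S2 \<equiv> sphere 0 1"

definition sext :: "(real^3 \<Rightarrow> 'b::real_normed_vector) \<Rightarrow> real^3 \<Rightarrow> 'b" where
  "sext f y = f (y /\<^sub>R norm y)"

definition smooth_on_S2 :: "(real^3 \<Rightarrow> 'b::real_normed_vector) \<Rightarrow> bool" where
  "smooth_on_S2 f \<longleftrightarrow> smooth_on (- {0}) (sext f)"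

definition sderiv :: "(real^3 \<Rightarrow> 'b::real_normed_vector) \<Rightarrow> real^3 \<Rightarrow> real^3 \<Rightarrow> 'b" where
  "sderiv f x v = frechet_derivative (sext f) (at x) v"

section \<open>Pseudo-Riemannian metrics in a global chart\<close>

type_synonym 'm metric = "'m \<Rightarrow> 'm \<Rightarrow> 'm \<Rightarrow> real"

text \<open>The bilinear map of the Christoffel symbols of the Levi-Civita connection, by the Koszul
  formula for constant (hence commuting) vector fields.\<close>

definition christoffel :: "'m::euclidean_space metric \<Rightarrow> 'm \<Rightarrow> 'm \<Rightarrow> 'm \<Rightarrow> 'm" where
  "christoffel g p u v = (THE c. \<forall>w. g p c w =
     (frechet_derivative (\<lambda>q. g q v w) (at p) u
    + frechet_derivative (\<lambda>q. g q u w) (at p) v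
    - frechet_derivative (\<lambda>q. g q u v) (at p) w) / 2)"

definition nabla :: "'m::euclidean_space metric \<Rightarrow> (real^3 \<Rightarrow> 'm) \<Rightarrow> (real^3 \<Rightarrow> 'm)
    \<Rightarrow> real^3 \<Rightarrow> real^3 \<Rightarrow> 'm" where
  \<comment> \<open>covariant derivative in direction v of the vector field Z along X\<close>
  "nabla g X Z x v = sderiv Z x v + christoffel g (X x) (sderiv X x v) (Z x)"

section \<open>Extrinsic geometry of closed surfaces\<close>

definition induced_metric :: "'m::euclidean_space metric \<Rightarrow> (real^3 \<Rightarrow> 'm)
    \<Rightarrow> real^3 \<Rightarrow> real^3 \<Rightarrow> real^3 \<Rightarrow> real" where
  "induced_metric g X x v w = g (X x) (sderiv X x v) (sderiv X x w)"

definition spacelike_surface :: "'m::euclidean_space metric \<Rightarrow> 'm set \<Rightarrow> (real^3 \<Rightarrow> 'm) \<Rightarrow> bool" where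
  "spacelike_surface g M X \<longleftrightarrow> smooth_on_S2 X \<and> X ` S2 \<subseteq> M \<and>
     (\<forall>x\<in>S2. \<forall>v. x \<bullet> v = 0 \<and> v \<noteq> 0 \<longrightarrow> 0 < induced_metric g X x v v)"

definition orthonormal_frame :: "'m::euclidean_space metric \<Rightarrow> (real^3 \<Rightarrow> 'm)
    \<Rightarrow> real^3 \<Rightarrow> (real^3) \<times> (real^3) \<Rightarrow> bool" where
  "orthonormal_frame g X x e \<longleftrightarrow> x \<bullet> fst e = 0 \<and> x \<bullet> snd e = 0 \<and>
     induced_metric g X x (fst e) (fst e) = 1 \<and>
     induced_metric g X x (snd e) (snd e) = 1 \<and>
     induced_metric g X x (fst e) (snd e) = 0"

text \<open>The trace does not depend on the chosen frame when B is bilinear.\<close>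

definition htrace :: "'m::euclidean_space metric \<Rightarrow> (real^3 \<Rightarrow> 'm) \<Rightarrow> real^3
    \<Rightarrow> (real^3 \<Rightarrow> real^3 \<Rightarrow> 'b::real_vector) \<Rightarrow> 'b" where
  "htrace g X x B =
     (let e = (SOME e. orthonormal_frame g X x e) in B (fst e) (fst e) + B (snd e) (snd e))"

definition is_normal :: "'m::euclidean_space metric \<Rightarrow> (real^3 \<Rightarrow> 'm) \<Rightarrow> real^3 \<Rightarrow> 'm \<Rightarrow> bool" where
  "is_normal g X x N \<longleftrightarrow> (\<forall>v. g (X x) N (sderiv X x v) = 0)"

definition normal_part :: "'m::euclidean_space metric \<Rightarrow> (real^3 \<Rightarrow> 'm) \<Rightarrow> real^3 \<Rightarrow> 'm \<Rightarrow> 'm" where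
  "normal_part g X x Z = (THE N. is_normal g X x N \<and> (\<exists>v. Z - N = sderiv X x v))"

definition second_ff :: "'m::euclidean_space metric \<Rightarrow> (real^3 \<Rightarrow> 'm)
    \<Rightarrow> real^3 \<Rightarrow> real^3 \<Rightarrow> real^3 \<Rightarrow> 'm" where
  "second_ff g X x v w = - normal_part g X x (nabla g X (\<lambda>y. sderiv X y w) x v)"

definition mean_curv :: "'m::euclidean_space metric \<Rightarrow> (real^3 \<Rightarrow> 'm) \<Rightarrow> real^3 \<Rightarrow> 'm" where
  "mean_curv g X x = htrace g X x (second_ff g X x)"

definition mean_curv_sq :: "'m::euclidean_space metric \<Rightarrow> (real^3 \<Rightarrow> 'm) \<Rightarrow> real^3 \<Rightarrow> real" where
  "mean_curv_sq g X x = g (X x) (mean_curv g X x) (mean_curv g X x)"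

text \<open>The value at x of the Levi-Civita derivative, for the induced metric, in direction v of the
  tangential part of the constant field w, for tangent vectors v and w at x. The Koszul formula has
  no bracket terms: the brackets of tangential parts of constant fields tangent at x vanish at x.\<close>

definition nabla_h :: "'m::euclidean_space metric \<Rightarrow> (real^3 \<Rightarrow> 'm)
    \<Rightarrow> real^3 \<Rightarrow> real^3 \<Rightarrow> real^3 \<Rightarrow> real^3" where
  "nabla_h g X x v w = (THE z. x \<bullet> z = 0 \<and> (\<forall>u. x \<bullet> u = 0 \<longrightarrow> induced_metric g X x z u =
     (sderiv (\<lambda>y. induced_metric g X y w u) x v
    + sderiv (\<lambda>y. induced_metric g X y v u) x w
    - sderiv (\<lambda>y. induced_metric g X y v w) x u) / 2))"

definition div_h :: "'m::euclidean_space metric \<Rightarrow> (real^3 \<Rightarrow> 'm)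
    \<Rightarrow> (real^3 \<Rightarrow> real^3 \<Rightarrow> real) \<Rightarrow> real^3 \<Rightarrow> real" where
  \<comment> \<open>for a one-form s that vanishes on radial vectors\<close>
  "div_h g X s x = htrace g X x (\<lambda>v w. sderiv (\<lambda>y. s y w) x v - s x (nabla_h g X x v w))"

definition sph :: "real \<Rightarrow> real \<Rightarrow> real^3" where
  "sph \<theta> \<phi> = vector [sin \<theta> * cos \<phi>, sin \<theta> * sin \<phi>, cos \<theta>]"

definition area_density :: "'m::euclidean_space metric \<Rightarrow> (real^3 \<Rightarrow> 'm) \<Rightarrow> real \<Rightarrow> real \<Rightarrow> real" where
  "area_density g X \<theta> \<phi> =
     (let h = induced_metric g X (sph \<theta> \<phi>);
          e\<^sub>1 = vector_derivative (\<lambda>\<theta>. sph \<theta> \<phi>) (at \<theta>);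
          e\<^sub>2 = vector_derivative (\<lambda>\<phi>. sph \<theta> \<phi>) (at \<phi>)
      in sqrt (h e\<^sub>1 e\<^sub>1 * h e\<^sub>2 e\<^sub>2 - (h e\<^sub>1 e\<^sub>2)\<^sup>2))"

text \<open>Integral of a function against the area measure of the induced metric, in spherical
  coordinates, which cover the sphere up to a null set.\<close>

definition surface_integral :: "'m::euclidean_space metric \<Rightarrow> (real^3 \<Rightarrow> 'm)
    \<Rightarrow> (real^3 \<Rightarrow> real) \<Rightarrow> real" where
  "surface_integral g X f =
     set_lebesgue_integral lborel ({0<..<pi} \<times> {0<..<2*pi})
       (\<lambda>(\<theta>, \<phi>). f (sph \<theta> \<phi>) * area_density g X \<theta> \<phi>)"

definition willmore_energy :: "'m::euclidean_space metric \<Rightarrow> (real^3 \<Rightarrow> 'm) \<Rightarrow> real" where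
  "willmore_energy g X = surface_integral g X (mean_curv_sq g X)"

definition is_variation :: "'m::euclidean_space metric \<Rightarrow> 'm set \<Rightarrow> (real^3 \<Rightarrow> 'm)
    \<Rightarrow> (real^3 \<Rightarrow> 'm) \<Rightarrow> (real \<Rightarrow> real^3 \<Rightarrow> 'm) \<Rightarrow> bool" where
  \<comment> \<open>F is a smooth variation of X, through closed spacelike surfaces, with initial velocity V\<close>
  "is_variation g M X V F \<longleftrightarrow>
     (\<exists>\<epsilon>>0. smooth_on ({-\<epsilon><..<\<epsilon>} \<times> (- {0})) (\<lambda>(s, y). sext (F s) y) \<and>
            (\<forall>s\<in>{-\<epsilon><..<\<epsilon>}. spacelike_surface g M (F s))) \<and>
     (\<forall>x\<in>S2. F 0 x = X x \<and> ((\<lambda>s. F s x) has_vector_derivative V x) (at 0))"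

section \<open>Surfaces in spacetime\<close>

text \<open>Points of spacetime are pairs (t, x), and the time orientation is that of increasing t: a
  timelike vector is future-directed iff its t-component is positive.\<close>

type_synonym spacetime = "real \<times> (real^3)"

definition dual_mean_curv :: "spacetime metric \<Rightarrow> (real^3 \<Rightarrow> spacetime) \<Rightarrow> real^3 \<Rightarrow> spacetime" where
  "dual_mean_curv g X x = (THE V. is_normal g X x V \<and> g (X x) (mean_curv g X x) V = 0 \<and>
     g (X x) V V = - mean_curv_sq g X x \<and> 0 < fst V)"

definition null_l :: "spacetime metric \<Rightarrow> (real^3 \<Rightarrow> spacetime) \<Rightarrow> real^3 \<Rightarrow> spacetime" where
  "null_l g X x = (dual_mean_curv g X x + mean_curv g X x) /\<^sub>R sqrt (mean_curv_sq g X x)"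

definition null_k :: "spacetime metric \<Rightarrow> (real^3 \<Rightarrow> spacetime) \<Rightarrow> real^3 \<Rightarrow> spacetime" where
  "null_k g X x = (dual_mean_curv g X x - mean_curv g X x) /\<^sub>R sqrt (mean_curv_sq g X x)"

definition connection_form :: "spacetime metric \<Rightarrow> (real^3 \<Rightarrow> spacetime) \<Rightarrow> real^3 \<Rightarrow> real^3 \<Rightarrow> real" where
  "connection_form g X x v = - g (X x) (null_k g X x) (nabla g X (null_l g X) x v) / 2"

definition spacelike_mean_curv :: "spacetime metric \<Rightarrow> spacetime set \<Rightarrow> (real^3 \<Rightarrow> spacetime) \<Rightarrow> bool" where
  "spacelike_mean_curv g M X \<longleftrightarrow> spacelike_surface g M X \<and> (\<forall>x\<in>S2. 0 < mean_curv_sq g X x)"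

definition willmore_critical_dual ::
    "spacetime metric \<Rightarrow> spacetime set \<Rightarrow> (real^3 \<Rightarrow> spacetime) \<Rightarrow> bool" where
  "willmore_critical_dual g M X \<longleftrightarrow> spacelike_mean_curv g M X \<and>
     (\<forall>\<alpha> F. smooth_on_S2 \<alpha> \<longrightarrow>
        is_variation g M X (\<lambda>x. \<alpha> x *\<^sub>R dual_mean_curv g X x) F \<longrightarrow>
        ((\<lambda>s. willmore_energy g (F s)) has_real_derivative 0) (at 0))"

definition time_flat :: "spacetime metric \<Rightarrow> spacetime set \<Rightarrow> (real^3 \<Rightarrow> spacetime) \<Rightarrow> bool" where
  "time_flat g M X \<longleftrightarrow> spacelike_mean_curv g M X \<and>
     (\<forall>x\<in>S2. div_h g X (connection_form g X) x = 0)"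

definition connection_compatible ::
    "spacetime metric \<Rightarrow> spacetime set \<Rightarrow> (real^3 \<Rightarrow> spacetime) \<Rightarrow> (real^3 \<Rightarrow> real) \<Rightarrow> bool" where
  \<comment> \<open>of the normal direction generated by the mean curvature vector plus \<beta> times its dual\<close>
  "connection_compatible g M X \<beta> \<longleftrightarrow> spacelike_mean_curv g M X \<and>
     surface_integral g X (\<lambda>x. \<beta> x * div_h g X (connection_form g X) x) \<le> 0"

section \<open>The Kerr exterior\<close>

definition r_plus :: "real \<Rightarrow> real \<Rightarrow> real" where
  "r_plus m a = m + sqrt (m\<^sup>2 - a\<^sup>2)"

definition kerr_exterior :: "real \<Rightarrow> real \<Rightarrow> spacetime set" where
  "kerr_exterior m a = {(t, x). r_plus m a < norm x}"

text \<open>The Kerr metric at Boyer-Lindquist coordinates (t, r, \<theta>, \<phi>), polarised, on coordinate vectors.\<close>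

definition kerr_BL :: "real \<Rightarrow> real \<Rightarrow> real \<times> real \<times> real \<times> real
    \<Rightarrow> real \<times> real \<times> real \<times> real \<Rightarrow> real \<times> real \<times> real \<times> real \<Rightarrow> real" where
  "kerr_BL m a = (\<lambda>(t, r, \<theta>, \<phi>) (dt, dr, d\<theta>, d\<phi>) (dt', dr', d\<theta>', d\<phi>').
     let \<rho>2 = r\<^sup>2 + a\<^sup>2 * (cos \<theta>)\<^sup>2; \<Delta> = r\<^sup>2 - 2 * m * r + a\<^sup>2 in
     - (1 - 2 * m * r / \<rho>2) * dt * dt'
     - (2 * m * a * r * (sin \<theta>)\<^sup>2 / \<rho>2) * (dt * d\<phi>' + d\<phi> * dt')
     + (\<rho>2 / \<Delta>) * dr * dr'
     + \<rho>2 * d\<theta> * d\<theta>'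
     + (r\<^sup>2 + a\<^sup>2 + 2 * m * a\<^sup>2 * r * (sin \<theta>)\<^sup>2 / \<rho>2) * (sin \<theta>)\<^sup>2 * d\<phi> * d\<phi>')"

definition BL_chart :: "real \<times> real \<times> real \<times> real \<Rightarrow> spacetime" where
  "BL_chart = (\<lambda>(t, r, \<theta>, \<phi>). (t, r *\<^sub>R sph \<theta> \<phi>))"

text \<open>The same metric in the coordinates (t, x) with x = r (sin \<theta> cos \<phi>, sin \<theta> sin \<phi>, cos \<theta>), in
  which it is smooth across the axis. Here r = |x|, \<omega> is the one-form (sin \<theta>)^2 d\<phi>, and the angular
  part uses that d\<theta>^2 + (sin \<theta>)^2 d\<phi>^2 = (|dx|^2 - dr^2) / r^2. See kerr_pullback below.\<close>

definition kerr :: "real \<Rightarrow> real \<Rightarrow> spacetime metric" where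
  "kerr m a = (\<lambda>(t, x) (dt, u) (dt', u').
     let r = norm x;
         \<rho>2 = r\<^sup>2 + a\<^sup>2 * (x $ 3 / r)\<^sup>2;
         \<Delta> = r\<^sup>2 - 2 * m * r + a\<^sup>2;
         dr = (\<lambda>u. (x \<bullet> u) / r);
         \<omega> = (\<lambda>u. (x $ 1 * u $ 2 - x $ 2 * u $ 1) / r\<^sup>2)
     in
     - (1 - 2 * m * r / \<rho>2) * dt * dt'
     - (2 * m * a * r / \<rho>2) * (dt * \<omega> u' + \<omega> u * dt')
     + (\<rho>2 / \<Delta>) * dr u * dr u'
     + (\<rho>2 / r\<^sup>2) * (u \<bullet> u' - dr u * dr u')
     + a\<^sup>2 * (1 + 2 * m * r / \<rho>2) * \<omega> u * \<omega> u')"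

definition coord_sphere :: "real \<Rightarrow> real \<Rightarrow> real^3 \<Rightarrow> spacetime" where
  "coord_sphere t0 R x = (t0, R *\<^sub>R x)"

definition slice_metric :: "real \<Rightarrow> real \<Rightarrow> real \<Rightarrow> (real^3) metric" where
  "slice_metric m a t0 x u v = kerr m a (t0, x) (0, u) (0, v)"

text \<open>Within the slice, the coordinate sphere is Y and the coordinate vector field of r is sgn.\<close>

definition slice_unit_normal :: "real \<Rightarrow> real \<Rightarrow> real \<Rightarrow> real \<Rightarrow> real^3 \<Rightarrow> real^3" where
  "slice_unit_normal m a t0 R x =
     (let \<gamma> = slice_metric m a t0; Y = (\<lambda>x. R *\<^sub>R x) in
      THE N. is_normal \<gamma> Y x N \<and> \<gamma> (Y x) N N = 1 \<and> 0 < \<gamma> (Y x) N (sgn (Y x)))"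

definition slice_mean_curv :: "real \<Rightarrow> real \<Rightarrow> real \<Rightarrow> real \<Rightarrow> real^3 \<Rightarrow> real" where
  "slice_mean_curv m a t0 R x =
     (let \<gamma> = slice_metric m a t0; Y = (\<lambda>x. R *\<^sub>R x) in
      \<gamma> (Y x) (mean_curv \<gamma> Y x) (slice_unit_normal m a t0 R x))"

subsection \<open>Consistency with Boyer-Lindquist coordinates\<close>

lemma sph_nth: "sph \<theta> \<phi> $ 1 = sin \<theta> * cos \<phi>" "sph \<theta> \<phi> $ 2 = sin \<theta> * sin \<phi>" "sph \<theta> \<phi> $ 3 = cos \<theta>"
  by (simp_all add: sph_def vector_3)

lemma norm_sph: "norm (sph \<theta> \<phi>) = 1"
proof -
  have "(sin \<theta> * cos \<phi>)\<^sup>2 + (sin \<theta> * sin \<phi>)\<^sup>2 + (cos \<theta>)\<^sup>2 = 1"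
    using sin_cos_squared_add[of \<theta>] sin_cos_squared_add[of \<phi>] by algebra
  then show ?thesis
    by (simp add: norm_eq_1 inner_vec_def sum_3 sph_nth power2_eq_square)
qed

definition BL_chart_deriv :: "real \<times> real \<times> real \<times> real \<Rightarrow> real \<times> real \<times> real \<times> real \<Rightarrow> spacetime" where
  "BL_chart_deriv = (\<lambda>(t, r, \<theta>, \<phi>) (dt, dr, d\<theta>, d\<phi>). (dt,
     vector [dr * sin \<theta> * cos \<phi> + r * cos \<theta> * cos \<phi> * d\<theta> - r * sin \<theta> * sin \<phi> * d\<phi>,
             dr * sin \<theta> * sin \<phi> + r * cos \<theta> * sin \<phi> * d\<theta> + r * sin \<theta> * cos \<phi> * d\<phi>,
             dr * cos \<theta> - r * sin \<theta> * d\<theta>]))"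

lemma BL_chart_has_derivative: "(BL_chart has_derivative BL_chart_deriv q) (at q)"
proof -
  obtain t r \<theta> \<phi> where q: "q = (t, r, \<theta>, \<phi>)" by (metis prod.exhaust)
  have eq: "BL_chart = (\<lambda>p. (fst p, \<chi> i. fst (snd p) * (if i = 1 then sin (fst (snd (snd p))) * cos (snd (snd (snd p)))
      else if i = 2 then sin (fst (snd (snd p))) * sin (snd (snd (snd p))) else cos (fst (snd (snd p))))))"
    by (auto simp: BL_chart_def fun_eq_iff vec_eq_iff forall_3 sph_nth)
  have "((\<lambda>p::real\<times>real\<times>real\<times>real. fst (snd p) * (if i = 1 then sin (fst (snd (snd p))) * cos (snd (snd (snd p)))
      else if i = 2 then sin (fst (snd (snd p))) * sin (snd (snd (snd p))) else cos (fst (snd (snd p)))))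
      has_derivative (\<lambda>p. snd (BL_chart_deriv q p) $ i)) (at q)" for i :: 3
    unfolding q BL_chart_deriv_def
    using exhaust_3[of i]
    by (auto intro!: derivative_eq_intros simp: vector_3 fun_eq_iff algebra_simps)
  then have "((\<lambda>p::real\<times>real\<times>real\<times>real. \<chi> i::3. fst (snd p) * (if i = 1 then sin (fst (snd (snd p))) * cos (snd (snd (snd p)))
      else if i = 2 then sin (fst (snd (snd p))) * sin (snd (snd (snd p))) else cos (fst (snd (snd p)))))
      has_derivative (\<lambda>p. \<chi> i. snd (BL_chart_deriv q p) $ i)) (at q)"
    unfolding has_derivative_componentwise_within[of "\<lambda>p. (\<chi> i. _ p i)"]
    by (auto simp: Basis_vec_def inner_axis)
  then have "(BL_chart has_derivative (\<lambda>p. (fst p, \<chi> i. snd (BL_chart_deriv q p) $ i))) (at q)"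
    unfolding eq by (intro has_derivative_Pair has_derivative_fst has_derivative_ident)
  moreover have "(\<lambda>p. (fst p, \<chi> i. snd (BL_chart_deriv q p) $ i)) = BL_chart_deriv q"
    by (auto simp: fun_eq_iff q BL_chart_deriv_def)
  ultimately show ?thesis by simp
qed

lemma polar_identities:
  fixes r st ct sp cp :: real
  assumes "sp\<^sup>2 + cp\<^sup>2 = 1" "st\<^sup>2 + ct\<^sup>2 = 1"
  shows "r * (st * cp) * (dr * st * cp + r * ct * cp * dt - r * st * sp * dp)
       + r * (st * sp) * (dr * st * sp + r * ct * sp * dt + r * st * cp * dp)
       + r * ct * (dr * ct - r * st * dt) = r * dr"
    and "r * (st * cp) * (dr * st * sp + r * ct * sp * dt + r * st * cp * dp)
       - r * (st * sp) * (dr * st * cp + r * ct * cp * dt - r * st * sp * dp) = r\<^sup>2 * (st\<^sup>2 * dp)"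
    and "(dr * st * cp + r * ct * cp * dt - r * st * sp * dp) * (dr' * st * cp + r * ct * cp * dt' - r * st * sp * dp')
       + (dr * st * sp + r * ct * sp * dt + r * st * cp * dp) * (dr' * st * sp + r * ct * sp * dt' + r * st * cp * dp')
       + (dr * ct - r * st * dt) * (dr' * ct - r * st * dt') - dr * dr'
       = r\<^sup>2 * (dt * dt' + st\<^sup>2 * dp * dp')"
  using assms by algebra+

theorem kerr_pullback:
  assumes r: "0 < r"
  shows "kerr m a (BL_chart (t, r, \<theta>, \<phi>)) (BL_chart_deriv (t, r, \<theta>, \<phi>) \<xi>) (BL_chart_deriv (t, r, \<theta>, \<phi>) \<eta>)
       = kerr_BL m a (t, r, \<theta>, \<phi>) \<xi> \<eta>"
proof -
  obtain dt dr d\<theta> d\<phi> where xi: "\<xi> = (dt, dr, d\<theta>, d\<phi>)" by (metis prod.exhaust)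
  obtain dt' dr' d\<theta>' d\<phi>' where eta: "\<eta> = (dt', dr', d\<theta>', d\<phi>')" by (metis prod.exhaust)
  define U where "U dr d\<theta> d\<phi> = (vector
      [dr * sin \<theta> * cos \<phi> + r * cos \<theta> * cos \<phi> * d\<theta> - r * sin \<theta> * sin \<phi> * d\<phi>,
       dr * sin \<theta> * sin \<phi> + r * cos \<theta> * sin \<phi> * d\<theta> + r * sin \<theta> * cos \<phi> * d\<phi>,
       dr * cos \<theta> - r * sin \<theta> * d\<theta>] :: real^3)" for dr d\<theta> d\<phi>
  let ?x = "r *\<^sub>R sph \<theta> \<phi>"
  have n: "norm ?x = r" using r by (simp add: norm_sph)
  have c3: "?x $ 3 / r = cos \<theta>" using r by (simp add: sph_nth)
  have d: "(?x \<bullet> U dr d\<theta> d\<phi>) / r = dr" for dr d\<theta> d\<phi>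
  proof -
    have "?x \<bullet> U dr d\<theta> d\<phi> = r * dr"
      unfolding U_def inner_vec_def sum_3 vector_3 sph_nth vector_scaleR_component inner_real_def real_scaleR_def
      by (rule polar_identities(1)) simp_all
    then show ?thesis using r by simp
  qed
  have w: "(?x $ 1 * U dr d\<theta> d\<phi> $ 2 - ?x $ 2 * U dr d\<theta> d\<phi> $ 1) / r\<^sup>2 = (sin \<theta>)\<^sup>2 * d\<phi>" for dr d\<theta> d\<phi>
  proof -
    have "?x $ 1 * U dr d\<theta> d\<phi> $ 2 - ?x $ 2 * U dr d\<theta> d\<phi> $ 1 = r\<^sup>2 * ((sin \<theta>)\<^sup>2 * d\<phi>)"
      unfolding U_def vector_3 sph_nth vector_scaleR_component real_scaleR_def
      by (rule polar_identities(2)) simp_all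
    then show ?thesis using r by simp
  qed
  have i: "U dr d\<theta> d\<phi> \<bullet> U dr' d\<theta>' d\<phi>' - dr * dr' = r\<^sup>2 * (d\<theta> * d\<theta>' + (sin \<theta>)\<^sup>2 * d\<phi> * d\<phi>')"
    unfolding U_def inner_vec_def sum_3 vector_3 inner_real_def
    by (rule polar_identities(3)) simp_all
  define \<rho>2 where "\<rho>2 = r\<^sup>2 + a\<^sup>2 * (cos \<theta>)\<^sup>2"
  have rho: "\<rho>2 + a\<^sup>2 * (sin \<theta>)\<^sup>2 = r\<^sup>2 + a\<^sup>2"
    unfolding \<rho>2_def by (simp add: cos_squared_eq algebra_simps)
  have L: "BL_chart_deriv (t, r, \<theta>, \<phi>) \<xi> = (dt, U dr d\<theta> d\<phi>)"
    "BL_chart_deriv (t, r, \<theta>, \<phi>) \<eta> = (dt', U dr' d\<theta>' d\<phi>')"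
    "BL_chart (t, r, \<theta>, \<phi>) = (t, ?x)"
    by (simp_all add: BL_chart_deriv_def xi eta U_def BL_chart_def)
  have A: "(\<rho>2 / r\<^sup>2) * (r\<^sup>2 * (d\<theta> * d\<theta>' + (sin \<theta>)\<^sup>2 * d\<phi> * d\<phi>'))
      = \<rho>2 * (d\<theta> * d\<theta>' + (sin \<theta>)\<^sup>2 * d\<phi> * d\<phi>')"
    using r by simp
  have K: "kerr m a (t, ?x) (dt, U dr d\<theta> d\<phi>) (dt', U dr' d\<theta>' d\<phi>') =
     - (1 - 2 * m * r / \<rho>2) * dt * dt'
     - (2 * m * a * r / \<rho>2) * (dt * ((sin \<theta>)\<^sup>2 * d\<phi>') + (sin \<theta>)\<^sup>2 * d\<phi> * dt')
     + (\<rho>2 / (r\<^sup>2 - 2 * m * r + a\<^sup>2)) * dr * dr'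
     + \<rho>2 * (d\<theta> * d\<theta>' + (sin \<theta>)\<^sup>2 * d\<phi> * d\<phi>')
     + a\<^sup>2 * (1 + 2 * m * r / \<rho>2) * ((sin \<theta>)\<^sup>2 * d\<phi>) * ((sin \<theta>)\<^sup>2 * d\<phi>')"
    unfolding kerr_def Let_def split n c3 d w i \<rho>2_def[symmetric] A by (rule refl)
  have B: "kerr_BL m a (t, r, \<theta>, \<phi>) \<xi> \<eta> =
     - (1 - 2 * m * r / \<rho>2) * dt * dt'
     - (2 * m * a * r * (sin \<theta>)\<^sup>2 / \<rho>2) * (dt * d\<phi>' + d\<phi> * dt')
     + (\<rho>2 / (r\<^sup>2 - 2 * m * r + a\<^sup>2)) * dr * dr'
     + \<rho>2 * d\<theta> * d\<theta>'
     + (\<rho>2 + a\<^sup>2 * (sin \<theta>)\<^sup>2 + 2 * m * a\<^sup>2 * r * (sin \<theta>)\<^sup>2 / \<rho>2) * (sin \<theta>)\<^sup>2 * d\<phi> * d\<phi>'"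
    unfolding kerr_BL_def Let_def split xi eta rho by (simp add: \<rho>2_def)
  show ?thesis unfolding L K B
    by (simp add: divide_inverse algebra_simps power2_eq_square)
qed

lemma coord_sphere_image:
  "coord_sphere t0 R ` S2 = {BL_chart (t, r, \<theta>, \<phi>) | t r \<theta> \<phi>. t = t0 \<and> r = R}"
proof -
  have "\<exists>\<theta> \<phi>. x = sph \<theta> \<phi>" if x: "x \<in> S2" for x
  proof -
    have s: "(x $ 1)\<^sup>2 + (x $ 2)\<^sup>2 + (x $ 3)\<^sup>2 = 1"
      using x by (simp add: norm_eq_1 inner_vec_def sum_3 power2_eq_square)
    define c where "c = sqrt ((x $ 1)\<^sup>2 + (x $ 2)\<^sup>2)"
    have "c\<^sup>2 + (x $ 3)\<^sup>2 = 1" using s by (simp add: c_def)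
    then obtain \<theta> where \<theta>: "c = sin \<theta>" "x $ 3 = cos \<theta>"
      by (metis add.commute sincos_total_2pi)
    have "\<exists>\<phi>. x $ 1 = c * cos \<phi> \<and> x $ 2 = c * sin \<phi>"
    proof (cases "c = 0")
      case True
      then show ?thesis by (auto simp: c_def sum_power2_eq_zero_iff)
    next
      case False
      have "(x $ 1)\<^sup>2 + (x $ 2)\<^sup>2 = c\<^sup>2" by (simp add: c_def)
      then have "(x $ 1 / c)\<^sup>2 + (x $ 2 / c)\<^sup>2 = 1"
        using False by (simp add: power_divide flip: add_divide_distrib)
      then obtain \<phi> where "x $ 1 / c = cos \<phi>" "x $ 2 / c = sin \<phi>"
        by (metis sincos_total_2pi)
      then show ?thesis using False by (metis mult.commute nonzero_eq_divide_eq)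
    qed
    then show ?thesis using \<theta> by (auto simp: vec_eq_iff forall_3 sph_nth)
  qed
  then show ?thesis
    by (fastforce simp: coord_sphere_def BL_chart_def norm_sph image_iff)
qed

end

theory Submission
  imports Defs
begin

text \<open>Everything follows from the symmetries of Kerr. The reflections of space in a plane through the
  axis, combined with a reversal of time about t0, are isometries that preserve the coordinate sphere;
  they fix its mean curvature vector and reverse the dual one. At a point of the reflection plane this
  makes the mean curvature vector radial and exchanges the two null directions up to sign, so that
  the connection one-form is odd and its divergence vanishes.

  The first variation of the Willmore energy is the integral of the differential of a density that
  depends on the 2-jet of the surface and is invariant under isometries. Rotating back to one meridian
  and integrating over the circle of latitude first, the differential is evaluated at the rotational
  average of the variation field. That average is odd under the reflection while the density and the
  2-jet of the sphere are even, so the integral vanishes.\<close>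

subsection \<open>Smooth maps\<close>

text \<open>The mean curvature of the spheres is never computed. The cross term of the metric
  changes sign under time reversal and under a meridian reflection, so it is their combination
  (\<open>lift_iso\<close> with \<open>\<delta> = - 1\<close>) that preserves it. That map is affine
  with constant differential, so Christoffel symbols, mean curvature and jets transform linearly.
  The coefficient of the variation is arbitrary, so the velocity field has no parity of its own;
  averaging creates it. On every orbit a reflection acts like some rotation, so an averaged scalar
  is reflection invariant, while the direction of \<open>dual_mean_curv\<close> is that of
  \<open>zamo\<close>, the future normal of the slice, which time reversal turns around. The
  definitions use \<open>THE\<close> and \<open>SOME\<close>, which say nothing about smoothness.
  Each is first replaced by an explicit expression in the metric and the 2-jet
  (\<open>mean_vec\<close>, \<open>kerr_inv\<close>); only then can the energy be differentiated
  under the integral. The poles do no harm: the frame \<open>e_theta\<close>, \<open>e_phi\<close>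
  stays orthonormal there, and the degeneration of the coordinates is confined to the factor
  \<open>sin \<theta>\<close>.\<close>

lemma frechet_derivative_eqI: "(f has_derivative f') (at x) \<Longrightarrow> frechet_derivative f (at x) v = f' v"
  using frechet_derivative_at by metis

lemma frechet_derivative_cong_open:
  assumes "open S" "x \<in> S" "\<And>y. y \<in> S \<Longrightarrow> f y = g y"
  shows "frechet_derivative f (at x) = frechet_derivative g (at x)"
proof -
  have "(f has_derivative f') (at x) \<longleftrightarrow> (g has_derivative f') (at x)" for f'
    using assms has_derivative_transform_within_open[of f f' x UNIV S g]
      has_derivative_transform_within_open[of g f' x UNIV S f] by auto
  then show ?thesis by (simp add: frechet_derivative_def)
qed

lemma Ck_on_cong:
  assumes "open S" "\<And>x. x \<in> S \<Longrightarrow> f x = g x"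
  shows "Ck_on k S f \<longleftrightarrow> Ck_on k S g"
  using assms(2)
proof (induction k arbitrary: f g)
  case 0
  then show ?case by (auto cong: continuous_on_cong)
next
  case (Suc k)
  have "f differentiable at x \<longleftrightarrow> g differentiable at x" if "x \<in> S" for x
    using that Suc.prems assms(1) has_derivative_transform_within_open[of f _ x UNIV S g]
      has_derivative_transform_within_open[of g _ x UNIV S f]
    unfolding differentiable_def by (metis (no_types, lifting))
  moreover have "Ck_on k S (\<lambda>x. frechet_derivative f (at x) v) \<longleftrightarrow> Ck_on k S (\<lambda>x. frechet_derivative g (at x) v)" for v
    using frechet_derivative_cong_open[OF assms(1) _ Suc.prems] by (intro Suc.IH) auto
  ultimately show ?case by simp
qed

lemma Ck_on_subset: "Ck_on k S f \<Longrightarrow> T \<subseteq> S \<Longrightarrow> Ck_on k T f"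
  by (induction k arbitrary: f) (auto intro: continuous_on_subset)

lemma Ck_on_SucD: "Ck_on (Suc k) S f \<Longrightarrow> Ck_on k S f"
proof (induction k arbitrary: f)
  case 0
  then show ?case
    by (auto intro!: continuous_at_imp_continuous_on differentiable_imp_continuous_within)
next
  case (Suc k)
  then show ?case by (metis Ck_on.simps(2))
qed

lemma Ck_on_const: "Ck_on k S (\<lambda>x. c)"
  by (induction k arbitrary: c) (auto simp: frechet_derivative_const)

text \<open>\<open>Ck_on\<close> is phrased with \<open>frechet_derivative\<close>; this lets the
  inductive steps below use any explicit formula for the differential instead.\<close>

lemma Ck_on_SucI:
  assumes "open S" "\<And>x. x \<in> S \<Longrightarrow> (f has_derivative f' x) (at x)"
    and "\<And>v. Ck_on k S (\<lambda>x. f' x v)"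
  shows "Ck_on (Suc k) S f"
proof -
  have "Ck_on k S (\<lambda>x. frechet_derivative f (at x) v)" for v
    using assms(3)[of v] by (subst Ck_on_cong[OF assms(1)]) (auto intro!: frechet_derivative_eqI assms(2))
  then show ?thesis using assms(2) by (auto simp: differentiable_def)
qed

lemma Ck_on_Suc_has_derivative:
  "Ck_on (Suc k) S f \<Longrightarrow> x \<in> S \<Longrightarrow> (f has_derivative frechet_derivative f (at x)) (at x)"
  by (simp flip: frechet_derivative_works)

lemma Ck_on_linear:
  assumes "bounded_linear L" "open S"
  shows "Ck_on k S f \<Longrightarrow> Ck_on k S (\<lambda>x. L (f x))"
proof (induction k arbitrary: f)
  case 0
  then show ?case using bounded_linear.continuous_on[OF assms(1)] by auto
next
  case (Suc k)
  show ?case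
    by (rule Ck_on_SucI[OF assms(2) bounded_linear.has_derivative[OF assms(1) Ck_on_Suc_has_derivative[OF Suc.prems]]])
      (use Suc in auto)
qed

lemma Ck_on_add: "open S \<Longrightarrow> Ck_on k S f \<Longrightarrow> Ck_on k S g \<Longrightarrow> Ck_on k S (\<lambda>x. f x + g x)"
proof (induction k arbitrary: f g)
  case 0
  then show ?case by (auto intro: continuous_on_add)
next
  case (Suc k)
  show ?case
    by (rule Ck_on_SucI[OF Suc.prems(1) has_derivative_add[OF Ck_on_Suc_has_derivative[OF Suc.prems(2)]
      Ck_on_Suc_has_derivative[OF Suc.prems(3)]]]) (use Suc in auto)
qed

lemma Ck_on_bilinear:
  assumes "bounded_bilinear B" "open S"
  shows "Ck_on k S f \<Longrightarrow> Ck_on k S g \<Longrightarrow> Ck_on k S (\<lambda>x. B (f x) (g x))"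
proof (induction k arbitrary: f g)
  case 0
  then show ?case using bounded_bilinear.continuous_on[OF assms(1)] by auto
next
  case (Suc k)
  show ?case
  proof (rule Ck_on_SucI[OF assms(2) bounded_bilinear.FDERIV[OF assms(1) Ck_on_Suc_has_derivative[OF Suc.prems(1)]
      Ck_on_Suc_has_derivative[OF Suc.prems(2)]]])
    fix v
    show "Ck_on k S (\<lambda>x. B (f x) (frechet_derivative g (at x) v) + B (frechet_derivative f (at x) v) (g x))"
      using Suc.prems by (intro Ck_on_add Suc.IH assms(2)) (auto intro: Ck_on_SucD)
  qed
qed

lemma Ck_on_sum:
  "open S \<Longrightarrow> (\<And>i. i \<in> I \<Longrightarrow> Ck_on k S (f i)) \<Longrightarrow> Ck_on k S (\<lambda>x. \<Sum>i\<in>I. f i x)"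
  by (induction I rule: infinite_finite_induct) (auto intro: Ck_on_add Ck_on_const)

lemma linear_eq_sum_Basis:
  fixes D :: "'a::euclidean_space \<Rightarrow> 'b::real_vector"
  assumes "linear D"
  shows "D v = (\<Sum>b\<in>Basis. (v \<bullet> b) *\<^sub>R D b)"
proof -
  have "D v = D (\<Sum>b\<in>Basis. (v \<bullet> b) *\<^sub>R b)" by (simp add: euclidean_representation)
  then show ?thesis by (simp add: linear_sum[OF assms] linear_cmul[OF assms])
qed

text \<open>In the chain rule the direction fed to the differential of \<open>f\<close> moves with
  \<open>x\<close>, while the induction hypothesis covers fixed directions only. Expanding that
  direction in \<open>Basis\<close> gives a finite sum of products, which is why the middle space is
  Euclidean.\<close>

lemma Ck_on_compose:
  fixes f :: "'b::euclidean_space \<Rightarrow> 'c::real_normed_vector"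
  assumes "open S" "open T" "g ` S \<subseteq> T"
  shows "Ck_on k T f \<Longrightarrow> Ck_on k S g \<Longrightarrow> Ck_on k S (\<lambda>x. f (g x))"
proof (induction k arbitrary: f)
  case 0
  then show ?case using assms(3) by (auto intro: continuous_on_compose2)
next
  case (Suc k)
  have d: "((\<lambda>x. f (g x)) has_derivative
      (\<lambda>v. \<Sum>b\<in>Basis. (frechet_derivative g (at x) v \<bullet> b) *\<^sub>R frechet_derivative f (at (g x)) b)) (at x)"
    if "x \<in> S" for x
  proof -
    have f: "(f has_derivative frechet_derivative f (at (g x))) (at (g x))"
      using Suc.prems(1) assms(3) that by (intro Ck_on_Suc_has_derivative) auto
    have g: "(g has_derivative frechet_derivative g (at x)) (at x)"
      using Suc.prems(2) that by (rule Ck_on_Suc_has_derivative)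
    show ?thesis
      using has_derivative_compose[OF g f]
      by (simp add: linear_eq_sum_Basis[OF has_derivative_linear[OF f], symmetric])
  qed
  show ?case
  proof (rule Ck_on_SucI[OF assms(1) d])
    fix v
    have "Ck_on k S (\<lambda>x. frechet_derivative f (at (g x)) b)" for b
      using Suc.prems by (intro Suc.IH) (auto intro: Ck_on_SucD)
    then show "Ck_on k S (\<lambda>x. \<Sum>b\<in>Basis. (frechet_derivative g (at x) v \<bullet> b) *\<^sub>R frechet_derivative f (at (g x)) b)"
      using Suc.prems(2)
      by (intro Ck_on_sum Ck_on_bilinear[OF bounded_bilinear_scaleR] Ck_on_linear[OF bounded_linear_inner_left] assms(1)) auto
  qed
qed

lemma smooth_onI: "open S \<Longrightarrow> (\<And>k. Ck_on k S f) \<Longrightarrow> smooth_on S f"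
  by (simp add: smooth_on_def)

lemma smooth_on_open: "smooth_on S f \<Longrightarrow> open S"
  by (simp add: smooth_on_def)

lemma smooth_on_continuous: "smooth_on S f \<Longrightarrow> continuous_on S f"
  unfolding smooth_on_def by (metis Ck_on.simps(1))

lemma smooth_on_has_derivative:
  "smooth_on S f \<Longrightarrow> x \<in> S \<Longrightarrow> (f has_derivative frechet_derivative f (at x)) (at x)"
  unfolding smooth_on_def by (metis Ck_on_Suc_has_derivative)

lemma smooth_on_differentiable: "smooth_on S f \<Longrightarrow> x \<in> S \<Longrightarrow> f differentiable at x"
  using smooth_on_has_derivative differentiable_def by blast

lemma smooth_on_cong:
  "smooth_on S f \<Longrightarrow> (\<And>x. x \<in> S \<Longrightarrow> f x = g x) \<Longrightarrow> smooth_on S g"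
  unfolding smooth_on_def using Ck_on_cong by metis

lemma smooth_on_frechet: "smooth_on S f \<Longrightarrow> smooth_on S (\<lambda>x. frechet_derivative f (at x) v)"
  unfolding smooth_on_def by (metis Ck_on.simps(2))

lemma smooth_on_const: "open S \<Longrightarrow> smooth_on S (\<lambda>x. c)"
  by (simp add: smooth_on_def Ck_on_const)

lemma smooth_on_linear: "bounded_linear L \<Longrightarrow> smooth_on S f \<Longrightarrow> smooth_on S (\<lambda>x. L (f x))"
  by (simp add: smooth_on_def Ck_on_linear)

lemma smooth_on_bilinear:
  "bounded_bilinear B \<Longrightarrow> smooth_on S f \<Longrightarrow> smooth_on S g \<Longrightarrow> smooth_on S (\<lambda>x. B (f x) (g x))"
  by (simp add: smooth_on_def Ck_on_bilinear)

lemma smooth_on_add: "smooth_on S f \<Longrightarrow> smooth_on S g \<Longrightarrow> smooth_on S (\<lambda>x. f x + g x)"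
  by (simp add: smooth_on_def Ck_on_add)

lemma smooth_on_ident: "open S \<Longrightarrow> smooth_on S (\<lambda>x. x)"
proof (rule smooth_onI)
  fix k assume S: "open S"
  show "Ck_on k S (\<lambda>x. x)"
  proof (cases k)
    case (Suc j)
    then show ?thesis
      using Ck_on_SucI[OF S, of "\<lambda>x. x" "\<lambda>x v. v" j] by (auto intro: Ck_on_const)
  qed simp
qed

lemma smooth_on_compose:
  fixes f :: "'b::euclidean_space \<Rightarrow> 'c::real_normed_vector"
  assumes "smooth_on T f" "smooth_on S g" "\<And>x. x \<in> S \<Longrightarrow> g x \<in> T"
  shows "smooth_on S (\<lambda>x. f (g x))"
  using assms Ck_on_compose[of S T g _ f] unfolding smooth_on_def by (simp add: image_subset_iff)

lemma smooth_on_uminus: "smooth_on S f \<Longrightarrow> smooth_on S (\<lambda>x. - f x)"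
  by (rule smooth_on_linear[OF bounded_linear_minus[OF bounded_linear_ident]])

lemma smooth_on_diff: "smooth_on S f \<Longrightarrow> smooth_on S g \<Longrightarrow> smooth_on S (\<lambda>x. f x - g x)"
  using smooth_on_add[OF _ smooth_on_uminus] by fastforce

lemma smooth_on_scaleR: "smooth_on S f \<Longrightarrow> smooth_on S g \<Longrightarrow> smooth_on S (\<lambda>x. f x *\<^sub>R g x)"
  by (rule smooth_on_bilinear[OF bounded_bilinear_scaleR])

lemma smooth_on_mult:
  fixes f g :: "_ \<Rightarrow> real"
  shows "smooth_on S f \<Longrightarrow> smooth_on S g \<Longrightarrow> smooth_on S (\<lambda>x. f x * g x)"
  by (rule smooth_on_bilinear[OF bounded_bilinear_mult])

lemma smooth_on_inner: "smooth_on S f \<Longrightarrow> smooth_on S g \<Longrightarrow> smooth_on S (\<lambda>x. f x \<bullet> g x)"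
  by (rule smooth_on_bilinear[OF bounded_bilinear_inner])

lemma smooth_on_power:
  fixes f :: "_ \<Rightarrow> real"
  shows "smooth_on S f \<Longrightarrow> smooth_on S (\<lambda>x. f x ^ n)"
  by (induction n) (auto intro: smooth_on_mult smooth_on_const smooth_on_open)

lemma smooth_on_sum:
  "open S \<Longrightarrow> (\<And>i. i \<in> I \<Longrightarrow> smooth_on S (f i)) \<Longrightarrow> smooth_on S (\<lambda>x. \<Sum>i\<in>I. f i x)"
  by (simp add: smooth_on_def Ck_on_sum)

lemma smooth_on_Pair:
  assumes "smooth_on S f" "smooth_on S g"
  shows "smooth_on S (\<lambda>x. (f x, g x))"
proof -
  have "smooth_on S (\<lambda>x. (f x, 0) + (0, g x))"
    using assms by (intro smooth_on_add smooth_on_linear[of "\<lambda>x. (x, 0)"] smooth_on_linear[of "\<lambda>x. (0, x)"])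
      (auto intro!: bounded_linear_intros)
  then show ?thesis by simp
qed

lemma smooth_on_fst: "smooth_on S f \<Longrightarrow> smooth_on S (\<lambda>x. fst (f x))"
  by (rule smooth_on_linear[OF bounded_linear_fst])

lemma smooth_on_snd: "smooth_on S f \<Longrightarrow> smooth_on S (\<lambda>x. snd (f x))"
  by (rule smooth_on_linear[OF bounded_linear_snd])

lemma smooth_on_nth: "smooth_on S f \<Longrightarrow> smooth_on S (\<lambda>x. f x $ i)"
  by (rule smooth_on_linear[OF bounded_linear_vec_nth])

lemma smooth_on_real_inverse: "smooth_on (- {0::real}) inverse"
proof (rule smooth_onI)
  fix k show "Ck_on k (- {0::real}) inverse"
  proof (induction k)
    case 0
    then show ?case by (auto intro: continuous_intros)
  next
    case (Suc k)
    show ?case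
    proof (rule Ck_on_SucI)
      show "(inverse has_derivative (\<lambda>v. - (inverse x * v * inverse x))) (at x)" if "x \<in> - {0}" for x :: real
        using that has_derivative_inverse' by force
      show "Ck_on k (- {0}) (\<lambda>x. - (inverse x * v * inverse x))" for v :: real
        using Suc by (intro Ck_on_linear[of uminus] Ck_on_bilinear[OF bounded_bilinear_mult] Ck_on_const)
          (auto simp: bounded_linear_minus open_Compl intro: bounded_linear_intros)
    qed auto
  qed
qed auto

lemma smooth_on_inverse:
  fixes f :: "_ \<Rightarrow> real"
  assumes "smooth_on S f" "\<And>x. x \<in> S \<Longrightarrow> f x \<noteq> 0"
  shows "smooth_on S (\<lambda>x. inverse (f x))"
  using smooth_on_compose[OF smooth_on_real_inverse assms(1)] assms(2) by auto

lemma smooth_on_divide: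
  fixes f g :: "_ \<Rightarrow> real"
  assumes "smooth_on S f" "smooth_on S g" "\<And>x. x \<in> S \<Longrightarrow> g x \<noteq> 0"
  shows "smooth_on S (\<lambda>x. f x / g x)"
  unfolding divide_inverse using assms by (intro smooth_on_mult smooth_on_inverse)

lemma smooth_on_real_sqrt: "smooth_on {0<..} sqrt"
proof (rule smooth_onI)
  fix k show "Ck_on k {0<..} sqrt"
  proof (induction k)
    case 0
    then show ?case by (auto intro: continuous_intros)
  next
    case (Suc k)
    show ?case
    proof (rule Ck_on_SucI)
      show "(sqrt has_derivative (\<lambda>v. (v / 2) * (sqrt x * inverse x))) (at x)" if "x \<in> {0<..}" for x :: real
        using that by (auto intro!: derivative_eq_intros simp: fun_eq_iff field_simps)
      have "Ck_on k {0<..} (inverse :: real \<Rightarrow> real)"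
        using smooth_on_real_inverse unfolding smooth_on_def by (auto intro: Ck_on_subset)
      then show "Ck_on k {0<..} (\<lambda>x. (v / 2) * (sqrt x * inverse x))" for v :: real
        using Suc by (intro Ck_on_bilinear[OF bounded_bilinear_mult] Ck_on_const) auto
    qed auto
  qed
qed auto

lemma smooth_on_sqrt:
  assumes "smooth_on S f" "\<And>x. x \<in> S \<Longrightarrow> 0 < f x"
  shows "smooth_on S (\<lambda>x. sqrt (f x))"
  using smooth_on_compose[OF smooth_on_real_sqrt assms(1)] assms(2) by auto

lemma smooth_on_norm:
  fixes f :: "_ \<Rightarrow> 'b::euclidean_space"
  assumes "smooth_on S f" "\<And>x. x \<in> S \<Longrightarrow> f x \<noteq> 0"
  shows "smooth_on S (\<lambda>x. norm (f x))"
  unfolding norm_eq_sqrt_inner using assms by (intro smooth_on_sqrt smooth_on_inner) auto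

lemma Ck_on_sin_cos: "Ck_on k UNIV (sin :: real \<Rightarrow> real) \<and> Ck_on k UNIV (cos :: real \<Rightarrow> real)"
proof (induction k)
  case 0
  then show ?case by (auto intro: continuous_intros)
next
  case (Suc k)
  have "Ck_on (Suc k) UNIV (sin :: real \<Rightarrow> real)"
    using Suc by (intro Ck_on_SucI[where f'="\<lambda>x v. v * cos x"] Ck_on_bilinear[OF bounded_bilinear_mult] Ck_on_const)
      (auto intro!: derivative_eq_intros)
  moreover have "Ck_on (Suc k) UNIV (cos :: real \<Rightarrow> real)"
    using Suc by (intro Ck_on_SucI[where f'="\<lambda>x v. - v * sin x"] Ck_on_bilinear[OF bounded_bilinear_mult] Ck_on_const)
      (auto intro!: derivative_eq_intros)
  ultimately show ?case ..
qed

lemma smooth_on_sin: "smooth_on S (f :: _ \<Rightarrow> real) \<Longrightarrow> smooth_on S (\<lambda>x. sin (f x))"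
  using smooth_on_compose[of UNIV "sin :: real \<Rightarrow> real" S f] Ck_on_sin_cos by (auto simp: smooth_on_def)

lemma smooth_on_cos: "smooth_on S (f :: _ \<Rightarrow> real) \<Longrightarrow> smooth_on S (\<lambda>x. cos (f x))"
  using smooth_on_compose[of UNIV "cos :: real \<Rightarrow> real" S f] Ck_on_sin_cos by (auto simp: smooth_on_def)

lemma smooth_on_axis: "smooth_on S f \<Longrightarrow> smooth_on S (\<lambda>x. axis i (f x) :: real^'n)"
  by (rule smooth_on_linear[of "axis i"]) (auto simp: linear_linear axis_def vec_eq_iff intro!: linearI)

lemma vector_3_axis: "(vector [a, b, c] :: real^3) = axis 1 a + axis 2 b + axis 3 c"
  by (simp add: vec_eq_iff forall_3 vector_3 axis_def)

lemma smooth_on_vector_3: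
  assumes "smooth_on S f" "smooth_on S g" "smooth_on S h"
  shows "smooth_on S (\<lambda>x. vector [f x, g x, h x] :: real^3)"
  unfolding vector_3_axis using assms by (intro smooth_on_add smooth_on_axis)

text \<open>Expansion in \<open>Basis\<close> reduces a moving linear argument to finitely many
  frozen ones. Joint smoothness of the metric, its derivatives and second differentials is obtained
  from this, one argument at a time.\<close>

lemma smooth_on_linear_arg:
  fixes f :: "'a::real_normed_vector \<Rightarrow> 'c::euclidean_space \<Rightarrow> 'b::real_normed_vector"
  assumes "\<And>c. smooth_on S (\<lambda>z. f z c)" "\<And>z. z \<in> S \<Longrightarrow> linear (f z)" "smooth_on S v"
  shows "smooth_on S (\<lambda>z. f z (v z))"
proof (rule smooth_on_cong)
  show "smooth_on S (\<lambda>z. \<Sum>b\<in>Basis. (v z \<bullet> b) *\<^sub>R f z b)"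
    using assms by (intro smooth_on_sum smooth_on_scaleR smooth_on_inner smooth_on_const) (auto dest: smooth_on_open)
qed (use assms(2) in \<open>simp flip: linear_eq_sum_Basis\<close>)

lemma smooth_on_frechet_arg:
  fixes f :: "'a::euclidean_space \<Rightarrow> 'b::real_normed_vector"
  assumes "smooth_on T f" "smooth_on S q" "smooth_on S v" "\<And>z. z \<in> S \<Longrightarrow> q z \<in> T"
  shows "smooth_on S (\<lambda>z. frechet_derivative f (at (q z)) (v z))"
proof (rule smooth_on_linear_arg[where f="\<lambda>z. frechet_derivative f (at (q z))"])
  show "smooth_on S (\<lambda>z. frechet_derivative f (at (q z)) c)" for c
    by (rule smooth_on_compose[OF smooth_on_frechet[OF assms(1)] assms(2,4)])
  show "linear (frechet_derivative f (at (q z)))" if "z \<in> S" for z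
    by (rule has_derivative_linear[OF smooth_on_has_derivative[OF assms(1) assms(4)[OF that]]])
qed (rule assms)

lemma frechet_derivative_linear: "smooth_on S f \<Longrightarrow> x \<in> S \<Longrightarrow> linear (frechet_derivative f (at x))"
  by (rule has_derivative_linear[OF smooth_on_has_derivative])

lemma frechet_derivative_compose:
  assumes "smooth_on T f" "(g has_derivative g') (at x)" "g x \<in> T"
  shows "((\<lambda>x. f (g x)) has_derivative (\<lambda>v. frechet_derivative f (at (g x)) (g' v))) (at x)"
  using has_derivative_compose[OF assms(2) smooth_on_has_derivative[OF assms(1,3)]] .

text \<open>The mean value theorem is used twice: along \<open>v\<close> for the difference in
  \<open>w\<close>, then along \<open>w\<close> for the derivative along \<open>v\<close>. The left
  side is symmetric in \<open>v\<close> and \<open>w\<close>, the right side contains one order of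
  differentiation.\<close>

lemma second_difference_mean_value:
  fixes f :: "'a::real_normed_vector \<Rightarrow> real"
  assumes f: "smooth_on S f" and h: "0 < h"
    and box: "\<And>a b. 0 \<le> a \<Longrightarrow> a \<le> h \<Longrightarrow> 0 \<le> b \<Longrightarrow> b \<le> h \<Longrightarrow> x + a *\<^sub>R v + b *\<^sub>R w \<in> S"
  shows "\<exists>a b. 0 < a \<and> a < h \<and> 0 < b \<and> b < h \<and>
    f (x + h *\<^sub>R v + h *\<^sub>R w) - f (x + h *\<^sub>R v) - f (x + h *\<^sub>R w) + f x =
    h\<^sup>2 * frechet_derivative (\<lambda>q. frechet_derivative f (at q) v) (at (x + a *\<^sub>R v + b *\<^sub>R w)) w"
proof -
  let ?Df = "\<lambda>q. frechet_derivative f (at q) v"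
  let ?D2 = "\<lambda>q. frechet_derivative ?Df (at q) w"
  have Df: "((\<lambda>t. f (x + t *\<^sub>R v + b *\<^sub>R w)) has_real_derivative ?Df (x + a *\<^sub>R v + b *\<^sub>R w)) (at a)"
    if "0 \<le> a" "a \<le> h" "0 \<le> b" "b \<le> h" for a b
  proof -
    have "((\<lambda>t. x + t *\<^sub>R v + b *\<^sub>R w) has_derivative (\<lambda>t. t *\<^sub>R v)) (at a)"
      by (auto intro!: derivative_eq_intros)
    from frechet_derivative_compose[OF f this box[OF that]]
    show ?thesis
      unfolding has_field_derivative_def
      by (rule has_derivative_eq_rhs) (simp add: fun_eq_iff linear_cmul[OF frechet_derivative_linear[OF f box[OF that]]])
  qed
  have D2: "((\<lambda>t. ?Df (x + a *\<^sub>R v + t *\<^sub>R w)) has_real_derivative ?D2 (x + a *\<^sub>R v + b *\<^sub>R w)) (at b)"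
    if "0 \<le> a" "a \<le> h" "0 \<le> b" "b \<le> h" for a b
  proof -
    have "((\<lambda>t. x + a *\<^sub>R v + t *\<^sub>R w) has_derivative (\<lambda>t. t *\<^sub>R w)) (at b)"
      by (auto intro!: derivative_eq_intros)
    from frechet_derivative_compose[OF smooth_on_frechet[OF f] this box[OF that]]
    show ?thesis
      unfolding has_field_derivative_def
      by (rule has_derivative_eq_rhs)
        (simp add: fun_eq_iff linear_cmul[OF frechet_derivative_linear[OF smooth_on_frechet[OF f] box[OF that]]])
  qed
  have "\<exists>a>0. a < h \<and> (f (x + h *\<^sub>R v + h *\<^sub>R w) - f (x + h *\<^sub>R v + 0 *\<^sub>R w))
      - (f (x + 0 *\<^sub>R v + h *\<^sub>R w) - f (x + 0 *\<^sub>R v + 0 *\<^sub>R w))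
      = (h - 0) * (?Df (x + a *\<^sub>R v + h *\<^sub>R w) - ?Df (x + a *\<^sub>R v + 0 *\<^sub>R w))"
    using h by (intro MVT2[where f="\<lambda>t. f (x + t *\<^sub>R v + h *\<^sub>R w) - f (x + t *\<^sub>R v + 0 *\<^sub>R w)"] DERIV_diff Df) auto
  then obtain a where a: "0 < a" "a < h"
    "(f (x + h *\<^sub>R v + h *\<^sub>R w) - f (x + h *\<^sub>R v)) - (f (x + h *\<^sub>R w) - f x)
      = h * (?Df (x + a *\<^sub>R v + h *\<^sub>R w) - ?Df (x + a *\<^sub>R v + 0 *\<^sub>R w))" by auto
  have "\<exists>b>0. b < h \<and> ?Df (x + a *\<^sub>R v + h *\<^sub>R w) - ?Df (x + a *\<^sub>R v + 0 *\<^sub>R w)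
      = (h - 0) * ?D2 (x + a *\<^sub>R v + b *\<^sub>R w)"
    using h a by (intro MVT2[where f="\<lambda>t. ?Df (x + a *\<^sub>R v + t *\<^sub>R w)"] D2) auto
  then obtain b where b: "0 < b" "b < h" "?Df (x + a *\<^sub>R v + h *\<^sub>R w) - ?Df (x + a *\<^sub>R v + 0 *\<^sub>R w)
      = h * ?D2 (x + a *\<^sub>R v + b *\<^sub>R w)" by auto
  show ?thesis
    using a b by (intro exI[of _ a] exI[of _ b]) (simp add: power2_eq_square algebra_simps)
qed

text \<open>The same second difference is \<open>h\<^sup>2\<close> times either mixed derivative,
  taken at two unrelated points of a small box; continuity of both derivatives at \<open>x\<close>
  closes the gap.\<close>

lemma second_derivative_symmetric_real:
  fixes f :: "'a::real_normed_vector \<Rightarrow> real"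
  assumes f: "smooth_on S f" and x: "x \<in> S"
  shows "frechet_derivative (\<lambda>q. frechet_derivative f (at q) v) (at x) w
       = frechet_derivative (\<lambda>q. frechet_derivative f (at q) w) (at x) v"
proof -
  let ?A = "\<lambda>q. frechet_derivative (\<lambda>q. frechet_derivative f (at q) v) (at q) w"
  let ?B = "\<lambda>q. frechet_derivative (\<lambda>q. frechet_derivative f (at q) w) (at q) v"
  have S: "open S" using f by (rule smooth_on_open)
  have "\<bar>?A x - ?B x\<bar> \<le> e" if e: "0 < e" for e
  proof -
    note c = bspec[OF continuous_on_eq_continuous_at[OF S, THEN iffD1,
        OF smooth_on_continuous[OF smooth_on_frechet[OF smooth_on_frechet[OF f]]]] x]
    have "isCont ?A x" "isCont ?B x" by (rule c)+
    moreover have "(F \<longlongrightarrow> F x) (nhds x)" if "isCont F x" for F :: "'a \<Rightarrow> real"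
      using that by (simp add: isCont_def tendsto_at_iff_tendsto_nhds)
    ultimately have t: "(?A \<longlongrightarrow> ?A x) (nhds x)" "(?B \<longlongrightarrow> ?B x) (nhds x)"
      by blast+
    have "\<forall>\<^sub>F y in nhds x. y \<in> S \<and> dist (?A y) (?A x) < e / 2 \<and> dist (?B y) (?B x) < e / 2"
      using e S x
      by (intro eventually_conj eventually_nhds_in_open tendstoD[OF t(1)] tendstoD[OF t(2)]) auto
    then obtain d where d: "0 < d" "\<And>y. dist y x < d \<Longrightarrow> y \<in> S \<and> dist (?A y) (?A x) < e / 2 \<and> dist (?B y) (?B x) < e / 2"
      unfolding eventually_nhds_metric by auto
    \<comment> \<open>With \<open>h = d / (2 * K)\<close> every point of the box lies within
      \<open>d / 2\<close> of \<open>x\<close>. The summand 1 keeps \<open>K\<close> positive when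
      both vectors vanish.\<close>
    define K where "K = 1 + norm v + norm w"
    define h where "h = d / (2 * K)"
    have pos: "0 < K" by (simp add: K_def add_pos_nonneg)
    then have h: "0 < h" using d(1) by (simp add: h_def)
    have near: "dist (x + a *\<^sub>R v + b *\<^sub>R w) x < d" if "0 \<le> a" "a \<le> h" "0 \<le> b" "b \<le> h" for a b
    proof -
      have "norm (a *\<^sub>R v + b *\<^sub>R w) \<le> a * norm v + b * norm w"
        using that norm_triangle_ineq[of "a *\<^sub>R v" "b *\<^sub>R w"] by simp
      also have "\<dots> \<le> h * norm v + h * norm w"
        using that by (intro add_mono mult_right_mono) auto
      also have "\<dots> \<le> h * K" using h by (simp add: K_def algebra_simps)
      also have "\<dots> = d / 2" using pos by (simp add: h_def)
      finally show ?thesis using d(1) by (simp add: dist_norm add.assoc)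
    qed
    obtain a b where ab: "0 < a" "a < h" "0 < b" "b < h"
      "f (x + h *\<^sub>R v + h *\<^sub>R w) - f (x + h *\<^sub>R v) - f (x + h *\<^sub>R w) + f x = h\<^sup>2 * ?A (x + a *\<^sub>R v + b *\<^sub>R w)"
      using second_difference_mean_value[OF f h, of x v w] near d(2) by blast
    have near': "dist (x + a *\<^sub>R w + b *\<^sub>R v) x < d" if "0 \<le> a" "a \<le> h" "0 \<le> b" "b \<le> h" for a b
      using near[of b a] that by (simp add: algebra_simps)
    obtain a' b' where ab': "0 < a'" "a' < h" "0 < b'" "b' < h"
      "f (x + h *\<^sub>R w + h *\<^sub>R v) - f (x + h *\<^sub>R w) - f (x + h *\<^sub>R v) + f x = h\<^sup>2 * ?B (x + a' *\<^sub>R w + b' *\<^sub>R v)"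
      using second_difference_mean_value[OF f h, of x w v] near' d(2) by blast
    have comm: "x + h *\<^sub>R w + h *\<^sub>R v = x + h *\<^sub>R v + h *\<^sub>R w" by simp
    have "h\<^sup>2 * ?A (x + a *\<^sub>R v + b *\<^sub>R w) = h\<^sup>2 * ?B (x + a' *\<^sub>R w + b' *\<^sub>R v)"
      using ab(5) ab'(5)[unfolded comm] by linarith
    then have "?A (x + a *\<^sub>R v + b *\<^sub>R w) = ?B (x + a' *\<^sub>R w + b' *\<^sub>R v)" using h by simp
    moreover have "dist (?A (x + a *\<^sub>R v + b *\<^sub>R w)) (?A x) < e / 2"
      using d(2)[OF near] ab by auto
    moreover have "dist (?B (x + a' *\<^sub>R w + b' *\<^sub>R v)) (?B x) < e / 2"
      using d(2)[OF near'] ab' by auto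
    ultimately show ?thesis unfolding dist_real_def by linarith
  qed
  then have "\<bar>?A x - ?B x\<bar> \<le> 0" by (rule field_le_epsilon) simp
  then show ?thesis by simp
qed

lemma frechet_derivative_linear_compose:
  assumes "bounded_linear L" "f differentiable at x"
  shows "frechet_derivative (\<lambda>y. L (f y)) (at x) v = L (frechet_derivative f (at x) v)"
  by (rule frechet_derivative_eqI[OF bounded_linear.has_derivative[OF assms(1) assms(2)[THEN frechet_derivative_works[THEN iffD1]]]])

lemma second_derivative_symmetric:
  fixes f :: "'a::real_normed_vector \<Rightarrow> 'b::euclidean_space"
  assumes f: "smooth_on S f" and x: "x \<in> S"
  shows "frechet_derivative (\<lambda>q. frechet_derivative f (at q) v) (at x) w
       = frechet_derivative (\<lambda>q. frechet_derivative f (at q) w) (at x) v"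
proof (rule euclidean_eqI)
  fix i :: 'b assume "i \<in> Basis"
  have *: "frechet_derivative (\<lambda>q. frechet_derivative f (at q) v) (at x) w \<bullet> i
      = frechet_derivative (\<lambda>q. frechet_derivative (\<lambda>y. f y \<bullet> i) (at q) v) (at x) w" for v w
  proof -
    have "frechet_derivative (\<lambda>q. frechet_derivative (\<lambda>y. f y \<bullet> i) (at q) v) (at x)
        = frechet_derivative (\<lambda>q. frechet_derivative f (at q) v \<bullet> i) (at x)"
      using smooth_on_open[OF f] x frechet_derivative_linear_compose[OF bounded_linear_inner_left smooth_on_differentiable[OF f]]
      by (intro frechet_derivative_cong_open) auto
    then show ?thesis
      using frechet_derivative_linear_compose[OF bounded_linear_inner_left smooth_on_differentiable[OF smooth_on_frechet[OF f] x]]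
      by simp
  qed
  show "frechet_derivative (\<lambda>q. frechet_derivative f (at q) v) (at x) w \<bullet> i =
      frechet_derivative (\<lambda>q. frechet_derivative f (at q) w) (at x) v \<bullet> i"
    unfolding * by (intro second_derivative_symmetric_real[OF _ x] smooth_on_inner f smooth_on_const smooth_on_open[OF f])
qed

subsection \<open>Pseudo-Riemannian metrics\<close>

definition metric_deriv :: "'m::euclidean_space metric \<Rightarrow> 'm \<Rightarrow> 'm \<Rightarrow> 'm \<Rightarrow> 'm \<Rightarrow> real" where
  "metric_deriv g p u v w = frechet_derivative (\<lambda>q. g q v w) (at p) u"

text \<open>Kept apart from \<open>christoffel\<close>, because a pairing with the metric is often
  all that is needed: this expression is directly multilinear and smooth, while the
  \<open>THE\<close> first needs existence and uniqueness.\<close>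

definition koszul :: "'m::euclidean_space metric \<Rightarrow> 'm \<Rightarrow> 'm \<Rightarrow> 'm \<Rightarrow> 'm \<Rightarrow> real" where
  "koszul g p u v w = (metric_deriv g p u v w + metric_deriv g p v u w - metric_deriv g p w u v) / 2"

lemma christoffel_koszul: "christoffel g p u v = (THE c. \<forall>w. g p c w = koszul g p u v w)"
  by (simp add: christoffel_def koszul_def metric_deriv_def)

text \<open>Nondegeneracy in place of a signature lets the same theory serve the Lorentzian metric
  of spacetime and the Riemannian metric of a slice.\<close>

locale metric_chart =
  fixes g :: "'m::euclidean_space metric" and M :: "'m set"
  assumes open_M: "open M"
    and bilin: "p \<in> M \<Longrightarrow> bilinear (g p)"
    and sym: "p \<in> M \<Longrightarrow> g p u v = g p v u"
    and nondeg: "p \<in> M \<Longrightarrow> (\<And>v. g p u v = 0) \<Longrightarrow> u = 0"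
    and smooth: "smooth_on M (\<lambda>q. g q u v)"
begin

lemmas lin1 = bilinear_ladd[OF bilin] bilinear_lmul[OF bilin, unfolded real_scaleR_def] bilinear_lzero[OF bilin] bilinear_lneg[OF bilin] bilinear_lsub[OF bilin]
lemmas lin2 = bilinear_radd[OF bilin] bilinear_rmul[OF bilin, unfolded real_scaleR_def] bilinear_rzero[OF bilin] bilinear_rneg[OF bilin] bilinear_rsub[OF bilin]
lemmas lin = lin1 lin2

lemma metric_has_derivative: "p \<in> M \<Longrightarrow> ((\<lambda>q. g q v w) has_derivative (\<lambda>u. metric_deriv g p u v w)) (at p)"
  unfolding metric_deriv_def by (rule smooth_on_has_derivative[OF smooth])

lemma metric_deriv_eqI:
  assumes "p \<in> M" "(f has_derivative f') (at p)" "\<And>q. q \<in> M \<Longrightarrow> g q v w = f q"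
  shows "metric_deriv g p u v w = f' u"
proof -
  have "frechet_derivative (\<lambda>q. g q v w) (at p) = frechet_derivative f (at p)"
    by (rule frechet_derivative_cong_open[OF open_M assms(1)]) (rule assms(3))
  then show ?thesis by (simp add: metric_deriv_def frechet_derivative_eqI[OF assms(2)])
qed

lemma metric_deriv_linear:
  assumes p: "p \<in> M"
  shows "metric_deriv g p (u + u') v w = metric_deriv g p u v w + metric_deriv g p u' v w"
    "metric_deriv g p (c *\<^sub>R u) v w = c * metric_deriv g p u v w"
    "metric_deriv g p u (v + v') w = metric_deriv g p u v w + metric_deriv g p u v' w"
    "metric_deriv g p u (c *\<^sub>R v) w = c * metric_deriv g p u v w"
    "metric_deriv g p u v (w + w') = metric_deriv g p u v w + metric_deriv g p u v w'"
    "metric_deriv g p u v (c *\<^sub>R w) = c * metric_deriv g p u v w"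
    "metric_deriv g p u v w = metric_deriv g p u w v"
proof -
  have l: "linear (\<lambda>u. metric_deriv g p u v w)" for v w
    by (rule has_derivative_linear[OF metric_has_derivative[OF p]])
  show "metric_deriv g p (u + u') v w = metric_deriv g p u v w + metric_deriv g p u' v w"
    "metric_deriv g p (c *\<^sub>R u) v w = c * metric_deriv g p u v w"
    using linear_add[OF l] linear_cmul[OF l] by auto
  show "metric_deriv g p u (v + v') w = metric_deriv g p u v w + metric_deriv g p u v' w"
    by (rule metric_deriv_eqI[OF p has_derivative_add[OF metric_has_derivative metric_has_derivative]]) (auto simp: p lin)
  show "metric_deriv g p u v (w + w') = metric_deriv g p u v w + metric_deriv g p u v w'"
    by (rule metric_deriv_eqI[OF p has_derivative_add[OF metric_has_derivative metric_has_derivative]]) (auto simp: p lin)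
  show "metric_deriv g p u (c *\<^sub>R v) w = c * metric_deriv g p u v w"
    by (rule metric_deriv_eqI[OF p has_derivative_mult_right[OF metric_has_derivative]]) (auto simp: p lin)
  show "metric_deriv g p u v (c *\<^sub>R w) = c * metric_deriv g p u v w"
    by (rule metric_deriv_eqI[OF p has_derivative_mult_right[OF metric_has_derivative]]) (auto simp: p lin)
  show "metric_deriv g p u v w = metric_deriv g p u w v"
    by (rule metric_deriv_eqI[OF p metric_has_derivative]) (auto simp: p sym)
qed

text \<open>The seventh identity is vanishing torsion, the eighth compatibility of the connection
  with the metric.\<close>

lemma koszul_linear:
  assumes p: "p \<in> M"
  shows "koszul g p (u + u') v w = koszul g p u v w + koszul g p u' v w"
    "koszul g p (c *\<^sub>R u) v w = c * koszul g p u v w"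
    "koszul g p u (v + v') w = koszul g p u v w + koszul g p u v' w"
    "koszul g p u (c *\<^sub>R v) w = c * koszul g p u v w"
    "koszul g p u v (w + w') = koszul g p u v w + koszul g p u v w'"
    "koszul g p u v (c *\<^sub>R w) = c * koszul g p u v w"
    "koszul g p u v w = koszul g p v u w"
    "koszul g p u v w + koszul g p u w v = metric_deriv g p u v w"
  unfolding koszul_def using metric_deriv_linear(7)[OF p]
  by (auto simp: metric_deriv_linear(1-6)[OF p] field_simps)

lemma eqI: "p \<in> M \<Longrightarrow> (\<And>w. g p c w = g p c' w) \<Longrightarrow> c = c'"
  using nondeg[of p "c - c'"] by (simp add: lin)

text \<open>Existence for the \<open>THE\<close> in \<open>christoffel\<close>: nondegeneracy makes
  the map from vectors to their metric components injective, hence surjective in finite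
  dimension.\<close>

lemma riesz:
  assumes p: "p \<in> M" and l: "linear l"
  shows "\<exists>c. \<forall>w. g p c w = l w"
proof -
  define T where "T c = (\<Sum>b\<in>Basis. g p c b *\<^sub>R b)" for c
  have Tb: "T c \<bullet> b = g p c b" if "b \<in> Basis" for b c
    using that by (simp add: T_def)
  have linr: "linear (g p c)" for c
    using bilin[OF p] by (simp add: bilinear_def)
  have T: "linear T"
    by (rule linearI) (auto simp: T_def lin[OF p] scaleR_add_left sum.distrib scaleR_sum_right)
  have "inj T"
    unfolding linear_injective_0[OF T]
  proof (intro allI impI)
    fix c assume "T c = 0"
    then have "g p c b = 0" if "b \<in> Basis" for b
      using Tb[OF that, of c] by simp
    then have "g p c w = 0" for w
      using linear_eq_sum_Basis[OF linr, of c w] by simp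
    then show "c = 0" using nondeg[OF p] by blast
  qed
  then have "surj T" by (rule linear_inj_imp_surj[OF T])
  then obtain c where c: "T c = (\<Sum>b\<in>Basis. l b *\<^sub>R b)" by (metis surj_def)
  have "g p c b = l b" if "b \<in> Basis" for b
    using Tb[OF that, of c] that by (simp add: c)
  then have "g p c w = l w" for w
    using linear_eq_sum_Basis[OF linr, of c w] linear_eq_sum_Basis[OF l, of w] by simp
  then show ?thesis by blast
qed

lemma christoffel_unique:
  assumes p: "p \<in> M" and c: "\<And>w. g p c w = koszul g p u v w"
  shows "christoffel g p u v = c"
  unfolding christoffel_koszul using c eqI[OF p] by (intro the_equality) auto

lemma g_christoffel:
  assumes p: "p \<in> M"
  shows "g p (christoffel g p u v) w = koszul g p u v w"
proof -
  have "linear (koszul g p u v)"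
    by (rule linearI) (auto simp: koszul_linear[OF p])
  then obtain c where "\<And>w. g p c w = koszul g p u v w"
    using riesz[OF p] by blast
  then show ?thesis using christoffel_unique[OF p] by metis
qed

lemma christoffel_linear:
  assumes p: "p \<in> M"
  shows "christoffel g p (u + u') v = christoffel g p u v + christoffel g p u' v"
    "christoffel g p (c *\<^sub>R u) v = c *\<^sub>R christoffel g p u v"
    "christoffel g p u (v + v') = christoffel g p u v + christoffel g p u v'"
    "christoffel g p u (c *\<^sub>R v) = c *\<^sub>R christoffel g p u v"
    "christoffel g p u v = christoffel g p v u"
  by (rule christoffel_unique[OF p]; simp add: lin[OF p] g_christoffel[OF p] koszul_linear(1-6)[OF p] koszul_linear(7)[OF p, symmetric])+

lemma christoffel_neg:
  assumes p: "p \<in> M"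
  shows "christoffel g p (- u) v = - christoffel g p u v" "christoffel g p u (- v) = - christoffel g p u v"
  using christoffel_linear(2,4)[OF p, where c="-1"] by auto

end

text \<open>The differential \<open>A\<close> is the same at every point, so \<open>\<sigma>\<close>
  is affine. This covers all symmetries used here and keeps second derivatives of
  \<open>\<sigma>\<close> out of every transformation law.\<close>

definition (in metric_chart) isometry_at :: "('m \<Rightarrow> 'm) \<Rightarrow> ('m \<Rightarrow> 'm) \<Rightarrow> bool" where
  "isometry_at \<sigma> A \<longleftrightarrow> surj A \<and> \<sigma> ` M \<subseteq> M \<and> (\<forall>p. (\<sigma> has_derivative A) (at p)) \<and>
     (\<forall>p\<in>M. \<forall>u v. g (\<sigma> p) (A u) (A v) = g p u v)"

context metric_chart
begin

lemma metric_deriv_isometry: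
  assumes "isometry_at \<sigma> A" "p \<in> M"
  shows "metric_deriv g (\<sigma> p) (A u) (A v) (A w) = metric_deriv g p u v w"
proof -
  have \<sigma>: "\<sigma> p \<in> M" "(\<sigma> has_derivative A) (at p)" "\<And>q. q \<in> M \<Longrightarrow> g q v w = g (\<sigma> q) (A v) (A w)"
    using assms by (auto simp: isometry_at_def)
  show ?thesis
    by (rule metric_deriv_eqI[OF assms(2) has_derivative_compose[OF \<sigma>(2) metric_has_derivative[OF \<sigma>(1)]] \<sigma>(3), symmetric])
qed

text \<open>Koszul expressions are preserved, and since \<open>A\<close> is onto, testing against
  vectors \<open>A w'\<close> determines the result. Affineness makes the symbols transform like a
  tensor.\<close>

lemma christoffel_isometry:
  assumes \<sigma>: "isometry_at \<sigma> A" and p: "p \<in> M"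
  shows "christoffel g (\<sigma> p) (A u) (A v) = A (christoffel g p u v)"
proof (rule christoffel_unique)
  show "\<sigma> p \<in> M" using assms by (auto simp: isometry_at_def)
  fix w obtain w' where w: "w = A w'" using \<sigma> by (metis isometry_at_def surj_def)
  have "g (\<sigma> p) (A (christoffel g p u v)) (A w') = g p (christoffel g p u v) w'"
    using assms by (auto simp: isometry_at_def)
  also have "\<dots> = koszul g (\<sigma> p) (A u) (A v) (A w')"
    unfolding g_christoffel[OF p] by (simp add: koszul_def metric_deriv_isometry[OF assms])
  finally show "g (\<sigma> p) (A (christoffel g p u v)) w = koszul g (\<sigma> p) (A u) (A v) w" by (simp add: w)
qed

end

section \<open>Mean curvature as an explicit function of the 2-jet\<close>

definition gram :: "('m \<Rightarrow> 'm \<Rightarrow> real) \<Rightarrow> 'm \<Rightarrow> 'm \<Rightarrow> real" where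
  "gram G u1 u2 = G u1 u1 * G u2 u2 - (G u1 u2)\<^sup>2"

text \<open>Cramer's rule for the tangential coefficients. It is written for an arbitrary basis,
  because the images of a fixed frame of the sphere do not stay orthonormal along a
  variation.\<close>

definition normal_proj :: "('m::real_vector \<Rightarrow> 'm \<Rightarrow> real) \<Rightarrow> 'm \<Rightarrow> 'm \<Rightarrow> 'm \<Rightarrow> 'm" where
  "normal_proj G u1 u2 Z = Z - ((G u2 u2 * G Z u1 - G u1 u2 * G Z u2) / gram G u1 u2) *\<^sub>R u1
     - ((G u1 u1 * G Z u2 - G u1 u2 * G Z u1) / gram G u1 u2) *\<^sub>R u2"

text \<open>Trace with the inverse Gram matrix of second derivatives plus Christoffel terms. The
  slot \<open>z12\<close> holds the sum of both mixed second derivatives, hence the factor 2 on the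
  mixed Christoffel term.\<close>

definition trace_vec :: "'m::euclidean_space metric \<Rightarrow> 'm \<Rightarrow> 'm \<Rightarrow> 'm \<Rightarrow> 'm \<Rightarrow> 'm \<Rightarrow> 'm \<Rightarrow> 'm" where
  "trace_vec g p u1 u2 z11 z12 z22 =
     (1 / gram (g p) u1 u2) *\<^sub>R (g p u2 u2 *\<^sub>R (z11 + christoffel g p u1 u1)
      - g p u1 u2 *\<^sub>R (z12 + 2 *\<^sub>R christoffel g p u1 u2) + g p u1 u1 *\<^sub>R (z22 + christoffel g p u2 u2))"

definition mean_vec :: "'m::euclidean_space metric \<Rightarrow> 'm \<Rightarrow> 'm \<Rightarrow> 'm \<Rightarrow> 'm \<Rightarrow> 'm \<Rightarrow> 'm \<Rightarrow> 'm" where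
  "mean_vec g p u1 u2 z11 z12 z22 = - normal_proj (g p) u1 u2 (trace_vec g p u1 u2 z11 z12 z22)"

text \<open>Second differential of the extension in the ambient space. It differs from an iterated
  \<open>sderiv\<close>, which extends the first derivative by degree 0 once more;
  \<open>sderiv_sderiv\<close> compares them.\<close>

definition hess :: "(real^3 \<Rightarrow> 'm::real_normed_vector) \<Rightarrow> real^3 \<Rightarrow> real^3 \<Rightarrow> real^3 \<Rightarrow> 'm" where
  "hess X x v w = frechet_derivative (\<lambda>y. frechet_derivative (sext X) (at y) w) (at x) v"

definition tangent_basis :: "real^3 \<Rightarrow> real^3 \<Rightarrow> real^3 \<Rightarrow> bool" where
  "tangent_basis x e1 e2 \<longleftrightarrow> x \<bullet> x = 1 \<and> e1 \<bullet> e1 = 1 \<and> e2 \<bullet> e2 = 1 \<and> x \<bullet> e1 = 0 \<and> x \<bullet> e2 = 0 \<and> e1 \<bullet> e2 = 0"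

lemma tangent_basis_expand:
  assumes "tangent_basis x e1 e2" "x \<bullet> v = 0"
  shows "v = (v \<bullet> e1) *\<^sub>R e1 + (v \<bullet> e2) *\<^sub>R e2"
proof -
  note o = assms(1)[unfolded tangent_basis_def]
  have ne: "x \<noteq> 0" "e1 \<noteq> 0" "e2 \<noteq> 0" using o by auto
  have d: "x \<noteq> e1" "x \<noteq> e2" "e1 \<noteq> e2" using o by auto
  have "pairwise orthogonal {x, e1, e2}"
    using o by (auto simp: pairwise_def orthogonal_def inner_commute)
  then have "independent {x, e1, e2}"
    using ne by (intro pairwise_orthogonal_independent) auto
  moreover have "card {x, e1, e2} = 3" using d by simp
  ultimately have sp: "span {x, e1, e2} = UNIV"
    using card_eq_dim[of "{x, e1, e2}" UNIV] by (auto simp: dim_UNIV)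
  define u where "u = v - (v \<bullet> e1) *\<^sub>R e1 - (v \<bullet> e2) *\<^sub>R e2"
  have "orthogonal u y" if "y \<in> {x, e1, e2}" for y
    using that o assms(2) by (auto simp: orthogonal_def u_def inner_diff_left inner_diff_right inner_commute)
  then have "orthogonal u u"
    using orthogonal_to_span[of u "{x, e1, e2}" u] sp by auto
  then have "u = 0" by (simp add: orthogonal_def)
  then show ?thesis by (simp add: u_def algebra_simps)
qed

section \<open>Calculus of the degree-0 extension\<close>

lemma S2_nonzero: "x \<in> S2 \<Longrightarrow> x \<noteq> 0" by auto

lemma sext_on_S2: "x \<in> S2 \<Longrightarrow> sext f x = f x" by (simp add: sext_def)

lemma sext_scale:
  assumes "0 < c"
  shows "sext f (c *\<^sub>R y) = sext f y"
proof -
  have "inverse c * inverse (norm y) * c = inverse (norm y)" using assms by simp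
  then have "(c *\<^sub>R y) /\<^sub>R norm (c *\<^sub>R y) = y /\<^sub>R norm y"
    using assms by (metis abs_of_pos inverse_mult_distrib norm_scaleR scaleR_scaleR)
  then show ?thesis by (simp only: sext_def)
qed

lemma smooth_sext: "smooth_on_S2 X \<Longrightarrow> smooth_on (- {0}) (sext X)"
  by (simp add: smooth_on_S2_def)

lemma sderiv_linear: "smooth_on_S2 X \<Longrightarrow> x \<noteq> 0 \<Longrightarrow> linear (sderiv X x)"
  unfolding sderiv_def using frechet_derivative_linear[OF smooth_sext, of X x] by (simp add: eta_contract_eq)

lemma sext_has_derivative: "smooth_on_S2 X \<Longrightarrow> x \<noteq> 0 \<Longrightarrow> (sext X has_derivative sderiv X x) (at x)"
  using smooth_on_has_derivative[OF smooth_sext, of X x] by (simp add: sderiv_def[abs_def])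

lemma sderiv_radial:
  assumes "smooth_on_S2 X" "x \<noteq> 0"
  shows "sderiv X x x = 0"
proof -
  have "((\<lambda>t. t *\<^sub>R x) has_derivative (\<lambda>t. t *\<^sub>R x)) (at 1)"
    by (auto intro!: derivative_eq_intros)
  then have "((\<lambda>t. sext X (t *\<^sub>R x)) has_derivative (\<lambda>t. sderiv X x (t *\<^sub>R x))) (at (1::real))"
    using has_derivative_compose[of "\<lambda>t. t *\<^sub>R x" _ 1 UNIV "sext X"] sext_has_derivative[OF assms] by simp
  moreover have "((\<lambda>t. sext X (t *\<^sub>R x)) has_derivative (\<lambda>t. 0)) (at (1::real))"
  proof (rule has_derivative_transform_within_open[of "\<lambda>t. sext X x" _ _ _ "{0<..}"])
    show "((\<lambda>t. sext X x) has_derivative (\<lambda>t. 0)) (at 1)" by simp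
  qed (auto simp: sext_scale)
  ultimately have "(\<lambda>t. sderiv X x (t *\<^sub>R x)) = (\<lambda>t. 0)" by (rule has_derivative_unique)
  from fun_cong[OF this, of 1] show ?thesis by simp
qed

text \<open>The derivative of a function homogeneous of degree 0 is homogeneous of degree -1; this
  is the origin of the factor \<open>norm y\<close> in \<open>sext_sderiv\<close>.\<close>

lemma sderiv_scale:
  assumes "smooth_on_S2 X" "y \<noteq> 0" "0 < c"
  shows "sderiv X (c *\<^sub>R y) w = (1 / c) *\<^sub>R sderiv X y w"
proof -
  have "((\<lambda>z. c *\<^sub>R z) has_derivative (\<lambda>z. c *\<^sub>R z)) (at y)"
    by (auto intro!: derivative_eq_intros)
  then have "((\<lambda>z. sext X (c *\<^sub>R z)) has_derivative (\<lambda>z. sderiv X (c *\<^sub>R y) (c *\<^sub>R z))) (at y)"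
    using has_derivative_compose[OF _ sext_has_derivative[OF assms(1)], of "\<lambda>z. c *\<^sub>R z"] assms by simp
  then have "(sext X has_derivative (\<lambda>z. sderiv X (c *\<^sub>R y) (c *\<^sub>R z))) (at y)"
    using assms(3) by (simp add: sext_scale)
  from has_derivative_unique[OF this sext_has_derivative[OF assms(1,2)]]
  have "sderiv X (c *\<^sub>R y) (c *\<^sub>R w) = sderiv X y w" by metis
  then have "sderiv X y w = c *\<^sub>R sderiv X (c *\<^sub>R y) w"
    using assms by (simp add: linear_cmul[OF sderiv_linear])
  then show ?thesis using assms(3) by simp
qed

lemma hess_has_derivative:
  assumes "smooth_on_S2 X" "x \<noteq> 0"
  shows "((\<lambda>y. sderiv X y w) has_derivative (\<lambda>v. hess X x v w)) (at x)"
  unfolding hess_def sderiv_def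
  using smooth_on_has_derivative[OF smooth_on_frechet[OF smooth_sext[OF assms(1)]], of x w] assms(2) by simp

lemma sext_sderiv:
  assumes "smooth_on_S2 X" "y \<noteq> 0"
  shows "sext (\<lambda>y. sderiv X y w) y = norm y *\<^sub>R sderiv X y w"
  using sderiv_scale[OF assms, of "1 / norm y"] assms(2) by (simp add: sext_def divide_inverse_commute)

lemma smooth_on_S2_sderiv:
  assumes "smooth_on_S2 X"
  shows "smooth_on_S2 (\<lambda>y. sderiv X y w)"
  unfolding smooth_on_S2_def
proof (rule smooth_on_cong)
  show "smooth_on (- {0}) (\<lambda>y. norm y *\<^sub>R sderiv X y w)"
    unfolding sderiv_def
    by (intro smooth_on_scaleR smooth_on_norm smooth_on_ident smooth_on_frechet smooth_sext assms) auto
qed (simp add: sext_sderiv[OF assms])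

text \<open>The factor \<open>norm y\<close> has value 1 on the sphere and derivative 0 in tangent
  directions, so there the two notions of second derivative agree.\<close>

lemma sderiv_sderiv:
  assumes "smooth_on_S2 X" "x \<in> S2" "x \<bullet> v = 0"
  shows "sderiv (\<lambda>y. sderiv X y w) x v = hess X x v w"
proof -
  have x: "x \<noteq> 0" "norm x = 1" using assms(2) by auto
  have "((\<lambda>y. norm y *\<^sub>R sderiv X y w) has_derivative (\<lambda>v. norm x *\<^sub>R hess X x v w + (v \<bullet> sgn x) *\<^sub>R sderiv X x w)) (at x)"
    by (rule has_derivative_scaleR[OF has_derivative_norm[OF x(1)] hess_has_derivative[OF assms(1) x(1)]])
  then have "(sext (\<lambda>y. sderiv X y w) has_derivative (\<lambda>v. norm x *\<^sub>R hess X x v w + (v \<bullet> sgn x) *\<^sub>R sderiv X x w)) (at x)"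
    by (rule has_derivative_transform_within_open[of _ _ _ _ "- {0}"]) (auto simp: x sext_sderiv[OF assms(1)])
  then show ?thesis
    using assms(3) x by (simp add: sderiv_def[of "\<lambda>y. sderiv X y w"] frechet_derivative_eqI sgn_div_norm inner_commute)
qed

lemma hess_linear:
  assumes "smooth_on_S2 X" "x \<noteq> 0"
  shows "hess X x (u + u') v = hess X x u v + hess X x u' v"
    "hess X x (c *\<^sub>R u) v = c *\<^sub>R hess X x u v"
proof -
  note l = has_derivative_linear[OF hess_has_derivative[OF assms]]
  show "hess X x (u + u') v = hess X x u v + hess X x u' v"
    "hess X x (c *\<^sub>R u) v = c *\<^sub>R hess X x u v"
    using linear_add[OF l] linear_cmul[OF l] by auto
qed

lemma hess_commute:
  fixes X :: "real^3 \<Rightarrow> 'm::euclidean_space"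
  shows "smooth_on_S2 X \<Longrightarrow> x \<noteq> 0 \<Longrightarrow> hess X x v w = hess X x w v"
  unfolding hess_def by (rule second_derivative_symmetric[OF smooth_sext]) auto

lemma hess_linear2:
  fixes X :: "real^3 \<Rightarrow> 'm::euclidean_space"
  assumes "smooth_on_S2 X" "x \<noteq> 0"
  shows "hess X x u (v + v') = hess X x u v + hess X x u v'"
    "hess X x u (c *\<^sub>R v) = c *\<^sub>R hess X x u v"
  using hess_commute[OF assms] hess_linear[OF assms] by metis+

subsection \<open>Surfaces and their mean curvature\<close>

text \<open>If the coordinate matrix \<open>P\<close> of a frame satisfies
  \<open>P H P^T = 1\<close>, then \<open>P^T P\<close> is the inverse of \<open>H\<close>; this is
  that identity in entries, multiplied by the determinant of \<open>H\<close>.\<close>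

lemma orthonormal_coordinates:
  fixes a b c d :: real
  assumes "a\<^sup>2 * h11 + 2 * a * b * h12 + b\<^sup>2 * h22 = 1" "c\<^sup>2 * h11 + 2 * c * d * h12 + d\<^sup>2 * h22 = 1"
    "a * c * h11 + (a * d + b * c) * h12 + b * d * h22 = 0"
  shows "(a\<^sup>2 + c\<^sup>2) * (h11 * h22 - h12\<^sup>2) = h22" "(b\<^sup>2 + d\<^sup>2) * (h11 * h22 - h12\<^sup>2) = h11"
    "(a * b + c * d) * (h11 * h22 - h12\<^sup>2) = - h12"
proof -
  \<comment> \<open>Determinants of both sides. It makes \<open>a * d - b * c\<close> nonzero, which
    permits the cancellation at the end.\<close>
  have D: "(a * d - b * c)\<^sup>2 * (h11 * h22 - h12\<^sup>2) = 1"
    using assms by algebra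
  have 1: "d * h22 + c * h12 = a * ((a * d - b * c) * (h11 * h22 - h12\<^sup>2))"
    "c * h11 + d * h12 = - b * ((a * d - b * c) * (h11 * h22 - h12\<^sup>2))"
    "b * h22 + a * h12 = - c * ((a * d - b * c) * (h11 * h22 - h12\<^sup>2))"
    "a * h11 + b * h12 = d * ((a * d - b * c) * (h11 * h22 - h12\<^sup>2))"
    using assms by algebra+
  have ne: "a * d - b * c \<noteq> 0" using D by auto
  have "(a * d - b * c) * ((a\<^sup>2 + c\<^sup>2) * (h11 * h22 - h12\<^sup>2)) = (a * d - b * c) * h22"
    "(a * d - b * c) * ((b\<^sup>2 + d\<^sup>2) * (h11 * h22 - h12\<^sup>2)) = (a * d - b * c) * h11"
    "(a * d - b * c) * ((a * b + c * d) * (h11 * h22 - h12\<^sup>2)) = (a * d - b * c) * - h12"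
    using 1 by algebra+
  then show "(a\<^sup>2 + c\<^sup>2) * (h11 * h22 - h12\<^sup>2) = h22" "(b\<^sup>2 + d\<^sup>2) * (h11 * h22 - h12\<^sup>2) = h11"
    "(a * b + c * d) * (h11 * h22 - h12\<^sup>2) = - h12"
    by (simp_all only: mult_left_cancel[OF ne])
qed

locale surface_point = metric_chart g M for g :: "'m::euclidean_space metric" and M +
  fixes X :: "real^3 \<Rightarrow> 'm" and x e1 e2 :: "real^3"
  assumes surf: "spacelike_surface g M X" and basis: "tangent_basis x e1 e2"
begin

abbreviation "G \<equiv> g (X x)"
abbreviation "u1 \<equiv> sderiv X x e1"
abbreviation "u2 \<equiv> sderiv X x e2"
abbreviation "h \<equiv> induced_metric g X x"
abbreviation "D \<equiv> gram G u1 u2"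

lemma x_S2: "x \<in> S2"
  using basis by (simp add: tangent_basis_def norm_eq_1)

lemma x_nz: "x \<noteq> 0" using x_S2 by auto

lemma smooth_X: "smooth_on_S2 X" using surf by (simp add: spacelike_surface_def)

lemma Xx: "X x \<in> M" using surf x_S2 by (auto simp: spacelike_surface_def)

lemma pos: "x \<bullet> v = 0 \<Longrightarrow> v \<noteq> 0 \<Longrightarrow> 0 < h v v"
  using surf x_S2 by (auto simp: spacelike_surface_def)

lemmas dX_lin = linear_add[OF sderiv_linear[OF smooth_X x_nz]] linear_cmul[OF sderiv_linear[OF smooth_X x_nz]]
  linear_diff[OF sderiv_linear[OF smooth_X x_nz]] linear_neg[OF sderiv_linear[OF smooth_X x_nz]]

lemmas Glin = lin[OF Xx]

lemma tangent_e: "x \<bullet> e1 = 0" "x \<bullet> e2 = 0" and e_nz: "e1 \<noteq> 0" "e2 \<noteq> 0"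
  using basis by (auto simp: tangent_basis_def)

text \<open>Positivity of the induced metric is applied to
  \<open>h e2 e2 *\<^sub>R e1 - h e1 e2 *\<^sub>R e2\<close>, whose square length is
  \<open>h e2 e2 * D\<close>.\<close>

lemma gram_pos: "0 < D"
proof -
  have h22: "0 < h e2 e2" using pos tangent_e e_nz by blast
  define v where "v = h e2 e2 *\<^sub>R e1 - h e1 e2 *\<^sub>R e2"
  have "v \<bullet> e1 = h e2 e2" using basis by (simp add: tangent_basis_def v_def inner_diff_left inner_commute[of e2 e1])
  then have "v \<noteq> 0" using h22 by auto
  moreover have "x \<bullet> v = 0" using tangent_e by (simp add: v_def inner_diff_right)
  ultimately have "0 < h v v" by (rule pos[rotated])
  also have "h v v = h e2 e2 * D"
    unfolding v_def induced_metric_def dX_lin Glin gram_def sym[OF Xx, of u2 u1] by algebra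
  finally show ?thesis using h22 by (simp add: zero_less_mult_iff)
qed

lemma tangent_expand:
  obtains a b where "sderiv X x v = a *\<^sub>R u1 + b *\<^sub>R u2"
proof -
  define w where "w = v - (x \<bullet> v) *\<^sub>R x"
  have "x \<bullet> w = 0" using x_S2 by (simp add: w_def inner_diff_right norm_eq_1)
  then have "sderiv X x w = sderiv X x ((w \<bullet> e1) *\<^sub>R e1 + (w \<bullet> e2) *\<^sub>R e2)"
    using tangent_basis_expand[OF basis] by simp
  moreover have "sderiv X x w = sderiv X x v"
    by (simp add: w_def dX_lin sderiv_radial[OF smooth_X x_nz])
  ultimately show ?thesis using that by (simp add: dX_lin)
qed

lemma is_normal_iff: "is_normal g X x N \<longleftrightarrow> G N u1 = 0 \<and> G N u2 = 0"
proof
  assume n: "G N u1 = 0 \<and> G N u2 = 0"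
  show "is_normal g X x N" unfolding is_normal_def
  proof
    fix v show "G N (sderiv X x v) = 0"
      using tangent_expand[of v] n by (metis Glin(6,7) add.right_neutral mult_zero_right)
  qed
qed (auto simp: is_normal_def)

text \<open>Since the surface is spacelike, its tangent plane meets the normal space trivially; this
  is the uniqueness behind \<open>normal_part\<close>.\<close>

lemma tangent_normal_zero:
  assumes "is_normal g X x (sderiv X x v)"
  shows "sderiv X x v = 0"
proof -
  define w where "w = v - (x \<bullet> v) *\<^sub>R x"
  have w: "x \<bullet> w = 0" "sderiv X x w = sderiv X x v"
    using x_S2 by (simp_all add: w_def inner_diff_right norm_eq_1 dX_lin sderiv_radial[OF smooth_X x_nz])
  have "h w w = 0" using assms w(2) by (simp add: is_normal_def induced_metric_def)
  then have "w = 0" using pos[OF w(1)] by force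
  then show ?thesis using w(2) linear_0[OF sderiv_linear[OF smooth_X x_nz]] by simp
qed

lemma is_normal_diff: "is_normal g X x N \<Longrightarrow> is_normal g X x N' \<Longrightarrow> is_normal g X x (N - N')"
  by (simp add: is_normal_def Glin)

lemma normal_proj_normal: "is_normal g X x (normal_proj G u1 u2 Z)"
  unfolding is_normal_iff normal_proj_def Glin sym[OF Xx, of u2 u1]
  using gram_pos by (simp add: field_simps) (simp add: gram_def algebra_simps power2_eq_square)

lemma normal_part_eq: "normal_part g X x Z = normal_proj G u1 u2 Z"
  unfolding normal_part_def
proof (rule the_equality)
  have "\<exists>v. Z - normal_proj G u1 u2 Z = sderiv X x v"
  proof -
    have "Z - normal_proj G u1 u2 Z = sderiv X x (((G u2 u2 * G Z u1 - G u1 u2 * G Z u2) / D) *\<^sub>R e1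
        + ((G u1 u1 * G Z u2 - G u1 u2 * G Z u1) / D) *\<^sub>R e2)"
      by (simp add: normal_proj_def dX_lin)
    then show ?thesis by blast
  qed
  then show "is_normal g X x (normal_proj G u1 u2 Z) \<and> (\<exists>v. Z - normal_proj G u1 u2 Z = sderiv X x v)"
    using normal_proj_normal by blast
  fix N assume N: "is_normal g X x N \<and> (\<exists>v. Z - N = sderiv X x v)"
  obtain v v' where v: "Z - N = sderiv X x v" "Z - normal_proj G u1 u2 Z = sderiv X x v'"
    using N \<open>\<exists>v. Z - normal_proj G u1 u2 Z = sderiv X x v\<close> by blast
  then have *: "N - normal_proj G u1 u2 Z = sderiv X x (v' - v)"
    by (simp add: dX_lin flip: v)
  then have "is_normal g X x (sderiv X x (v' - v))"
    using is_normal_diff N normal_proj_normal by metis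
  then have "N - normal_proj G u1 u2 Z = 0" unfolding * by (rule tangent_normal_zero)
  then show "N = normal_proj G u1 u2 Z" by simp
qed

lemma normal_proj_linear:
  "normal_proj G u1 u2 (Z + Z') = normal_proj G u1 u2 Z + normal_proj G u1 u2 Z'"
  "normal_proj G u1 u2 (Z - Z') = normal_proj G u1 u2 Z - normal_proj G u1 u2 Z'"
  "normal_proj G u1 u2 (c *\<^sub>R Z) = c *\<^sub>R normal_proj G u1 u2 Z"
  by (simp_all add: normal_proj_def Glin algebra_simps add_divide_distrib diff_divide_distrib scaleR_add_left scaleR_diff_left)

lemma orthonormal_frame_exists: "\<exists>e. orthonormal_frame g X x e"
proof -
  define c where "c = h e1 e2 / h e1 e1"
  define f where "f = e2 - c *\<^sub>R e1"
  have h11: "0 < h e1 e1" using pos tangent_e e_nz by blast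
  have "f \<bullet> e2 = 1" using basis by (simp add: f_def tangent_basis_def inner_diff_left)
  then have "f \<noteq> 0" by auto
  moreover have xf: "x \<bullet> f = 0" using tangent_e by (simp add: f_def inner_diff_right)
  ultimately have hff: "0 < h f f" by (rule pos[rotated])
  have hf: "h e1 f = 0"
    using h11 by (simp add: f_def induced_metric_def dX_lin Glin c_def)
  have "orthonormal_frame g X x ((1 / sqrt (h e1 e1)) *\<^sub>R e1, (1 / sqrt (h f f)) *\<^sub>R f)"
    using h11 hff hf tangent_e xf
    by (simp add: orthonormal_frame_def induced_metric_def dX_lin Glin flip: real_sqrt_mult)
  then show ?thesis by blast
qed

text \<open>Replaces the frame chosen by \<open>SOME\<close> with the inverse Gram matrix of a given
  basis. Agreement with a bilinear map is asked on tangent vectors only, since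
  \<open>second_ff\<close> is computed by \<open>hess\<close> only in tangent directions.\<close>

lemma htrace_eq:
  assumes B: "bilinear B'" "\<And>v w. x \<bullet> v = 0 \<Longrightarrow> x \<bullet> w = 0 \<Longrightarrow> B v w = B' v w"
  shows "htrace g X x B = (1 / D) *\<^sub>R (h e2 e2 *\<^sub>R B e1 e1 - h e1 e2 *\<^sub>R (B e1 e2 + B e2 e1) + h e1 e1 *\<^sub>R B e2 e2)"
proof -
  obtain f f' where e: "(SOME e. orthonormal_frame g X x e) = (f, f')" and of: "orthonormal_frame g X x (f, f')"
    by (metis orthonormal_frame_exists someI_ex surj_pair)
  have xf: "x \<bullet> f = 0" "x \<bullet> f' = 0" using of by (simp_all add: orthonormal_frame_def)
  obtain a b c d where f: "f = a *\<^sub>R e1 + b *\<^sub>R e2" "f' = c *\<^sub>R e1 + d *\<^sub>R e2"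
    using tangent_basis_expand[OF basis xf(1)] tangent_basis_expand[OF basis xf(2)] by blast
  have "h f f = 1" "h f' f' = 1" "h f f' = 0"
    using of by (simp_all add: orthonormal_frame_def)
  then have o: "a\<^sup>2 * G u1 u1 + 2 * a * b * G u1 u2 + b\<^sup>2 * G u2 u2 = 1"
    "c\<^sup>2 * G u1 u1 + 2 * c * d * G u1 u2 + d\<^sup>2 * G u2 u2 = 1"
    "a * c * G u1 u1 + (a * d + b * c) * G u1 u2 + b * d * G u2 u2 = 0"
    unfolding f induced_metric_def dX_lin Glin sym[OF Xx, of u2 u1] by (simp_all add: algebra_simps power2_eq_square)
  have inv: "a\<^sup>2 + c\<^sup>2 = h e2 e2 / D" "b\<^sup>2 + d\<^sup>2 = h e1 e1 / D" "a * b + c * d = - h e1 e2 / D"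
    using orthonormal_coordinates[OF o] nonzero_eq_divide_eq[OF less_imp_neq[OF gram_pos, symmetric]]
    by (simp_all only: gram_def induced_metric_def)
  have "htrace g X x B = B' f f + B' f' f'"
    using B(2) xf by (simp add: htrace_def e)
  also have "\<dots> = (a\<^sup>2 + c\<^sup>2) *\<^sub>R B' e1 e1 + (a * b + c * d) *\<^sub>R (B' e1 e2 + B' e2 e1) + (b\<^sup>2 + d\<^sup>2) *\<^sub>R B' e2 e2"
    unfolding f by (simp add: bilinear_ladd[OF B(1)] bilinear_radd[OF B(1)] bilinear_lmul[OF B(1)] bilinear_rmul[OF B(1)]
        scaleR_add_right scaleR_add_left power2_eq_square mult.commute)
  also have "\<dots> = (1 / D) *\<^sub>R (h e2 e2 *\<^sub>R B' e1 e1 - h e1 e2 *\<^sub>R (B' e1 e2 + B' e2 e1) + h e1 e1 *\<^sub>R B' e2 e2)"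
    unfolding inv by (simp add: scaleR_add_right scaleR_diff_right)
  finally show ?thesis using B(2) tangent_e by simp
qed

lemma nabla_sderiv:
  "x \<bullet> v = 0 \<Longrightarrow> nabla g X (\<lambda>y. sderiv X y w) x v = hess X x v w + christoffel g (X x) (sderiv X x v) (sderiv X x w)"
  by (simp add: nabla_def sderiv_sderiv[OF smooth_X x_S2])

text \<open>The bridge from the definitions to calculus: the surface enters only through its 2-jet,
  in a formula whose smoothness and symmetries can be checked term by term.\<close>

lemma mean_curv_eq:
  "mean_curv g X x = mean_vec g (X x) u1 u2 (hess X x e1 e1) (hess X x e1 e2 + hess X x e2 e1) (hess X x e2 e2)"
proof -
  let ?B = "\<lambda>v w. - normal_proj G u1 u2 (hess X x v w + christoffel g (X x) (sderiv X x v) (sderiv X x w))"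
  have "bilinear ?B"
    unfolding bilinear_def
    by (auto intro!: linearI simp: hess_linear[OF smooth_X x_nz] hess_linear2[OF smooth_X x_nz] dX_lin
        christoffel_linear(1-4)[OF Xx] normal_proj_linear algebra_simps)
  moreover have "second_ff g X x v w = ?B v w" if "x \<bullet> v = 0" for v w
    by (simp add: second_ff_def normal_part_eq nabla_sderiv[OF that])
  ultimately have "mean_curv g X x = (1 / D) *\<^sub>R (h e2 e2 *\<^sub>R ?B e1 e1 - h e1 e2 *\<^sub>R (?B e1 e2 + ?B e2 e1) + h e1 e1 *\<^sub>R ?B e2 e2)"
    unfolding mean_curv_def by (subst htrace_eq[of ?B]) (auto simp: tangent_e)
  also have "\<dots> = mean_vec g (X x) u1 u2 (hess X x e1 e1) (hess X x e1 e2 + hess X x e2 e1) (hess X x e2 e2)"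
    using christoffel_linear(5)[OF Xx, of u2 u1]
    by (simp add: mean_vec_def trace_vec_def normal_proj_linear induced_metric_def scaleR_2 algebra_simps)
  finally show ?thesis .
qed

lemma mean_curv_normal: "is_normal g X x (mean_curv g X x)"
  using normal_proj_normal unfolding mean_curv_eq mean_vec_def by (simp add: is_normal_def Glin)

lemma g_normal_proj:
  assumes "is_normal g X x N"
  shows "G (normal_proj G u1 u2 Z) N = G Z N"
proof -
  have "G u1 N = 0" "G u2 N = 0" using assms sym[OF Xx] by (simp_all add: is_normal_def)
  then show ?thesis by (simp add: normal_proj_def Glin)
qed

text \<open>A normal test vector absorbs the projection and turns Christoffel vectors into Koszul
  expressions. In this form the mean curvatures in the slice and in spacetime become
  comparable.\<close>

lemma g_mean_curv:
  assumes "is_normal g X x N"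
  shows "D * G (mean_curv g X x) N =
    - (G u2 u2 * (G (hess X x e1 e1) N + koszul g (X x) u1 u1 N)
       - G u1 u2 * (G (hess X x e1 e2) N + G (hess X x e2 e1) N + 2 * koszul g (X x) u1 u2 N)
       + G u1 u1 * (G (hess X x e2 e2) N + koszul g (X x) u2 u2 N))"
proof -
  have "D * (1 / D * c) = c" for c using gram_pos by simp
  then show ?thesis
    unfolding mean_curv_eq mean_vec_def trace_vec_def
    by (simp only: Glin g_normal_proj[OF assms] g_christoffel[OF Xx] mult_minus_right)
qed

end

subsection \<open>The Kerr metric\<close>

text \<open>\<open>I p b\<close> raises the index of the covector \<open>b\<close>. An explicit
  smooth inverse is what shows that \<open>christoffel\<close>, given by \<open>THE\<close>, depends
  smoothly on the point.\<close>

locale metric_chart_inverse = metric_chart g M for g :: "'m::euclidean_space metric" and M +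
  fixes I :: "'m \<Rightarrow> 'm \<Rightarrow> 'm"
  assumes inverse: "p \<in> M \<Longrightarrow> g p (I p b) w = b \<bullet> w"
    and smooth_inverse: "smooth_on M (\<lambda>p. I p b)"

context metric_chart
begin

lemma smooth_metric:
  assumes "smooth_on S p" "smooth_on S u" "smooth_on S v" "\<And>z. z \<in> S \<Longrightarrow> p z \<in> M"
  shows "smooth_on S (\<lambda>z. g (p z) (u z) (v z))"
proof -
  have 1: "smooth_on S (\<lambda>z. g (p z) c d)" for c d
    by (rule smooth_on_compose[OF smooth assms(1,4)])
  have 2: "smooth_on S (\<lambda>z. g (p z) (u z) d)" for d
    by (rule smooth_on_linear_arg[where f="\<lambda>z c. g (p z) c d", OF 1 _ assms(2)])
      (auto intro!: linearI simp: lin[OF assms(4)])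
  show ?thesis
    by (rule smooth_on_linear_arg[where f="\<lambda>z d. g (p z) (u z) d", OF 2 _ assms(3)])
      (auto intro!: linearI simp: lin[OF assms(4)])
qed

lemma smooth_metric_deriv:
  assumes "smooth_on S p" "smooth_on S u" "smooth_on S v" "smooth_on S w" "\<And>z. z \<in> S \<Longrightarrow> p z \<in> M"
  shows "smooth_on S (\<lambda>z. metric_deriv g (p z) (u z) (v z) (w z))"
proof -
  have 1: "smooth_on S (\<lambda>z. metric_deriv g (p z) (u z) c d)" for c d
    unfolding metric_deriv_def by (rule smooth_on_frechet_arg[OF smooth assms(1,2,5)])
  have 2: "smooth_on S (\<lambda>z. metric_deriv g (p z) (u z) (v z) d)" for d
    by (rule smooth_on_linear_arg[where f="\<lambda>z c. metric_deriv g (p z) (u z) c d", OF 1 _ assms(3)])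
      (auto intro!: linearI simp: metric_deriv_linear(1-6)[OF assms(5)])
  show ?thesis
    by (rule smooth_on_linear_arg[where f="\<lambda>z d. metric_deriv g (p z) (u z) (v z) d", OF 2 _ assms(4)])
      (auto intro!: linearI simp: metric_deriv_linear(1-6)[OF assms(5)])
qed

lemma smooth_koszul:
  assumes "smooth_on S p" "smooth_on S u" "smooth_on S v" "smooth_on S w" "\<And>z. z \<in> S \<Longrightarrow> p z \<in> M"
  shows "smooth_on S (\<lambda>z. koszul g (p z) (u z) (v z) (w z))"
  unfolding koszul_def
  by (intro smooth_on_divide smooth_on_diff smooth_on_add smooth_metric_deriv assms smooth_on_const)
    (use assms in \<open>auto intro: smooth_on_open\<close>)

end

context metric_chart_inverse
begin

lemma christoffel_inverse:
  assumes p: "p \<in> M"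
  shows "christoffel g p u v = (\<Sum>b\<in>Basis. koszul g p u v b *\<^sub>R I p b)"
proof (rule christoffel_unique[OF p])
  fix w
  have l: "linear (\<lambda>c. g p c w)" by (rule linearI) (auto simp: lin[OF p])
  have k: "linear (koszul g p u v)" by (rule linearI) (auto simp: koszul_linear[OF p])
  show "g p (\<Sum>b\<in>Basis. koszul g p u v b *\<^sub>R I p b) w = koszul g p u v w"
    using linear_eq_sum_Basis[OF k, of w]
    by (simp add: linear_sum[OF l] lin[OF p] inverse[OF p] inner_commute mult.commute)
qed

lemma smooth_christoffel:
  assumes "smooth_on S p" "smooth_on S u" "smooth_on S v" "\<And>z. z \<in> S \<Longrightarrow> p z \<in> M"
  shows "smooth_on S (\<lambda>z. christoffel g (p z) (u z) (v z))"
proof (rule smooth_on_cong)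
  have S: "open S" by (rule smooth_on_open[OF assms(1)])
  show "smooth_on S (\<lambda>z. \<Sum>b\<in>Basis. koszul g (p z) (u z) (v z) b *\<^sub>R I (p z) b)"
    by (intro smooth_on_sum smooth_on_scaleR smooth_koszul smooth_on_compose[OF smooth_inverse] assms smooth_on_const S)
qed (simp add: christoffel_inverse assms(4))

end

section \<open>Coefficients, inverse and slice normal of the Kerr metric\<close>

definition omega :: "real^3 \<Rightarrow> real^3 \<Rightarrow> real" where
  "omega x u = (x $ 1 * u $ 2 - x $ 2 * u $ 1) / (norm x)\<^sup>2"

definition rho2 :: "real \<Rightarrow> real^3 \<Rightarrow> real" where
  "rho2 a x = (norm x)\<^sup>2 + a\<^sup>2 * (x $ 3 / norm x)\<^sup>2"

definition Delta :: "real \<Rightarrow> real \<Rightarrow> real^3 \<Rightarrow> real" where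
  "Delta m a x = (norm x)\<^sup>2 - 2 * m * norm x + a\<^sup>2"

definition kerr_K :: "real \<Rightarrow> real \<Rightarrow> real^3 \<Rightarrow> real" where
  "kerr_K m a x = 2 * m * norm x / rho2 a x"

definition sin2 :: "real^3 \<Rightarrow> real" where
  "sin2 x = ((x $ 1)\<^sup>2 + (x $ 2)\<^sup>2) / (norm x)\<^sup>2"

text \<open>The field generating rotations about the axis, that is, the coordinate field of
  \<phi>.\<close>

definition axial :: "real^3 \<Rightarrow> real^3" where
  "axial x = vector [- x $ 2, x $ 1, 0]"

lemma norm3: "(norm (x::real^3))\<^sup>2 = (x $ 1)\<^sup>2 + (x $ 2)\<^sup>2 + (x $ 3)\<^sup>2"
  unfolding power2_norm_eq_inner by (simp add: inner_vec_def sum_3 power2_eq_square)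

lemma inner3: "(x::real^3) \<bullet> y = x $ 1 * y $ 1 + x $ 2 * y $ 2 + x $ 3 * y $ 3"
  by (simp add: inner_vec_def sum_3)

lemma rho2_sin2:
  assumes "x \<noteq> 0"
  shows "rho2 a x = (norm x)\<^sup>2 + a\<^sup>2 - a\<^sup>2 * sin2 x"
proof -
  have "(x $ 3)\<^sup>2 = (norm x)\<^sup>2 - ((x $ 1)\<^sup>2 + (x $ 2)\<^sup>2)" by (simp add: norm3)
  then have "(x $ 3 / norm x)\<^sup>2 = 1 - sin2 x"
    using assms by (simp add: sin2_def power_divide diff_divide_distrib)
  then show ?thesis unfolding rho2_def by (simp only:) (simp add: algebra_simps)
qed

lemma rho2_pos: "x \<noteq> 0 \<Longrightarrow> 0 < rho2 a x"
  by (simp add: rho2_def add_pos_nonneg)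

lemma sin2_nonneg: "0 \<le> sin2 x" by (simp add: sin2_def)

lemma omega_linear: "omega x (u + v) = omega x u + omega x v" "omega x (c *\<^sub>R u) = c * omega x u"
  by (simp_all add: omega_def algebra_simps add_divide_distrib diff_divide_distrib)

lemma omega_zero: "omega x 0 = 0" by (simp add: omega_def)

lemma omega_self: "omega x x = 0" by (simp add: omega_def)

lemma omega_axial: "omega x (axial x) = sin2 x"
  by (simp add: omega_def axial_def vector_3 sin2_def power2_eq_square)

lemma axial_inner: "x \<noteq> 0 \<Longrightarrow> axial x \<bullet> u = (norm x)\<^sup>2 * omega x u" "x \<bullet> axial x = 0"
  by (simp_all add: inner3 axial_def vector_3 omega_def)

lemma kerr_apply:
  "kerr m a p v w =
     - (1 - kerr_K m a (snd p)) * fst v * fst w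
     - a * kerr_K m a (snd p) * (fst v * omega (snd p) (snd w) + omega (snd p) (snd v) * fst w)
     + (rho2 a (snd p) / Delta m a (snd p)) * ((snd p \<bullet> snd v) * (snd p \<bullet> snd w) / (norm (snd p))\<^sup>2)
     + (rho2 a (snd p) / (norm (snd p))\<^sup>2) * (snd v \<bullet> snd w - (snd p \<bullet> snd v) * (snd p \<bullet> snd w) / (norm (snd p))\<^sup>2)
     + a\<^sup>2 * (1 + kerr_K m a (snd p)) * omega (snd p) (snd v) * omega (snd p) (snd w)"
  unfolding kerr_def Let_def split_beta kerr_K_def rho2_def[symmetric] Delta_def[symmetric] omega_def[symmetric]
  by (simp add: power2_eq_square mult.commute mult.left_commute)

lemma kerr_bilinear: "bilinear (kerr m a p)"
  unfolding bilinear_def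
  by (auto intro!: linearI simp: kerr_apply omega_linear inner_add_left inner_add_right algebra_simps
      add_divide_distrib diff_divide_distrib)

lemma kerr_sym: "kerr m a p v w = kerr m a p w v"
  by (simp add: kerr_apply inner_commute mult.commute mult.left_commute)

lemmas kerr_lin = bilinear_ladd[OF kerr_bilinear] bilinear_lmul[OF kerr_bilinear, unfolded real_scaleR_def]
  bilinear_radd[OF kerr_bilinear] bilinear_rmul[OF kerr_bilinear, unfolded real_scaleR_def]
  bilinear_lneg[OF kerr_bilinear] bilinear_rneg[OF kerr_bilinear] bilinear_lsub[OF kerr_bilinear] bilinear_rsub[OF kerr_bilinear]
  bilinear_lzero[OF kerr_bilinear] bilinear_rzero[OF kerr_bilinear]

lemma kerr_radial:
  assumes "x \<noteq> 0"
  shows "kerr m a (t, x) (0, x) w = rho2 a x / Delta m a x * (x \<bullet> snd w)"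
  using assms by (simp add: kerr_apply omega_self power2_norm_eq_inner)

lemma kerr_time: "kerr m a (t, x) (1, 0) w = - (1 - kerr_K m a x) * fst w - a * kerr_K m a x * omega x (snd w)"
  by (simp add: kerr_apply omega_zero)

lemma kerr_space:
  "kerr m a (t, x) (0, y) w = - a * kerr_K m a x * omega x y * fst w
     + (rho2 a x / Delta m a x) * ((x \<bullet> y) * (x \<bullet> snd w) / (norm x)\<^sup>2)
     + (rho2 a x / (norm x)\<^sup>2) * (y \<bullet> snd w - (x \<bullet> y) * (x \<bullet> snd w) / (norm x)\<^sup>2)
     + a\<^sup>2 * (1 + kerr_K m a x) * omega x y * omega x (snd w)"
  by (simp add: kerr_apply)

lemma kerr_axial:
  assumes "x \<noteq> 0"
  shows "kerr m a (t, x) (0, axial x) w = - a * kerr_K m a x * sin2 x * fst w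
     + (rho2 a x + a\<^sup>2 * (1 + kerr_K m a x) * sin2 x) * omega x (snd w)"
  using assms by (simp add: kerr_apply omega_axial axial_inner algebra_simps)

text \<open>\<open>Delta\<close> is \<open>(r - m)\<^sup>2 - (m\<^sup>2 - a\<^sup>2)\<close> with
  \<open>r = norm x\<close>, and \<open>r_plus\<close> is its larger root.\<close>

lemma exterior_pos:
  assumes "\<bar>a\<bar> \<le> m" "r_plus m a < norm x"
  shows "x \<noteq> 0" "0 < Delta m a x"
proof -
  have s: "0 \<le> m\<^sup>2 - a\<^sup>2" using power_mono[OF assms(1), of 2] by simp
  then have 0: "0 \<le> sqrt (m\<^sup>2 - a\<^sup>2)" by simp
  have "0 \<le> r_plus m a" unfolding r_plus_def using 0 assms(1) by linarith
  then show "x \<noteq> 0" using assms(2) by auto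
  have "sqrt (m\<^sup>2 - a\<^sup>2) < norm x - m" using assms(2) by (simp add: r_plus_def)
  then have "(sqrt (m\<^sup>2 - a\<^sup>2))\<^sup>2 < (norm x - m)\<^sup>2" using 0 by (intro power_strict_mono) auto
  then show "0 < Delta m a x" using s by (simp add: Delta_def power2_eq_square algebra_simps)
qed

text \<open>Origin: with T and P the coordinate fields of t and \<phi>, \<open>rho2\<close> times
  the inverse metric is Carter's sum of squares, Delta (d/dr)^2 + (d/d\<theta>)^2 + (P + a sin^2
  T)^2 / sin^2 - ((r^2 + a^2) T + a P)^2 / Delta. \<open>A\<close> is the value of the covector on
  P, and \<open>Q\<close> its value on the last field divided by Delta. The singular 1 / sin^2
  disappears into the Euclidean vector \<open>(0, y)\<close>, whose radial part the first summand
  corrects.\<close>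

definition kerr_inv :: "real \<Rightarrow> real \<Rightarrow> spacetime \<Rightarrow> spacetime \<Rightarrow> spacetime" where
  "kerr_inv m a p b =
     (let x = snd p; l = fst b; y = snd b; r2 = (norm x)\<^sup>2; A = r2 * omega x y; Q = ((r2 + a\<^sup>2) * l + a * A) / Delta m a x in
      (((Delta m a x - r2) * (x \<bullet> y) / r2) / rho2 a x) *\<^sub>R (0, x) + (r2 / rho2 a x) *\<^sub>R (0, y)
      + ((a * A + a\<^sup>2 * sin2 x * l - (r2 + a\<^sup>2) * Q) / rho2 a x) *\<^sub>R (1, 0)
      + ((a * l - a * Q) / rho2 a x) *\<^sub>R (0, axial x))"

text \<open>The inversion in the plane of t and \<phi>, cleared of denominators. The second
  assumption ties the mass term \<open>K\<close> to \<open>\<Delta>\<close>; it is what makes the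
  coefficients of \<open>Q\<close> collapse.\<close>

lemma kerr_inv_algebra:
  fixes K r2 s2 \<rho> \<Delta> l A dt B Q a oy :: real
  assumes "\<rho> = r2 + a\<^sup>2 - a\<^sup>2 * s2" "\<Delta> = r2 + a\<^sup>2 - K * \<rho>" "Q * \<Delta> = (r2 + a\<^sup>2) * l + a * A" "A = r2 * oy"
  shows "r2 * (- a * K * oy * dt + a\<^sup>2 * (1 + K) * oy * B)
     + (a * A + a\<^sup>2 * s2 * l - (r2 + a\<^sup>2) * Q) * (- (1 - K) * dt - a * K * B)
     + (a * l - a * Q) * (- a * K * s2 * dt + (\<rho> + a\<^sup>2 * (1 + K) * s2) * B) = \<rho> * l * dt"
  using assms by algebra

lemma kerr_inverse:
  assumes x: "x \<noteq> 0" and D: "0 < Delta m a x"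
  shows "kerr m a (t, x) (kerr_inv m a (t, x) b) w = b \<bullet> w"
proof -
  define r2 where "r2 = (norm x)\<^sup>2"
  define \<rho> where "\<rho> = rho2 a x"
  define \<Delta> where "\<Delta> = Delta m a x"
  define K where "K = kerr_K m a x"
  define l y dt u where "l = fst b" "y = snd b" "dt = fst w" "u = snd w"
  define A where "A = r2 * omega x y"
  define Q where "Q = ((r2 + a\<^sup>2) * l + a * A) / \<Delta>"
  note defs = r2_def \<rho>_def \<Delta>_def K_def l_y_dt_u_def A_def Q_def
  have pos: "0 < r2" "0 < \<rho>" "0 < \<Delta>" using x D by (auto simp: r2_def \<rho>_def \<Delta>_def rho2_pos)
  have KD: "\<Delta> = r2 + a\<^sup>2 - K * \<rho>" using pos by (simp add: defs Delta_def kerr_K_def)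
  have QD: "Q * \<Delta> = (r2 + a\<^sup>2) * l + a * A" using pos by (simp add: Q_def)
  have alg: "r2 * (- a * K * omega x y * dt + a\<^sup>2 * (1 + K) * omega x y * omega x u)
     + (a * A + a\<^sup>2 * sin2 x * l - (r2 + a\<^sup>2) * Q) * (- (1 - K) * dt - a * K * omega x u)
     + (a * l - a * Q) * (- a * K * sin2 x * dt + (\<rho> + a\<^sup>2 * (1 + K) * sin2 x) * omega x u) = \<rho> * l * dt"
    by (rule kerr_inv_algebra[OF _ KD QD A_def]) (simp add: \<rho>_def r2_def rho2_sin2[OF x])
  have "kerr m a (t, x) (kerr_inv m a (t, x) b) w =
      ((\<Delta> - r2) * (x \<bullet> y) / r2) / \<rho> * (\<rho> / \<Delta> * (x \<bullet> u))
      + (r2 / \<rho>) * (- a * K * omega x y * dt + (\<rho> / \<Delta>) * ((x \<bullet> y) * (x \<bullet> u) / r2) + (\<rho> / r2) * (y \<bullet> u - (x \<bullet> y) * (x \<bullet> u) / r2)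
          + a\<^sup>2 * (1 + K) * omega x y * omega x u)
      + (a * A + a\<^sup>2 * sin2 x * l - (r2 + a\<^sup>2) * Q) / \<rho> * (- (1 - K) * dt - a * K * omega x u)
      + (a * l - a * Q) / \<rho> * (- a * K * sin2 x * dt + (\<rho> + a\<^sup>2 * (1 + K) * sin2 x) * omega x u)"
    unfolding kerr_inv_def Let_def snd_conv fst_conv kerr_lin kerr_radial[OF x] kerr_time kerr_axial[OF x]
      r2_def[symmetric] \<rho>_def[symmetric] \<Delta>_def[symmetric] K_def[symmetric] l_y_dt_u_def[symmetric] A_def[symmetric] Q_def[symmetric]
    by (simp add: kerr_space[where y=y] r2_def \<rho>_def \<Delta>_def K_def l_y_dt_u_def(3,4) mult.commute mult.left_commute)
  also have "\<dots> = (\<rho> * l * dt) / \<rho> + y \<bullet> u"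
    unfolding alg[symmetric] using pos by (simp add: field_simps)
  finally show ?thesis using pos by (simp add: l_y_dt_u_def inner_prod_def)
qed

text \<open>The radial and angular parts are nonnegative, the latter by Cauchy-Schwarz, and they do
  not vanish together; what remains is a nonnegative multiple of the square of
  \<open>omega\<close>.\<close>

lemma kerr_spatial_pos:
  assumes x: "x \<noteq> 0" and D: "0 < Delta m a x" and m: "0 \<le> m" and u: "u \<noteq> 0"
  shows "0 < kerr m a (t, x) (0, u) (0, u)"
proof -
  have r: "0 < rho2 a x" using x by (rule rho2_pos)
  have cs: "(x \<bullet> u) * (x \<bullet> u) / (norm x)\<^sup>2 \<le> u \<bullet> u"
    using x Cauchy_Schwarz_ineq[of x u]
    by (simp add: power2_norm_eq_inner pos_divide_le_eq mult.commute flip: power2_eq_square)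
  have K: "0 \<le> kerr_K m a x" using r m by (simp add: kerr_K_def)
  have 3: "0 \<le> a\<^sup>2 * (1 + kerr_K m a x) * omega x u * omega x u"
    using K by (simp add: mult.assoc)
  have 2: "0 \<le> rho2 a x / (norm x)\<^sup>2 * (u \<bullet> u - (x \<bullet> u) * (x \<bullet> u) / (norm x)\<^sup>2)"
    using r cs by simp
  have "0 < rho2 a x / Delta m a x * ((x \<bullet> u) * (x \<bullet> u) / (norm x)\<^sup>2) + rho2 a x / (norm x)\<^sup>2 * (u \<bullet> u - (x \<bullet> u) * (x \<bullet> u) / (norm x)\<^sup>2)"
  proof (cases "x \<bullet> u = 0")
    case True
    then show ?thesis using r x u by simp
  next
    case False
    then have "0 < rho2 a x / Delta m a x * ((x \<bullet> u) * (x \<bullet> u) / (norm x)\<^sup>2)"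
      using r x D by (auto simp: zero_less_mult_iff linorder_neq_iff)
    then show ?thesis using 2 by linarith
  qed
  then show ?thesis using 3 by (simp add: kerr_apply)
qed

text \<open>Angular velocity of the zero angular momentum observers, -g(T, P) / g(P, P) for the
  coordinate fields T of t and P of \<phi>. The common factor \<open>sin2\<close> is cancelled,
  which keeps it smooth on the axis.\<close>

definition frame_drag :: "real \<Rightarrow> real \<Rightarrow> real^3 \<Rightarrow> real" where
  "frame_drag m a x = a * kerr_K m a x / (rho2 a x + a\<^sup>2 * (1 + kerr_K m a x) * sin2 x)"

definition zamo :: "real \<Rightarrow> real \<Rightarrow> real^3 \<Rightarrow> spacetime" where
  "zamo m a x = (1, frame_drag m a x *\<^sub>R axial x)"

lemma zamo_denom_pos:
  assumes "x \<noteq> 0" "0 \<le> m"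
  shows "0 < rho2 a x + a\<^sup>2 * (1 + kerr_K m a x) * sin2 x"
proof -
  have "0 \<le> kerr_K m a x" using assms rho2_pos[OF assms(1), of a] by (simp add: kerr_K_def)
  then show ?thesis using rho2_pos[OF assms(1), of a] sin2_nonneg[of x] by (simp add: add_pos_nonneg)
qed

text \<open>The drag is exactly what removes the \<phi> component, so the field is normal to the
  slices of constant time; the factor is the square of the lapse.\<close>

lemma kerr_zamo:
  assumes "x \<noteq> 0" "0 \<le> m"
  shows "kerr m a (t, x) (zamo m a x) w = - (Delta m a x / (rho2 a x + a\<^sup>2 * (1 + kerr_K m a x) * sin2 x)) * fst w"
proof -
  define X where "X = rho2 a x + a\<^sup>2 * (1 + kerr_K m a x) * sin2 x"
  have X: "0 < X" unfolding X_def by (rule zamo_denom_pos[OF assms])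
  have z: "zamo m a x = (1, 0) + frame_drag m a x *\<^sub>R (0, axial x)" by (simp add: zamo_def)
  have f: "frame_drag m a x * X = a * kerr_K m a x" using X by (simp add: frame_drag_def X_def)
  have D: "Delta m a x = (norm x)\<^sup>2 + a\<^sup>2 - kerr_K m a x * rho2 a x"
    using rho2_pos[OF assms(1), of a] by (simp add: Delta_def kerr_K_def)
  have "X * kerr m a (t, x) (zamo m a x) w = - Delta m a x * fst w"
    unfolding z kerr_lin kerr_time kerr_axial[OF assms(1)] X_def[symmetric]
    using f D X_def rho2_sin2[OF assms(1), of a] by algebra
  then show ?thesis unfolding X_def[symmetric] using X by (simp add: field_simps)
qed

lemma open_kerr_exterior: "open (kerr_exterior m a)"
proof -
  have "kerr_exterior m a = snd -` {x. r_plus m a < norm x}" by (auto simp: kerr_exterior_def)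
  moreover have "open {x::real^3. r_plus m a < norm x}" by (intro open_Collect_less continuous_intros)
  ultimately show ?thesis by (simp only: open_vimage_snd)
qed

lemma kerr_exterior_iff: "p \<in> kerr_exterior m a \<longleftrightarrow> r_plus m a < norm (snd p)"
  by (cases p) (simp add: kerr_exterior_def)

locale kerr_hole =
  fixes m a :: real
  assumes m: "0 < m" and a: "\<bar>a\<bar> \<le> m"
begin

lemma ext: "p \<in> kerr_exterior m a \<Longrightarrow> snd p \<noteq> 0" "p \<in> kerr_exterior m a \<Longrightarrow> 0 < Delta m a (snd p)"
  using exterior_pos[OF a, of "snd p"] by (auto simp: kerr_exterior_iff)

lemma smooth_coeffs:
  assumes "smooth_on S x" "\<And>z. z \<in> S \<Longrightarrow> r_plus m a < norm (x z)"
  shows "smooth_on S (\<lambda>z. norm (x z))" "smooth_on S (\<lambda>z. rho2 a (x z))" "smooth_on S (\<lambda>z. Delta m a (x z))"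
    "smooth_on S (\<lambda>z. kerr_K m a (x z))" "smooth_on S (\<lambda>z. sin2 (x z))"
    "smooth_on S u \<Longrightarrow> smooth_on S (\<lambda>z. omega (x z) (u z))" "smooth_on S (\<lambda>z. axial (x z))"
    "smooth_on S (\<lambda>z. frame_drag m a (x z))"
proof -
  have nz: "x z \<noteq> 0" if "z \<in> S" for z using exterior_pos[OF a assms(2)[OF that]] by simp
  have S: "open S" by (rule smooth_on_open[OF assms(1)])
  show n: "smooth_on S (\<lambda>z. norm (x z))" by (rule smooth_on_norm[OF assms(1) nz])
  show r: "smooth_on S (\<lambda>z. rho2 a (x z))"
    unfolding rho2_def using nz
    by (intro smooth_on_add smooth_on_power n smooth_on_mult smooth_on_const S smooth_on_divide smooth_on_nth assms(1)) auto
  show "smooth_on S (\<lambda>z. Delta m a (x z))"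
    unfolding Delta_def by (intro smooth_on_add smooth_on_diff smooth_on_power n smooth_on_mult smooth_on_const S)
  show K: "smooth_on S (\<lambda>z. kerr_K m a (x z))"
    unfolding kerr_K_def using rho2_pos[OF nz, of _ a]
    by (intro smooth_on_divide smooth_on_mult n r smooth_on_const S) force
  show s: "smooth_on S (\<lambda>z. sin2 (x z))"
    unfolding sin2_def using nz
    by (intro smooth_on_divide smooth_on_add smooth_on_power smooth_on_nth n assms(1)) auto
  show "smooth_on S (\<lambda>z. omega (x z) (u z))" if "smooth_on S u"
    unfolding omega_def using nz
    by (intro smooth_on_divide smooth_on_diff smooth_on_mult smooth_on_power smooth_on_nth n assms(1) that) auto
  show "smooth_on S (\<lambda>z. axial (x z))"
    unfolding axial_def by (intro smooth_on_vector_3 smooth_on_uminus smooth_on_nth assms(1) smooth_on_const S)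
  show "smooth_on S (\<lambda>z. frame_drag m a (x z))"
    unfolding frame_drag_def using zamo_denom_pos[OF nz, of _ m a] m
    by (intro smooth_on_divide smooth_on_add smooth_on_mult smooth_on_const S r K s) force
qed

lemma smooth_kerr:
  assumes "smooth_on S p" "smooth_on S u" "smooth_on S v" "\<And>z. z \<in> S \<Longrightarrow> p z \<in> kerr_exterior m a"
  shows "smooth_on S (\<lambda>z. kerr m a (p z) (u z) (v z))"
proof -
  note c = smooth_coeffs[of S "\<lambda>z. snd (p z)", OF smooth_on_snd[OF assms(1)]]
  have e: "r_plus m a < norm (snd (p z))" if "z \<in> S" for z using assms(4)[OF that] by (simp add: kerr_exterior_iff)
  have nz: "snd (p z) \<noteq> 0" "Delta m a (snd (p z)) \<noteq> 0" if "z \<in> S" for z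
    using ext[OF assms(4)[OF that]] by auto
  show ?thesis
    unfolding kerr_apply using nz
    by (intro smooth_on_add smooth_on_diff smooth_on_mult smooth_on_uminus smooth_on_divide smooth_on_power smooth_on_inner
        c e smooth_on_fst smooth_on_snd assms smooth_on_const smooth_on_open[OF assms(1)]) auto
qed

end

sublocale kerr_hole \<subseteq> metric_chart_inverse "kerr m a" "kerr_exterior m a" "kerr_inv m a"
proof
  show "kerr m a p (kerr_inv m a p b) w = b \<bullet> w" if "p \<in> kerr_exterior m a" for p b w
    using kerr_inverse[OF ext[OF that], of "fst p" b w] by simp
  then show "u = 0" if "p \<in> kerr_exterior m a" "\<And>v. kerr m a p u v = 0" for p u
    using that by (metis inner_eq_zero_iff kerr_sym)
  show "smooth_on (kerr_exterior m a) (\<lambda>p. kerr m a p u v)" for u v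
    by (rule smooth_kerr) (auto intro: smooth_on_ident smooth_on_const open_kerr_exterior)
  show "smooth_on (kerr_exterior m a) (\<lambda>p. kerr_inv m a p b)" for b
  proof -
    note c = smooth_coeffs[of "kerr_exterior m a" snd, OF smooth_on_snd[OF smooth_on_ident[OF open_kerr_exterior]] kerr_exterior_iff[THEN iffD1]]
    show ?thesis
      unfolding kerr_inv_def Let_def using ext rho2_pos[OF ext(1), of _ a]
      by (intro smooth_on_add smooth_on_diff smooth_on_mult smooth_on_divide smooth_on_power smooth_on_inner smooth_on_scaleR smooth_on_Pair
        c smooth_on_snd smooth_on_ident smooth_on_const open_kerr_exterior) force+
  qed
qed (auto simp: open_kerr_exterior kerr_bilinear kerr_sym)

subsection \<open>Isometries\<close>

text \<open>Smoothness may be checked on patches. This is needed for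
  \<open>mean_curv_smooth\<close>, where only local frames are available.\<close>

lemma Ck_on_local:
  assumes "open S"
  shows "(\<And>x. x \<in> S \<Longrightarrow> \<exists>T. open T \<and> x \<in> T \<and> Ck_on k T f) \<Longrightarrow> Ck_on k S f"
proof (induction k arbitrary: f)
  case 0
  then show ?case
    by (auto intro!: continuous_at_imp_continuous_on) (metis Ck_on.simps(1) continuous_on_eq_continuous_at)
next
  case (Suc k)
  have "f differentiable at x" if "x \<in> S" for x
    using Suc.prems[OF that] by auto
  moreover have "Ck_on k S (\<lambda>x. frechet_derivative f (at x) v)" for v
  proof (rule Suc.IH)
    fix x assume "x \<in> S"
    then show "\<exists>T. open T \<and> x \<in> T \<and> Ck_on k T (\<lambda>x. frechet_derivative f (at x) v)"
      using Suc.prems[of x] by auto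
  qed
  ultimately show ?case by simp
qed

lemma smooth_on_local:
  assumes "open S" "\<And>x. x \<in> S \<Longrightarrow> \<exists>T. x \<in> T \<and> smooth_on T f"
  shows "smooth_on S f"
  using assms unfolding smooth_on_def by (metis Ck_on_local)

context metric_chart
begin

context
  fixes \<sigma> A p
  assumes iso: "isometry_at \<sigma> A" and p: "p \<in> M"
begin

lemma iso_metric: "g (\<sigma> p) (A u) (A v) = g p u v"
  using iso p by (auto simp: isometry_at_def)

lemma iso_linear: "linear A"
  using iso by (auto simp: isometry_at_def intro: has_derivative_linear)

lemma iso_gram: "gram (g (\<sigma> p)) (A u) (A v) = gram (g p) u v"
  by (simp add: gram_def iso_metric)

lemma iso_mean_vec:
  "mean_vec g (\<sigma> p) (A u1) (A u2) (A z11) (A z12) (A z22) = A (mean_vec g p u1 u2 z11 z12 z22)"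
proof -
  note l = linear_add[OF iso_linear] linear_cmul[OF iso_linear] linear_diff[OF iso_linear] linear_neg[OF iso_linear]
  have t: "trace_vec g (\<sigma> p) (A u1) (A u2) (A z11) (A z12) (A z22) = A (trace_vec g p u1 u2 z11 z12 z22)"
    by (simp only: trace_vec_def iso_gram iso_metric christoffel_isometry[OF iso p] l)
  show ?thesis
    unfolding mean_vec_def t by (simp only: normal_proj_def iso_gram iso_metric l)
qed

end

lemma mean_vec_flip:
  assumes p: "p \<in> M"
  shows "mean_vec g p u1 (- u2) z11 (- z12) z22 = mean_vec g p u1 u2 z11 z12 z22"
proof -
  have gr: "gram (g p) u1 (- u2) = gram (g p) u1 u2" by (simp add: gram_def lin[OF p])
  have t: "trace_vec g p u1 (- u2) z11 (- z12) z22 = trace_vec g p u1 u2 z11 z12 z22"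
    unfolding trace_vec_def gr by (simp add: lin[OF p] christoffel_neg[OF p] algebra_simps)
  show ?thesis
    unfolding mean_vec_def t normal_proj_def gr by (simp add: lin[OF p] minus_divide_left flip: scaleR_minus_left)
qed

lemma smooth_gram:
  assumes "smooth_on S p" "smooth_on S u" "smooth_on S v" "\<And>z. z \<in> S \<Longrightarrow> p z \<in> M"
  shows "smooth_on S (\<lambda>z. gram (g (p z)) (u z) (v z))"
  unfolding gram_def by (intro smooth_on_diff smooth_on_mult smooth_on_power smooth_metric assms)

end

text \<open>The Willmore integrand as a density on the basis \<open>u1\<close>, \<open>u2\<close>:
  squared mean curvature times the area of their parallelogram.\<close>

definition surface_density :: "'m::euclidean_space metric \<Rightarrow> 'm \<Rightarrow> 'm \<Rightarrow> 'm \<Rightarrow> 'm \<Rightarrow> 'm \<Rightarrow> 'm \<Rightarrow> real" where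
  "surface_density g p u1 u2 z11 z12 z22 =
     g p (mean_vec g p u1 u2 z11 z12 z22) (mean_vec g p u1 u2 z11 z12 z22) * sqrt (gram (g p) u1 u2)"

lemma (in metric_chart) iso_surface_density:
  assumes "isometry_at \<sigma> A" "p \<in> M"
  shows "surface_density g (\<sigma> p) (A u1) (A u2) (A z11) (A z12) (A z22) = surface_density g p u1 u2 z11 z12 z22"
  by (simp only: surface_density_def iso_mean_vec[OF assms] iso_gram[OF assms] iso_metric[OF assms])

lemma (in metric_chart) surface_density_flip:
  assumes p: "p \<in> M"
  shows "surface_density g p u1 (- u2) z11 (- z12) z22 = surface_density g p u1 u2 z11 z12 z22"
  by (simp add: surface_density_def mean_vec_flip[OF p] gram_def lin[OF p])

context metric_chart_inverse
begin

lemma smooth_mean_vec: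
  assumes p: "smooth_on S p" "\<And>z. z \<in> S \<Longrightarrow> p z \<in> M"
    and u: "smooth_on S u1" "smooth_on S u2"
    and z: "smooth_on S z11" "smooth_on S z12" "smooth_on S z22"
    and nz: "\<And>z. z \<in> S \<Longrightarrow> gram (g (p z)) (u1 z) (u2 z) \<noteq> 0"
  shows "smooth_on S (\<lambda>z. mean_vec g (p z) (u1 z) (u2 z) (z11 z) (z12 z) (z22 z))"
proof -
  have S: "open S" by (rule smooth_on_open[OF p(1)])
  note gr = smooth_gram[OF p(1) u p(2)]
  have t: "smooth_on S (\<lambda>z. trace_vec g (p z) (u1 z) (u2 z) (z11 z) (z12 z) (z22 z))"
    unfolding trace_vec_def
    by (intro smooth_on_scaleR smooth_on_add smooth_on_diff smooth_on_divide smooth_metric smooth_christoffel gr p u z nz smooth_on_const S)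
  show ?thesis
    unfolding mean_vec_def normal_proj_def
    by (intro smooth_on_uminus smooth_on_scaleR smooth_on_diff smooth_on_divide smooth_on_mult smooth_metric gr t p u nz)
qed

lemma smooth_surface_density:
  assumes p: "smooth_on S p" "\<And>z. z \<in> S \<Longrightarrow> p z \<in> M"
    and u: "smooth_on S u1" "smooth_on S u2"
    and z: "smooth_on S z11" "smooth_on S z12" "smooth_on S z22"
    and pos: "\<And>z. z \<in> S \<Longrightarrow> 0 < gram (g (p z)) (u1 z) (u2 z)"
  shows "smooth_on S (\<lambda>z. surface_density g (p z) (u1 z) (u2 z) (z11 z) (z12 z) (z22 z))"
  unfolding surface_density_def
  by (intro smooth_on_mult smooth_metric smooth_mean_vec smooth_on_sqrt smooth_gram p u z pos less_imp_neq[OF pos, symmetric])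

end

text \<open>Rotations about the axis and reflections in meridian planes. The number
  \<open>\<delta>\<close> is the determinant of the horizontal part, so that \<open>omega\<close> is
  multiplied by \<open>\<delta>\<close>.\<close>

definition axial_iso :: "(real^3 \<Rightarrow> real^3) \<Rightarrow> real \<Rightarrow> bool" where
  "axial_iso L \<delta> \<longleftrightarrow> linear L \<and> (\<forall>x y. L x \<bullet> L y = x \<bullet> y) \<and> (\<forall>x. L x $ 3 = x $ 3) \<and>
     (\<forall>x u. L x $ 1 * L u $ 2 - L x $ 2 * L u $ 1 = \<delta> * (x $ 1 * u $ 2 - x $ 2 * u $ 1)) \<and> \<delta> * \<delta> = 1"

text \<open>Time is reversed together with orientation, so that the cross term of dt and
  \<open>omega\<close> is preserved.\<close>

definition lift_iso :: "(real^3 \<Rightarrow> real^3) \<Rightarrow> real \<Rightarrow> spacetime \<Rightarrow> spacetime" where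
  "lift_iso L \<delta> v = (\<delta> * fst v, L (snd v))"

lemma axial_iso_norm: "axial_iso L \<delta> \<Longrightarrow> norm (L x) = norm x"
  by (simp add: axial_iso_def norm_eq_sqrt_inner)

lemma axial_iso_surj:
  assumes "axial_iso L \<delta>"
  shows "surj L"
proof (rule linear_inj_imp_surj)
  show L: "linear L" using assms by (simp add: axial_iso_def)
  show "inj L" unfolding linear_injective_0[OF L] using axial_iso_norm[OF assms] by (metis norm_eq_zero)
qed

lemma kerr_lift_iso:
  assumes L: "axial_iso L \<delta>"
  shows "kerr m a ((c, 0) + lift_iso L \<delta> p) (lift_iso L \<delta> v) (lift_iso L \<delta> w) = kerr m a p v w"
proof -
  have n: "norm (L x) = norm x" "L x \<bullet> L y = x \<bullet> y" "rho2 a (L x) = rho2 a x" "Delta m a (L x) = Delta m a x"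
    "kerr_K m a (L x) = kerr_K m a x" "omega (L x) (L u) = \<delta> * omega x u" for x y u
    using L axial_iso_norm[OF L] by (auto simp: axial_iso_def rho2_def Delta_def kerr_K_def omega_def)
  have dd: "\<delta> * \<delta> = 1" using L by (simp add: axial_iso_def)
  have d: "\<delta> * fst v * (\<delta> * y) = fst v * y" "\<delta> * fst w * (\<delta> * y) = fst w * y" "\<delta> * omega x u * (\<delta> * y) = omega x u * y"
     "c * (\<delta> * fst v) * (\<delta> * fst w) = c * fst v * fst w" "c * (\<delta> * omega x u) * (\<delta> * y) = c * omega x u * y"
    "\<delta> * omega x u * (\<delta> * fst w) = omega x u * fst w" for x u y c
    using dd by algebra+
  show ?thesis
    by (simp only: kerr_apply lift_iso_def fst_conv snd_conv snd_add fst_add add_0 n d)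
qed

lemma lift_iso_linear:
  assumes "axial_iso L \<delta>"
  shows "linear (lift_iso L \<delta>)"
  using assms by (auto intro!: linearI simp: axial_iso_def lift_iso_def linear_add linear_cmul algebra_simps)

lemma lift_iso_has_derivative:
  assumes "axial_iso L \<delta>"
  shows "((\<lambda>p. c + lift_iso L \<delta> p) has_derivative lift_iso L \<delta>) (at p)"
  using has_derivative_add[OF has_derivative_const
    linear_imp_has_derivative[OF lift_iso_linear[OF assms]], of c] by simp

lemma kerr_isometry:
  assumes "kerr_hole m a" "axial_iso L \<delta>"
  shows "metric_chart.isometry_at (kerr m a) (kerr_exterior m a) (\<lambda>p. (c, 0) + lift_iso L \<delta> p) (lift_iso L \<delta>)"
proof -
  interpret kerr_hole m a by fact
  have "\<exists>w. v = lift_iso L \<delta> w" for v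
  proof -
    obtain y where "snd v = L y" using axial_iso_surj[OF assms(2)] by (metis surj_def)
    moreover have "\<delta> * (\<delta> * fst v) = fst v" using assms(2) by (simp add: axial_iso_def flip: mult.assoc)
    ultimately show ?thesis by (intro exI[of _ "(\<delta> * fst v, y)"]) (simp add: lift_iso_def prod_eq_iff)
  qed
  moreover have "(c, 0) + lift_iso L \<delta> p \<in> kerr_exterior m a" if "p \<in> kerr_exterior m a" for p
    using that by (simp add: kerr_exterior_iff lift_iso_def axial_iso_norm[OF assms(2)])
  ultimately show ?thesis
    unfolding isometry_at_def
    using lift_iso_has_derivative[OF assms(2)] kerr_lift_iso[OF assms(2)] by (auto simp: surj_def)
qed

definition reflect :: "real^3 \<Rightarrow> real^3 \<Rightarrow> real^3" where
  "reflect n x = x - (2 * (n \<bullet> x)) *\<^sub>R n"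

definition rot :: "real \<Rightarrow> real^3 \<Rightarrow> real^3" where
  "rot \<phi> x = vector [x $ 1 * cos \<phi> - x $ 2 * sin \<phi>, x $ 1 * sin \<phi> + x $ 2 * cos \<phi>, x $ 3]"

lemma axial_iso_reflect:
  assumes "n \<bullet> n = 1" "n $ 3 = 0"
  shows "axial_iso (reflect n) (- 1)"
proof -
  have n: "n $ 1 * n $ 1 + n $ 2 * n $ 2 = 1" using assms by (simp add: inner3)
  have 1: "reflect n x \<bullet> reflect n y = x \<bullet> y" for x y
    using assms(1) by (simp add: reflect_def inner_diff_left inner_diff_right inner_commute algebra_simps)
  have 2: "reflect n x $ 1 * reflect n u $ 2 - reflect n x $ 2 * reflect n u $ 1 = - 1 * (x $ 1 * u $ 2 - x $ 2 * u $ 1)" for x u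
    unfolding reflect_def vector_minus_component vector_scaleR_component inner3 assms(2) real_scaleR_def using n by algebra
  have 3: "linear (reflect n)"
    by (rule linearI) (auto simp: reflect_def inner_add_right algebra_simps scaleR_add_left)
  show ?thesis unfolding axial_iso_def using 1 2 3 assms(2) by (simp add: reflect_def)
qed

lemma axial_iso_rotate: "axial_iso (rot \<phi>) 1"
proof -
  have sc: "sin \<phi> * sin \<phi> + cos \<phi> * cos \<phi> = 1" using sin_cos_squared_add[of \<phi>] by (simp add: power2_eq_square)
  have 1: "rot \<phi> x \<bullet> rot \<phi> y = x \<bullet> y" for x y
    unfolding rot_def inner3 vector_3 using sc by algebra
  have 2: "rot \<phi> x $ 1 * rot \<phi> u $ 2 - rot \<phi> x $ 2 * rot \<phi> u $ 1 = 1 * (x $ 1 * u $ 2 - x $ 2 * u $ 1)" for x u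
    unfolding rot_def vector_3 using sc by algebra
  have 3: "linear (rot \<phi>)"
    by (rule linearI) (auto simp: rot_def vec_eq_iff forall_3 vector_3 algebra_simps)
  show ?thesis unfolding axial_iso_def using 1 2 3 by (simp add: rot_def vector_3)
qed

text \<open>The reflection in the plane through x and the axis; on the axis any such plane will do.\<close>

lemma meridian_basis_exists:
  assumes "x \<in> S2"
  obtains e n where "tangent_basis x e n" "n $ 3 = 0" "axial_iso (reflect n) (- 1)"
    "reflect n x = x" "reflect n e = e" "reflect n n = - n"
proof -
  obtain n where n: "n \<bullet> n = 1" "n $ 3 = 0" "n \<bullet> x = 0"
  proof (cases "x $ 1 = 0 \<and> x $ 2 = 0")
    case True
    then show ?thesis by (intro that[of "vector [1, 0, 0]"]) (auto simp: inner3 vector_3)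
  next
    case False
    define s where "s = sqrt ((x $ 1)\<^sup>2 + (x $ 2)\<^sup>2)"
    have s: "s * s = x $ 1 * x $ 1 + x $ 2 * x $ 2" by (simp add: s_def power2_eq_square)
    have "s \<noteq> 0" using False s by (metis mult_eq_0_iff sum_squares_eq_zero_iff)
    then have "x $ 1 * x $ 1 / (s * s) + x $ 2 * x $ 2 / (s * s) = 1"
      by (metis add_divide_distrib divide_self mult_eq_0_iff s)
    then show ?thesis
      by (intro that[of "vector [- x $ 2 / s, x $ 1 / s, 0]"]) (auto simp: inner3 vector_3)
  qed
  have x: "x \<bullet> x = 1" using assms by (simp add: norm_eq_1)
  define e where "e = cross3 n x"
  have "(norm e)\<^sup>2 = 1" using n x unfolding e_def norm_cross by (simp add: power2_norm_eq_inner)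
  then have e: "e \<bullet> e = 1" "x \<bullet> e = 0" "n \<bullet> e = 0" "e \<bullet> n = 0"
    by (auto simp: power2_norm_eq_inner e_def dot_cross_self)
  show ?thesis
    using n x e by (intro that[of e n]) (auto simp: tangent_basis_def axial_iso_reflect reflect_def inner_commute scaleR_2)
qed

lemma smooth_on_unit: "open S \<Longrightarrow> 0 \<notin> S \<Longrightarrow> smooth_on S (\<lambda>y::'a::euclidean_space. y /\<^sub>R norm y)"
  by (intro smooth_on_scaleR smooth_on_inverse smooth_on_norm smooth_on_ident) auto

section \<open>The 2-jet of a coordinate sphere\<close>

lemma sext_radial: "sext (\<lambda>x. R *\<^sub>R x) y = R *\<^sub>R (y /\<^sub>R norm y)"
  by (simp add: sext_def)

lemma radial_smooth: "smooth_on_S2 (\<lambda>x. R *\<^sub>R x)"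
  unfolding smooth_on_S2_def sext_radial[abs_def] by (intro smooth_on_scaleR smooth_on_unit smooth_on_const) auto

lemma radial_sderiv:
  assumes "y \<noteq> 0"
  shows "sderiv (\<lambda>x. R *\<^sub>R x) y w = R *\<^sub>R (inverse (norm y) *\<^sub>R w - ((y \<bullet> w) * inverse (norm y) ^ 3) *\<^sub>R y)"
proof -
  have "((\<lambda>y. R *\<^sub>R (inverse (norm y) *\<^sub>R y)) has_derivative
      (\<lambda>w. R *\<^sub>R (inverse (norm y) *\<^sub>R w - ((y \<bullet> w) * inverse (norm y) ^ 3) *\<^sub>R y))) (at y)"
    using assms
    by (auto intro!: derivative_eq_intros has_derivative_norm
        simp: fun_eq_iff sgn_div_norm power3_eq_cube inner_commute algebra_simps)
  then show ?thesis
    unfolding sderiv_def sext_radial[abs_def] by (rule frechet_derivative_eqI)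
qed

text \<open>In tangent directions only the second fundamental form of the round sphere survives, and
  it is purely radial.\<close>

lemma radial_hess:
  assumes "x \<in> S2" "x \<bullet> v = 0" "x \<bullet> w = 0"
  shows "hess (\<lambda>x. R *\<^sub>R x) x v w = - (R * (v \<bullet> w)) *\<^sub>R x"
proof -
  have x: "norm x = 1" "x \<noteq> 0" using assms(1) by auto
  have "((\<lambda>y. R *\<^sub>R (inverse (norm y) *\<^sub>R w - ((y \<bullet> w) * inverse (norm y) ^ 3) *\<^sub>R y)) has_derivative
      (\<lambda>v. R *\<^sub>R (- (v \<bullet> x) *\<^sub>R w - (v \<bullet> w - (x \<bullet> w) * (3 * (v \<bullet> x))) *\<^sub>R x - (x \<bullet> w) *\<^sub>R v))) (at x)"
    using x
    by (auto intro!: derivative_eq_intros has_derivative_norm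
        simp: fun_eq_iff sgn_div_norm inner_commute algebra_simps)
  moreover have "((\<lambda>y. sderiv (\<lambda>x. R *\<^sub>R x) y w) has_derivative (\<lambda>v. hess (\<lambda>x. R *\<^sub>R x) x v w)) (at x)"
    by (rule hess_has_derivative[OF radial_smooth x(2)])
  then have "((\<lambda>y. R *\<^sub>R (inverse (norm y) *\<^sub>R w - ((y \<bullet> w) * inverse (norm y) ^ 3) *\<^sub>R y)) has_derivative
      (\<lambda>v. hess (\<lambda>x. R *\<^sub>R x) x v w)) (at x)"
    by (rule has_derivative_transform_within_open[of _ _ _ _ "- {0}"]) (auto simp: x radial_sderiv)
  ultimately have "(\<lambda>v. R *\<^sub>R (- (v \<bullet> x) *\<^sub>R w - (v \<bullet> w - (x \<bullet> w) * (3 * (v \<bullet> x))) *\<^sub>R x - (x \<bullet> w) *\<^sub>R v))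
      = (\<lambda>v. hess (\<lambda>x. R *\<^sub>R x) x v w)"
    by (rule has_derivative_unique)
  from fun_cong[OF this, of v] have "hess (\<lambda>x. R *\<^sub>R x) x v w =
      R *\<^sub>R (- (v \<bullet> x) *\<^sub>R w - (v \<bullet> w - (x \<bullet> w) * (3 * (v \<bullet> x))) *\<^sub>R x - (x \<bullet> w) *\<^sub>R v)"
    by simp
  then show ?thesis using assms by (simp add: inner_commute)
qed

lemma coord_sphere_Pair: "coord_sphere t0 R = (\<lambda>x. (t0, R *\<^sub>R x))"
  by (simp add: coord_sphere_def[abs_def])

lemma sext_Pair: "sext (\<lambda>x. (t0, Y x)) = (\<lambda>y. (t0, sext Y y))"
  by (simp add: sext_def fun_eq_iff)

lemma coord_sphere_smooth: "smooth_on_S2 (coord_sphere t0 R)"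
  using radial_smooth[of R] unfolding smooth_on_S2_def coord_sphere_Pair sext_Pair
  by (intro smooth_on_Pair smooth_on_const) auto

lemma coord_sphere_sderiv:
  assumes "y \<noteq> 0"
  shows "sderiv (coord_sphere t0 R) y w = (0, sderiv (\<lambda>x. R *\<^sub>R x) y w)"
  unfolding coord_sphere_Pair sderiv_def[of "\<lambda>x. (t0, R *\<^sub>R x)"] sext_Pair
  by (rule frechet_derivative_eqI[OF has_derivative_Pair[OF has_derivative_const sext_has_derivative[OF radial_smooth assms]]])

lemma coord_sphere_hess:
  assumes "y \<noteq> 0"
  shows "hess (coord_sphere t0 R) y v w = (0, hess (\<lambda>x. R *\<^sub>R x) y v w)"
proof -
  have "((\<lambda>y. (0, sderiv (\<lambda>x. R *\<^sub>R x) y w)) has_derivative (\<lambda>v. (0, hess (\<lambda>x. R *\<^sub>R x) y v w))) (at y)"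
    by (rule has_derivative_Pair[OF has_derivative_const hess_has_derivative[OF radial_smooth assms]])
  then have "((\<lambda>y. sderiv (coord_sphere t0 R) y w) has_derivative (\<lambda>v. (0, hess (\<lambda>x. R *\<^sub>R x) y v w))) (at y)"
    by (rule has_derivative_transform_within_open[of _ _ _ _ "- {0}"]) (auto simp: assms coord_sphere_sderiv)
  then show ?thesis
    unfolding hess_def[of "coord_sphere t0 R"] sderiv_def by (rule frechet_derivative_eqI)
qed

lemma radial_tangent: "x \<in> S2 \<Longrightarrow> x \<bullet> v = 0 \<Longrightarrow> sderiv (\<lambda>x. R *\<^sub>R x) x v = R *\<^sub>R v"
  by (subst radial_sderiv) auto

lemma coord_sphere_tangent: "x \<in> S2 \<Longrightarrow> x \<bullet> v = 0 \<Longrightarrow> sderiv (coord_sphere t0 R) x v = (0, R *\<^sub>R v)"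
  by (subst coord_sphere_sderiv) (auto simp: radial_tangent)

lemma coord_sphere_hess_tangent:
  "x \<in> S2 \<Longrightarrow> x \<bullet> v = 0 \<Longrightarrow> x \<bullet> w = 0 \<Longrightarrow> hess (coord_sphere t0 R) x v w = (0, - (R * (v \<bullet> w)) *\<^sub>R x)"
  by (subst coord_sphere_hess) (auto simp: radial_hess)

subsection \<open>Symmetric surfaces\<close>

lemma smooth_on_S2_iff: "smooth_on_S2 f \<longleftrightarrow> smooth_on (- {0}) (\<lambda>y. f (y /\<^sub>R norm y))"
  by (simp add: smooth_on_S2_def sext_def[abs_def])

lemma unit_in_S2: "y \<noteq> 0 \<Longrightarrow> y /\<^sub>R norm y \<in> S2"
  by simp

lemma unit_inner_self: "(y::real^3) \<noteq> 0 \<Longrightarrow> (y /\<^sub>R norm y) \<bullet> (y /\<^sub>R norm y) = 1"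
  using unit_in_S2[of y] unfolding mem_sphere_0 norm_eq_1 by blast

lemma cross3_nonzero_exists:
  assumes "(y::real^3) \<noteq> 0"
  obtains n where "cross3 n y \<noteq> 0"
proof (rule ccontr)
  assume "\<not> thesis"
  then have "cross3 (axis 1 1) y = 0" "cross3 (axis 2 1) y = 0" using that by blast+
  then have "y = 0"
    by (simp add: cross3_def vec_eq_iff forall_3 vector_3 axis_def)
  then show False using assms by simp
qed

lemma bounded_bilinear_cross3: "bounded_bilinear cross3"
  using bilinear_conv_bounded_bilinear bilinear_cross by blast

lemma cross3_orthonormal:
  assumes "x \<bullet> x = 1" "e \<bullet> e = 1" "x \<bullet> e = 0"
  shows "cross3 x e \<bullet> cross3 x e = 1"
  using assms norm_cross[of x e] by (simp add: power2_norm_eq_inner)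

lemma smooth_on_cross3: "smooth_on S f \<Longrightarrow> smooth_on S g \<Longrightarrow> smooth_on S (\<lambda>x. cross3 (f x) (g x))"
  by (rule smooth_on_bilinear[OF bounded_bilinear_cross3])

text \<open>The sphere has no global smooth frame; locally there is one for every direction n that is
  not radial.\<close>

lemma local_tangent_frame:
  fixes y\<^sub>0 :: "real^3"
  assumes "y\<^sub>0 \<noteq> 0"
  obtains T e1 e2 where "open T" "y\<^sub>0 \<in> T" "T \<subseteq> - {0}" "smooth_on T e1" "smooth_on T e2"
    "\<And>y. y \<in> T \<Longrightarrow> tangent_basis (y /\<^sub>R norm y) (e1 y) (e2 y)"
proof -
  obtain n where n: "cross3 n y\<^sub>0 \<noteq> 0" using cross3_nonzero_exists[OF assms] .
  define T where "T = {y. cross3 n y \<noteq> 0}"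
  have T: "open T"
    unfolding T_def using bounded_bilinear.continuous_on[OF bounded_bilinear_cross3 continuous_on_const continuous_on_id]
    by (intro open_Collect_neq) auto
  have T0: "y \<noteq> 0" if "y \<in> T" for y using that by (auto simp: T_def)
  define e1 where "e1 y = cross3 n y /\<^sub>R norm (cross3 n y)" for y
  define e2 where "e2 y = cross3 (y /\<^sub>R norm y) (e1 y)" for y
  have s1: "smooth_on T e1"
    unfolding e1_def using T
    by (intro smooth_on_scaleR smooth_on_inverse smooth_on_norm smooth_on_cross3 smooth_on_const smooth_on_ident)
      (auto simp: T_def)
  have s2: "smooth_on T e2"
    unfolding e2_def using T T0 by (intro smooth_on_cross3 s1 smooth_on_unit) auto
  have "tangent_basis (y /\<^sub>R norm y) (e1 y) (e2 y)" if "y \<in> T" for y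
  proof -
    let ?x = "y /\<^sub>R norm y"
    have x: "?x \<bullet> ?x = 1" by (rule unit_inner_self[OF T0[OF that]])
    have 1: "e1 y \<bullet> e1 y = 1" unfolding e1_def using that by (intro unit_inner_self) (simp add: T_def)
    have x1: "?x \<bullet> e1 y = 0" by (simp add: e1_def dot_cross_self)
    have "e2 y \<bullet> e2 y = 1" unfolding e2_def by (rule cross3_orthonormal[OF x 1 x1])
    moreover have "?x \<bullet> e2 y = 0" "e1 y \<bullet> e2 y = 0"
      unfolding e2_def by (rule dot_cross_self)+
    ultimately show ?thesis using x 1 x1 by (simp add: tangent_basis_def)
  qed
  moreover have "y\<^sub>0 \<in> T" using n unfolding T_def by blast
  moreover have "T \<subseteq> - {0}" using T0 by blast
  ultimately show ?thesis by (intro that[OF T _ _ s1 s2])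
qed

text \<open>Two fields \<open>Z\<close> and \<open>Z'\<close> are carried along because time
  reversal exchanges the two null fields instead of preserving each.\<close>

lemma sderiv_equivariant:
  assumes Z: "smooth_on_S2 Z" "smooth_on_S2 Z'" and L: "linear L" "\<And>y. norm (L y) = norm y"
    and A: "bounded_linear A" and eq: "\<And>y. y \<in> S2 \<Longrightarrow> Z (L y) = c + A (Z' y)" and x: "x \<noteq> 0"
  shows "sderiv Z (L x) (L v) = A (sderiv Z' x v)"
proof -
  have Lx: "L x \<noteq> 0" using L(2)[of x] x by auto
  have "((\<lambda>y. sext Z (L y)) has_derivative (\<lambda>v. sderiv Z (L x) (L v))) (at x)"
    using has_derivative_compose[OF linear_imp_has_derivative[OF L(1)] sext_has_derivative[OF Z(1) Lx]] .
  moreover have "((\<lambda>y. c + A (sext Z' y)) has_derivative (\<lambda>v. A (sderiv Z' x v))) (at x)"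
    using has_derivative_add[OF has_derivative_const bounded_linear.has_derivative[OF A sext_has_derivative[OF Z(2) x]]] by simp
  then have "((\<lambda>y. sext Z (L y)) has_derivative (\<lambda>v. A (sderiv Z' x v))) (at x)"
  proof (rule has_derivative_transform_within_open[of _ _ _ _ "- {0}"])
    fix y :: "real^3" assume "y \<in> - {0}"
    then have "Z (L (y /\<^sub>R norm y)) = c + A (Z' (y /\<^sub>R norm y))" by (intro eq) auto
    then show "c + A (sext Z' y) = sext Z (L y)"
      by (simp add: sext_def L(2) linear_cmul[OF L(1)])
  qed (use x in auto)
  ultimately have "(\<lambda>v. sderiv Z (L x) (L v)) = (\<lambda>v. A (sderiv Z' x v))" by (rule has_derivative_unique)
  then show ?thesis by metis
qed

lemma sderiv_unique:
  assumes "(f has_derivative f') (at x)" "x \<in> S2" "\<And>y. y \<noteq> 0 \<Longrightarrow> f y = sext Z y"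
  shows "sderiv Z x v = f' v"
  unfolding sderiv_def
  by (rule frechet_derivative_eqI, rule has_derivative_transform_within_open[OF assms(1), of "- {0}"])
    (use assms(2,3) in auto)

lemma sderiv_add:
  "smooth_on_S2 Z \<Longrightarrow> smooth_on_S2 Z' \<Longrightarrow> x \<in> S2 \<Longrightarrow> sderiv (\<lambda>y. Z y + Z' y) x v = sderiv Z x v + sderiv Z' x v"
  by (rule sderiv_unique[OF has_derivative_add[OF sext_has_derivative sext_has_derivative]]) (auto simp: sext_def)

lemma sderiv_scaleR: "smooth_on_S2 Z \<Longrightarrow> x \<in> S2 \<Longrightarrow> sderiv (\<lambda>y. c *\<^sub>R Z y) x v = c *\<^sub>R sderiv Z x v"
  by (rule sderiv_unique[OF has_derivative_scaleR_right[OF sext_has_derivative]]) (auto simp: sext_def)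

lemma sderiv_mult_const:
  fixes Z :: "_ \<Rightarrow> real"
  shows "smooth_on_S2 Z \<Longrightarrow> x \<in> S2 \<Longrightarrow> sderiv (\<lambda>y. c * Z y) x v = c * sderiv Z x v"
  using sderiv_scaleR[of Z x c v] by simp

lemma sderiv_cong:
  assumes "smooth_on_S2 Z" "x \<in> S2" "\<And>y. y \<in> S2 \<Longrightarrow> Z y = Z' y"
  shows "sderiv Z' x v = sderiv Z x v"
  by (rule sderiv_unique[OF sext_has_derivative[OF assms(1)] assms(2)]) (use assms in \<open>auto simp: sext_def\<close>)

lemma sderiv_const: "x \<in> S2 \<Longrightarrow> sderiv (\<lambda>y. c) x v = 0"
  by (rule sderiv_unique[OF has_derivative_const]) (auto simp: sext_def)

context metric_chart
begin

lemma smooth_on_S2_metric: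
  assumes "smooth_on_S2 X" "smooth_on_S2 Z" "smooth_on_S2 Z'" "X ` S2 \<subseteq> M"
  shows "smooth_on_S2 (\<lambda>y. g (X y) (Z y) (Z' y))"
  using assms(1-3) unfolding smooth_on_S2_iff
  by (rule smooth_metric) (use assms(4) unit_in_S2 in blast)

text \<open>Freezing two of the three arguments identifies each partial differential; joint
  smoothness makes the total differential their sum.\<close>

lemma metric_joint_derivative:
  assumes p: "p \<in> M"
  shows "frechet_derivative (\<lambda>(q, u, w). g q u w) (at (p, u, w)) (p', u', w')
       = metric_deriv g p p' u w + g p u' w + g p u w'"
proof -
  have "open (M \<times> (UNIV :: ('m \<times> 'm) set))" using open_M by (intro open_Times) auto
  then have s: "smooth_on (M \<times> UNIV) (\<lambda>z. g (fst z) (fst (snd z)) (snd (snd z)))"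
    by (intro smooth_metric smooth_on_fst smooth_on_snd smooth_on_ident) auto
  let ?F = "\<lambda>z::'m \<times> 'm \<times> 'm. g (fst z) (fst (snd z)) (snd (snd z))"
  let ?D = "frechet_derivative ?F (at (p, u, w))"
  have z: "(p, u, w) \<in> M \<times> UNIV" using p by simp
  note D = smooth_on_has_derivative[OF s z]
  note l = has_derivative_linear[OF D]
  have "((\<lambda>q. (q, u, w)) has_derivative (\<lambda>h. (h, 0, 0))) (at p)" by (auto intro!: derivative_eq_intros simp: zero_prod_def)
  from has_derivative_unique[OF has_derivative_compose[OF this D, simplified] metric_has_derivative[OF p]]
  have 1: "?D (p', 0, 0) = metric_deriv g p p' u w" by metis
  have "((\<lambda>q. (p, q, w)) has_derivative (\<lambda>h. (0, h, 0))) (at u)" by (auto intro!: derivative_eq_intros)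
  from has_derivative_unique[OF has_derivative_compose[OF this D, simplified] linear_imp_has_derivative[of "\<lambda>q. g p q w"]]
  have 2: "?D (0, u', 0) = g p u' w" by (metis (mono_tags, lifting) lin1(1,2)[OF p] linearI real_scaleR_def)
  have "((\<lambda>q. (p, u, q)) has_derivative (\<lambda>h. (0, 0, h))) (at w)" by (auto intro!: derivative_eq_intros)
  from has_derivative_unique[OF has_derivative_compose[OF this D, simplified] linear_imp_has_derivative[of "\<lambda>q. g p u q"]]
  have 3: "?D (0, 0, w') = g p u w'" by (metis (mono_tags, lifting) lin2(1,2)[OF p] linearI real_scaleR_def)
  have "?D (p', u', w') = ?D ((p', 0, 0) + ((0, u', 0) + (0, 0, w')))" by simp
  also have "\<dots> = ?D (p', 0, 0) + (?D (0, u', 0) + ?D (0, 0, w'))"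
    by (simp only: linear_add[OF l])
  finally show ?thesis using 1 2 3 by (simp add: case_prod_beta')
qed

text \<open>Product rule along the surface: by the last identity of \<open>koszul_linear\<close>,
  the derivative of the metric itself splits into one Christoffel term for each field.\<close>

lemma metric_compatible:
  assumes X: "smooth_on_S2 X" "X ` S2 \<subseteq> M" and Z: "smooth_on_S2 Z" "smooth_on_S2 Z'" and x: "x \<in> S2"
  shows "sderiv (\<lambda>y. g (X y) (Z y) (Z' y)) x v = g (X x) (nabla g X Z x v) (Z' x) + g (X x) (Z x) (nabla g X Z' x v)"
proof -
  have x0: "x \<noteq> 0" using x by auto
  have p: "X x \<in> M" using X x by auto
  have "open (M \<times> (UNIV :: ('m \<times> 'm) set))" using open_M by (intro open_Times) auto
  then have s: "smooth_on (M \<times> UNIV) (\<lambda>(q, u, w). g q u w)"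
    unfolding case_prod_beta' by (intro smooth_metric smooth_on_fst smooth_on_snd smooth_on_ident) auto
  have "((\<lambda>y. (sext X y, sext Z y, sext Z' y)) has_derivative (\<lambda>v. (sderiv X x v, sderiv Z x v, sderiv Z' x v))) (at x)"
    by (intro has_derivative_Pair sext_has_derivative X Z x0)
  from frechet_derivative_compose[OF s this]
  have "((\<lambda>y. g (sext X y) (sext Z y) (sext Z' y)) has_derivative
      (\<lambda>v. metric_deriv g (X x) (sderiv X x v) (Z x) (Z' x) + g (X x) (sderiv Z x v) (Z' x) + g (X x) (Z x) (sderiv Z' x v))) (at x)"
    using p x by (simp add: sext_on_S2 metric_joint_derivative)
  then have "sderiv (\<lambda>y. g (X y) (Z y) (Z' y)) x v =
      metric_deriv g (X x) (sderiv X x v) (Z x) (Z' x) + g (X x) (sderiv Z x v) (Z' x) + g (X x) (Z x) (sderiv Z' x v)"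
    by (rule sderiv_unique[OF _ x]) (simp add: sext_def)
  then show ?thesis
    by (simp add: nabla_def lin[OF p] g_christoffel[OF p] sym[OF p, of "Z x" "christoffel _ _ _ _"] flip: koszul_linear(8)[OF p])
qed

end

context surface_point
begin

definition "koszul_h v w u = (sderiv (\<lambda>y. induced_metric g X y w u) x v
    + sderiv (\<lambda>y. induced_metric g X y v u) x w
    - sderiv (\<lambda>y. induced_metric g X y v w) x u) / 2"

text \<open>Candidate for the \<open>THE\<close> in \<open>nabla_h\<close>, again by Cramer's rule,
  in a form whose bilinearity can be read off.\<close>

definition "nabla_h_coords v w =
  ((h e2 e2 * koszul_h v w e1 - h e1 e2 * koszul_h v w e2) / D) *\<^sub>R e1
  + ((h e1 e1 * koszul_h v w e2 - h e1 e2 * koszul_h v w e1) / D) *\<^sub>R e2"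

lemma smooth_induced: "smooth_on_S2 (\<lambda>y. induced_metric g X y v w)"
  unfolding induced_metric_def using surf
  by (intro smooth_on_S2_metric smooth_on_S2_sderiv smooth_X) (auto simp: spacelike_surface_def)

lemma XS: "y \<in> S2 \<Longrightarrow> X y \<in> M"
  using surf by (auto simp: spacelike_surface_def)

lemma induced_linear:
  assumes y: "y \<in> S2"
  shows "induced_metric g X y (u + u') v = induced_metric g X y u v + induced_metric g X y u' v"
    "induced_metric g X y (c *\<^sub>R u) v = c * induced_metric g X y u v"
    "induced_metric g X y v (u + u') = induced_metric g X y v u + induced_metric g X y v u'"
    "induced_metric g X y v (c *\<^sub>R u) = c * induced_metric g X y v u"
    "induced_metric g X y u v = induced_metric g X y v u"
  using lin[OF XS[OF y]] sym[OF XS[OF y]] linear_add[OF sderiv_linear[OF smooth_X S2_nonzero[OF y]]]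
    linear_cmul[OF sderiv_linear[OF smooth_X S2_nonzero[OF y]]]
  by (auto simp: induced_metric_def)

lemma sderiv_induced_linear:
  "sderiv (\<lambda>y. induced_metric g X y (u + u') v) x w = sderiv (\<lambda>y. induced_metric g X y u v) x w + sderiv (\<lambda>y. induced_metric g X y u' v) x w"
  "sderiv (\<lambda>y. induced_metric g X y (c *\<^sub>R u) v) x w = c * sderiv (\<lambda>y. induced_metric g X y u v) x w"
  "sderiv (\<lambda>y. induced_metric g X y v (u + u')) x w = sderiv (\<lambda>y. induced_metric g X y v u) x w + sderiv (\<lambda>y. induced_metric g X y v u') x w"
  "sderiv (\<lambda>y. induced_metric g X y v (c *\<^sub>R u)) x w = c * sderiv (\<lambda>y. induced_metric g X y v u) x w"
  "sderiv (\<lambda>y. induced_metric g X y u v) x (w + w') = sderiv (\<lambda>y. induced_metric g X y u v) x w + sderiv (\<lambda>y. induced_metric g X y u v) x w'"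
  "sderiv (\<lambda>y. induced_metric g X y u v) x (c *\<^sub>R w) = c * sderiv (\<lambda>y. induced_metric g X y u v) x w"
proof -
  note add = sderiv_add[OF smooth_induced smooth_induced x_S2, symmetric]
  note sc = sderiv_mult_const[OF smooth_induced x_S2, symmetric]
  note c = sderiv_cong[OF smooth_induced x_S2]
  show "sderiv (\<lambda>y. induced_metric g X y (u + u') v) x w = sderiv (\<lambda>y. induced_metric g X y u v) x w + sderiv (\<lambda>y. induced_metric g X y u' v) x w"
    unfolding add by (rule c[symmetric]) (simp add: induced_linear)
  show "sderiv (\<lambda>y. induced_metric g X y v (u + u')) x w = sderiv (\<lambda>y. induced_metric g X y v u) x w + sderiv (\<lambda>y. induced_metric g X y v u') x w"
    unfolding add by (rule c[symmetric]) (simp add: induced_linear)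
  show "sderiv (\<lambda>y. induced_metric g X y (c *\<^sub>R u) v) x w = c * sderiv (\<lambda>y. induced_metric g X y u v) x w"
    unfolding sc by (rule c[symmetric]) (simp add: induced_linear)
  show "sderiv (\<lambda>y. induced_metric g X y v (c *\<^sub>R u)) x w = c * sderiv (\<lambda>y. induced_metric g X y v u) x w"
    unfolding sc by (rule c[symmetric]) (simp add: induced_linear)
  show "sderiv (\<lambda>y. induced_metric g X y u v) x (w + w') = sderiv (\<lambda>y. induced_metric g X y u v) x w + sderiv (\<lambda>y. induced_metric g X y u v) x w'"
    by (rule linear_add[OF sderiv_linear[OF smooth_induced x_nz]])
  show "sderiv (\<lambda>y. induced_metric g X y u v) x (c *\<^sub>R w) = c * sderiv (\<lambda>y. induced_metric g X y u v) x w"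
    using linear_cmul[OF sderiv_linear[OF smooth_induced x_nz]] by simp
qed

lemma koszul_h_linear:
  "koszul_h (v + v') w u = koszul_h v w u + koszul_h v' w u" "koszul_h (c *\<^sub>R v) w u = c * koszul_h v w u"
  "koszul_h v (w + w') u = koszul_h v w u + koszul_h v w' u" "koszul_h v (c *\<^sub>R w) u = c * koszul_h v w u"
  "koszul_h v w (u + u') = koszul_h v w u + koszul_h v w u'" "koszul_h v w (c *\<^sub>R u) = c * koszul_h v w u"
  unfolding koszul_h_def sderiv_induced_linear by (simp_all add: field_simps)

lemma nabla_h_coords_bilinear: "bilinear nabla_h_coords"
  unfolding bilinear_def nabla_h_coords_def
  by (auto intro!: linearI simp: koszul_h_linear algebra_simps add_divide_distrib diff_divide_distrib)

lemma nabla_h_coords_char: "x \<bullet> nabla_h_coords v w = 0" "x \<bullet> u = 0 \<Longrightarrow> h (nabla_h_coords v w) u = koszul_h v w u"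
proof -
  show "x \<bullet> nabla_h_coords v w = 0" by (simp add: nabla_h_coords_def inner_add_right tangent_e)
  have D: "D = h e1 e1 * h e2 e2 - h e1 e2 * h e1 e2" "D \<noteq> 0"
    using gram_pos by (auto simp: gram_def induced_metric_def power2_eq_square)
  define a b where "a = (h e2 e2 * koszul_h v w e1 - h e1 e2 * koszul_h v w e2) / D"
    and "b = (h e1 e1 * koszul_h v w e2 - h e1 e2 * koszul_h v w e1) / D"
  have ab: "a * D = h e2 e2 * koszul_h v w e1 - h e1 e2 * koszul_h v w e2"
    "b * D = h e1 e1 * koszul_h v w e2 - h e1 e2 * koszul_h v w e1"
    using D(2) by (simp_all add: a_def b_def)
  have n: "nabla_h_coords v w = a *\<^sub>R e1 + b *\<^sub>R e2" by (simp add: nabla_h_coords_def a_def b_def)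
  have "D * (a * h e1 e1 + b * h e1 e2) = D * koszul_h v w e1"
    "D * (a * h e1 e2 + b * h e2 e2) = D * koszul_h v w e2"
    using ab D(1) by algebra+
  then have e: "a * h e1 e1 + b * h e1 e2 = koszul_h v w e1" "a * h e1 e2 + b * h e2 e2 = koszul_h v w e2"
    by (simp_all only: mult_left_cancel[OF D(2)])
  show "h (nabla_h_coords v w) u = koszul_h v w u" if "x \<bullet> u = 0"
  proof -
    obtain c d where u: "u = c *\<^sub>R e1 + d *\<^sub>R e2" using tangent_basis_expand[OF basis \<open>x \<bullet> u = 0\<close>] by blast
    show ?thesis
      unfolding n u koszul_h_linear induced_linear(1-4)[OF x_S2] induced_linear(5)[OF x_S2, of e2 e1]
      unfolding e[symmetric] by (simp add: algebra_simps)
  qed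
qed

lemma nabla_h_unique:
  assumes "x \<bullet> z = 0" "\<And>u. x \<bullet> u = 0 \<Longrightarrow> h z u = koszul_h v w u"
  shows "nabla_h g X x v w = z"
  unfolding nabla_h_def koszul_h_def[symmetric]
proof (rule the_equality)
  fix z' assume z': "x \<bullet> z' = 0 \<and> (\<forall>u. x \<bullet> u = 0 \<longrightarrow> h z' u = koszul_h v w u)"
  have t: "x \<bullet> (z' - z) = 0" using z' assms(1) by (simp add: inner_diff_right)
  have "h z' (z' - z) = h z (z' - z)" using z' assms(2) t by simp
  moreover have "h z' (z' - z) = h (z' - z) (z' - z) + h z (z' - z)"
    by (simp flip: induced_linear(1)[OF x_S2])
  ultimately show "z' = z" using pos[OF t] by fastforce
qed (use assms in auto)

lemma nabla_h_eq: "nabla_h g X x v w = nabla_h_coords v w"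
  by (rule nabla_h_unique) (auto simp: nabla_h_coords_char)

text \<open>The covariant derivative \<open>T\<close> of an odd one-form is odd under
  \<open>L\<close> at the fixed point \<open>x\<close>. Invariance of the metric makes
  \<open>e1\<close> and \<open>e2\<close> orthogonal, so the trace needs only the two diagonal
  values of \<open>T\<close>; there the signs coming from \<open>e2\<close> cancel in pairs, and
  each value equals its own negative.\<close>

lemma div_h_odd:
  assumes s_lin: "\<And>y. y \<in> S2 \<Longrightarrow> linear (s y)" and s_smooth: "\<And>w. smooth_on_S2 (\<lambda>y. s y w :: real)"
    and L: "linear L" "\<And>y. norm (L y) = norm y" "\<And>v. x \<bullet> L v = x \<bullet> v" "L x = x" "\<And>v. L (L v) = v"
      "L e1 = e1" "L e2 = - e2"
    and s_odd: "\<And>y w. y \<in> S2 \<Longrightarrow> s (L y) (L w) = - s y w"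
    and h_even: "\<And>y v w. y \<in> S2 \<Longrightarrow> induced_metric g X (L y) (L v) (L w) = induced_metric g X y v w"
  shows "div_h g X s x = 0"
proof -
  have h: "h (L v) (L w) = h v w" for v w using h_even[OF x_S2] L(4) by simp
  have hd: "sderiv (\<lambda>y. induced_metric g X y (L v) (L w)) x (L u) = sderiv (\<lambda>y. induced_metric g X y v w) x u" for u v w
    using sderiv_equivariant[OF smooth_induced smooth_induced L(1,2) bounded_linear_ident, of _ _ 0 _ _ x u] h_even x_nz L(4)
    by simp
  have k: "koszul_h (L v) (L w) (L u) = koszul_h v w u" for v w u
    unfolding koszul_h_def hd ..
  have n: "nabla_h_coords (L v) (L w) = L (nabla_h_coords v w)" for v w
    unfolding nabla_h_eq[symmetric, of "L v"]
  proof (rule nabla_h_unique)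
    show "x \<bullet> L (nabla_h_coords v w) = 0" by (simp add: L nabla_h_coords_char)
    fix u assume u: "x \<bullet> u = 0"
    have "h (L (nabla_h_coords v w)) (L (L u)) = koszul_h v w (L u)"
      unfolding h using u by (intro nabla_h_coords_char) (simp add: L)
    also have "\<dots> = koszul_h (L v) (L w) (L (L u))" unfolding k ..
    finally show "h (L (nabla_h_coords v w)) u = koszul_h (L v) (L w) u" by (simp add: L)
  qed
  define T where "T v w = sderiv (\<lambda>y. s y w) x v - s x (nabla_h_coords v w)" for v w
  have sd: "sderiv (\<lambda>y. s y (w + w')) x v = sderiv (\<lambda>y. s y w) x v + sderiv (\<lambda>y. s y w') x v"
    "sderiv (\<lambda>y. s y (c *\<^sub>R w)) x v = c * sderiv (\<lambda>y. s y w) x v" for w w' v c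
  proof -
    show "sderiv (\<lambda>y. s y (w + w')) x v = sderiv (\<lambda>y. s y w) x v + sderiv (\<lambda>y. s y w') x v"
      unfolding sderiv_add[OF s_smooth s_smooth x_S2, symmetric]
      by (rule sderiv_cong[OF s_smooth x_S2, symmetric]) (simp add: linear_add[OF s_lin])
    show "sderiv (\<lambda>y. s y (c *\<^sub>R w)) x v = c * sderiv (\<lambda>y. s y w) x v"
      unfolding sderiv_mult_const[OF s_smooth x_S2, symmetric]
      by (rule sderiv_cong[OF s_smooth x_S2, symmetric]) (simp add: linear_cmul[OF s_lin])
  qed
  have T: "bilinear T"
    unfolding bilinear_def T_def
    by (auto intro!: linearI simp: sd linear_add[OF sderiv_linear[OF s_smooth x_nz]] linear_cmul[OF sderiv_linear[OF s_smooth x_nz]]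
        linear_add[OF s_lin[OF x_S2]] linear_cmul[OF s_lin[OF x_S2]] bilinear_ladd[OF nabla_h_coords_bilinear]
        bilinear_radd[OF nabla_h_coords_bilinear] bilinear_lmul[OF nabla_h_coords_bilinear]
        bilinear_rmul[OF nabla_h_coords_bilinear] algebra_simps)
  have T_odd: "T (L v) (L w) = - T v w" for v w
  proof -
    have "sderiv (\<lambda>y. s y (L w)) x (L v) = - sderiv (\<lambda>y. s y w) x v"
      using sderiv_equivariant[OF s_smooth s_smooth L(1,2) bounded_linear_minus[OF bounded_linear_ident], of "L w" 0 w x v] s_odd x_nz L(4)
      by simp
    moreover have "s x (L (nabla_h_coords v w)) = - s x (nabla_h_coords v w)"
      using s_odd[OF x_S2] L(4) by simp
    ultimately show ?thesis by (simp add: T_def n)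
  qed
  have "T e1 e1 = 0" using T_odd[of e1 e1] by (simp add: L)
  moreover have "T e2 e2 = 0"
    using T_odd[of e2 e2] by (simp add: L bilinear_lneg[OF T] bilinear_rneg[OF T])
  moreover have "h e1 e2 = 0"
    using h[of e1 e2] induced_linear(4)[OF x_S2, of e1 "- 1" e2] by (simp add: L)
  moreover have "div_h g X s x = (1 / D) *\<^sub>R (h e2 e2 *\<^sub>R T e1 e1 - h e1 e2 *\<^sub>R (T e1 e2 + T e2 e1) + h e1 e1 *\<^sub>R T e2 e2)"
    unfolding div_h_def nabla_h_eq T_def[symmetric] by (rule htrace_eq[OF T]) auto
  ultimately show ?thesis by simp
qed

end

subsection \<open>The mean curvature of coordinate spheres\<close>

locale kerr_sphere = kerr_hole +
  fixes t0 R :: real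
  assumes R: "r_plus m a < R"
begin

abbreviation "X \<equiv> coord_sphere t0 R"
abbreviation "K \<equiv> kerr m a"
abbreviation "E \<equiv> kerr_exterior m a"

lemma R_pos: "0 < R"
proof -
  have "0 \<le> m\<^sup>2 - a\<^sup>2" using power_mono[OF a, of 2] by simp
  then have "0 \<le> sqrt (m\<^sup>2 - a\<^sup>2)" by simp
  then show ?thesis using R m unfolding r_plus_def by linarith
qed

lemma X_apply: "X x = (t0, R *\<^sub>R x)" by (simp add: coord_sphere_def)

lemma norm_Rx: "x \<in> S2 \<Longrightarrow> norm (R *\<^sub>R x) = R" using R_pos by simp

lemma X_E: "x \<in> S2 \<Longrightarrow> X x \<in> E"
  using norm_Rx R by (simp add: kerr_exterior_iff X_apply)

lemma Rx: "x \<in> S2 \<Longrightarrow> R *\<^sub>R x \<noteq> 0" "x \<in> S2 \<Longrightarrow> 0 < Delta m a (R *\<^sub>R x)"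
  using ext[OF X_E] by (simp_all add: X_apply)

lemma X_smooth: "smooth_on_S2 X" by (rule coord_sphere_smooth)

lemma K_space_pos: "x \<in> S2 \<Longrightarrow> v \<noteq> 0 \<Longrightarrow> 0 < K (X x) (0, v) (0, v)"
  unfolding X_apply using kerr_spatial_pos[OF Rx] m by simp

lemma spacelike: "spacelike_surface K E X"
  unfolding spacelike_surface_def
proof (intro conjI ballI allI impI)
  fix x v assume x: "x \<in> S2" and v: "x \<bullet> v = 0 \<and> v \<noteq> 0"
  then show "0 < induced_metric K X x v v"
    using R_pos by (simp add: induced_metric_def coord_sphere_tangent K_space_pos)
qed (use X_smooth X_E in auto)

lemma point: "tangent_basis x e f \<Longrightarrow> surface_point K E X x e f"
  using spacelike by unfold_locales auto

lemma mean_curv_formula: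
  assumes b: "tangent_basis x e f"
  shows "mean_curv K X x = mean_vec K (X x) (0, R *\<^sub>R e) (0, R *\<^sub>R f) (0, - R *\<^sub>R x) 0 (0, - R *\<^sub>R x)"
proof -
  interpret P: surface_point K E X x e f by (rule point[OF b])
  have "e \<bullet> e = 1" "f \<bullet> f = 1" "e \<bullet> f = 0" "f \<bullet> e = 0"
    using b by (auto simp: tangent_basis_def inner_commute)
  then show ?thesis
    unfolding P.mean_curv_eq using P.x_S2 P.tangent_e
    by (simp add: coord_sphere_tangent coord_sphere_hess_tangent zero_prod_def)
qed

text \<open>The translation by \<open>t0 - \<delta> * t0\<close> is zero for a rotation; for a
  reflection it turns the lift into the reversal about \<open>t0\<close>, which keeps the sphere in
  its slice.\<close>

lemma sphere_iso:
  assumes "axial_iso L \<delta>"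
  shows "isometry_at (\<lambda>p. (t0 - \<delta> * t0, 0) + lift_iso L \<delta> p) (lift_iso L \<delta>)"
    "(t0 - \<delta> * t0, 0) + lift_iso L \<delta> (X x) = X (L x)"
proof -
  show "isometry_at (\<lambda>p. (t0 - \<delta> * t0, 0) + lift_iso L \<delta> p) (lift_iso L \<delta>)"
    by (rule kerr_isometry[OF kerr_hole_axioms assms])
  have "linear L" using assms by (simp add: axial_iso_def)
  then show "(t0 - \<delta> * t0, 0) + lift_iso L \<delta> (X x) = X (L x)"
    by (simp add: lift_iso_def X_apply linear_cmul)
qed

lemma axial_iso_S2: "axial_iso L \<delta> \<Longrightarrow> x \<in> S2 \<Longrightarrow> L x \<in> S2"
  by (simp add: axial_iso_norm)

lemma mean_curv_iso:
  assumes L: "axial_iso L \<delta>" and x: "x \<in> S2"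
  shows "mean_curv K X (L x) = lift_iso L \<delta> (mean_curv K X x)"
proof -
  obtain e f where b: "tangent_basis x e f" using meridian_basis_exists[OF x] by metis
  have lin: "linear L" using L by (simp add: axial_iso_def)
  have b': "tangent_basis (L x) (L e) (L f)" using b L by (simp add: tangent_basis_def axial_iso_def)
  have l: "lift_iso L \<delta> (0, R *\<^sub>R v) = (0, R *\<^sub>R L v)" "lift_iso L \<delta> (0, - R *\<^sub>R v) = (0, - R *\<^sub>R L v)" "lift_iso L \<delta> 0 = 0" for v
    by (simp_all add: lift_iso_def linear_cmul[OF lin] linear_neg[OF lin] linear_0[OF lin] zero_prod_def)
  show ?thesis
    using iso_mean_vec[OF sphere_iso(1)[OF L] X_E[OF x], of "(0, R *\<^sub>R e)" "(0, R *\<^sub>R f)" "(0, - R *\<^sub>R x)" 0 "(0, - R *\<^sub>R x)"]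
    unfolding mean_curv_formula[OF b] mean_curv_formula[OF b'] sphere_iso(2)[OF L] l .
qed

lemma normal_tangent: "x \<in> S2 \<Longrightarrow> is_normal K X x N \<Longrightarrow> x \<bullet> v = 0 \<Longrightarrow> K (X x) N (0, v) = 0"
proof -
  assume x: "x \<in> S2" and N: "is_normal K X x N" and v: "x \<bullet> v = 0"
  have "K (X x) N (sderiv X x v) = 0" using N by (simp add: is_normal_def)
  then have "K (X x) N (R *\<^sub>R (0, v)) = 0" using x v by (simp add: coord_sphere_tangent)
  then show ?thesis using R_pos by (simp only: kerr_lin mult_eq_0_iff) simp
qed

lemma K_radial:
  assumes x: "x \<in> S2"
  shows "K (X x) (0, x) w = rho2 a (R *\<^sub>R x) / Delta m a (R *\<^sub>R x) * (x \<bullet> snd w)"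
proof -
  have "R * K (X x) (0, x) w = K (X x) (R *\<^sub>R (0, x)) w" by (simp only: kerr_lin)
  also have "\<dots> = R * (rho2 a (R *\<^sub>R x) / Delta m a (R *\<^sub>R x) * (x \<bullet> snd w))"
    using kerr_radial[OF Rx(1)[OF x], of m a t0 w] by (simp add: X_apply)
  finally show ?thesis by (simp only: mult_left_cancel[OF less_imp_neq[OF R_pos, symmetric]])
qed

definition radial_sq :: "real^3 \<Rightarrow> real" where
  "radial_sq x = rho2 a (R *\<^sub>R x) / Delta m a (R *\<^sub>R x)"

lemma radial_sq_pos: "x \<in> S2 \<Longrightarrow> 0 < radial_sq x"
  using Rx rho2_pos by (simp add: radial_sq_def)

definition lapse_sq :: "real^3 \<Rightarrow> real" where
  "lapse_sq x = Delta m a (R *\<^sub>R x) / (rho2 a (R *\<^sub>R x) + a\<^sup>2 * (1 + kerr_K m a (R *\<^sub>R x)) * sin2 (R *\<^sub>R x))"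

lemma lapse_sq_pos: "x \<in> S2 \<Longrightarrow> 0 < lapse_sq x"
  using Rx zamo_denom_pos[OF Rx(1), of x m a] m by (simp add: lapse_sq_def)

abbreviation "W x \<equiv> zamo m a (R *\<^sub>R x)"

lemma K_zamo: "x \<in> S2 \<Longrightarrow> K (X x) (W x) w = - lapse_sq x * fst w"
  unfolding X_apply lapse_sq_def using kerr_zamo[OF Rx(1), of x m a t0 w] m by simp

lemma fst_zamo: "fst (W x) = 1" by (simp add: zamo_def)

lemma zamo_normal: "x \<in> S2 \<Longrightarrow> is_normal K X x (W x)"
  by (simp add: is_normal_def K_zamo coord_sphere_sderiv[OF S2_nonzero])

text \<open>The Euclidean tangential part of \<open>y\<close> is orthogonal to itself, because the
  radial direction is orthogonal to the sphere by \<open>K_radial\<close>; the metric of the slice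
  is positive definite, so this part vanishes.\<close>

lemma spatial_normal:
  assumes x: "x \<in> S2" and N: "is_normal K X x (0, y)"
  shows "y = (x \<bullet> y) *\<^sub>R x"
proof -
  define w where "w = y - (x \<bullet> y) *\<^sub>R x"
  have xw: "x \<bullet> w = 0" using x by (simp add: w_def inner_diff_right norm_eq_1)
  have e: "(0, w) = (0, y) - (x \<bullet> y) *\<^sub>R (0::real, x)" by (simp add: w_def)
  have "K (X x) (0, w) (0, w) = K (X x) (0, y) (0, w) - (x \<bullet> y) * K (X x) (0, x) (0, w)"
    using arg_cong[OF e, of "\<lambda>v. K (X x) v (0, w)"] by (simp only: kerr_lin)
  also have "\<dots> = 0" using normal_tangent[OF x N xw] K_radial[OF x, of "(0, w)"] xw by simp
  finally have "w = 0" using K_space_pos[OF x, of w] by fastforce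
  then show ?thesis by (simp add: w_def)
qed

text \<open>The normal plane is spanned by the radial direction and the slice normal. Since
  \<open>W x\<close> has time component 1, subtracting \<open>fst N *\<^sub>R W x\<close> leaves a
  spatial normal.\<close>

lemma normal_decompose:
  assumes x: "x \<in> S2" and N: "is_normal K X x N"
  obtains b where "N = (0, b *\<^sub>R x) + fst N *\<^sub>R W x"
proof -
  have n: "is_normal K X x (N - fst N *\<^sub>R W x)"
    using N zamo_normal[OF x] by (simp add: is_normal_def kerr_lin)
  have "N - fst N *\<^sub>R W x = (0, snd (N - fst N *\<^sub>R W x))"
    by (simp add: prod_eq_iff fst_zamo)
  then have "N - fst N *\<^sub>R W x = (0, (x \<bullet> snd (N - fst N *\<^sub>R W x)) *\<^sub>R x)"
    using spatial_normal[OF x] n by metis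
  then show ?thesis by (intro that[of "x \<bullet> snd (N - fst N *\<^sub>R W x)"]) (simp add: eq_diff_eq[symmetric] diff_eq_eq)
qed

lemma mean_curv_normal_X:
  assumes x: "x \<in> S2"
  shows "is_normal K X x (mean_curv K X x)"
proof -
  obtain e f where b: "tangent_basis x e f" using meridian_basis_exists[OF x] by metis
  show ?thesis by (rule surface_point.mean_curv_normal[OF point[OF b]])
qed

definition hc :: "real^3 \<Rightarrow> real" where "hc x = x \<bullet> snd (mean_curv K X x)"

text \<open>The reflection (t0 + t, y) to (t0 - t, Ly) in a meridian plane through x fixes the mean
  curvature vector at x, so the latter has no time component.\<close>

lemma mean_curv_radial:
  assumes x: "x \<in> S2"
  shows "mean_curv K X x = (0, hc x *\<^sub>R x)"
proof -
  obtain e n where n: "axial_iso (reflect n) (- 1)" "reflect n x = x" using meridian_basis_exists[OF x] by metis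
  have "fst (mean_curv K X x) = - fst (mean_curv K X x)"
    using mean_curv_iso[OF n(1) x] n(2) by (metis fst_conv lift_iso_def mult_minus1)
  then have f: "fst (mean_curv K X x) = 0" by simp
  then have "is_normal K X x (0, snd (mean_curv K X x))" using mean_curv_normal_X[OF x] by (metis prod.collapse)
  then show ?thesis using spatial_normal[OF x] f by (simp add: prod_eq_iff hc_def)
qed

lemma mean_curv_sq_X: "x \<in> S2 \<Longrightarrow> mean_curv_sq K X x = (hc x)\<^sup>2 * radial_sq x"
proof -
  assume x: "x \<in> S2"
  have e: "mean_curv K X x = hc x *\<^sub>R (0, x)" by (simp add: mean_curv_radial[OF x])
  have "x \<bullet> x = 1" using x by (simp add: norm_eq_1)
  then show ?thesis
    unfolding mean_curv_sq_def e kerr_lin K_radial[OF x] radial_sq_def by (simp add: power2_eq_square)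
qed

lemma slice_chart: "metric_chart (slice_metric m a t0) {x. r_plus m a < norm x}"
proof
  have e: "(t0, p) \<in> E" if "p \<in> {x. r_plus m a < norm x}" for p using that by (simp add: kerr_exterior_iff)
  show o: "open {x::real^3. r_plus m a < norm x}" by (intro open_Collect_less continuous_intros)
  show "bilinear (slice_metric m a t0 p)" for p
  proof -
    have "(0, v + w) = (0::real, v) + (0, w)" "(0, c *\<^sub>R v) = c *\<^sub>R (0::real, v)" for v w :: "real^3" and c by auto
    then show ?thesis
      unfolding bilinear_def slice_metric_def by (auto intro!: linearI simp only: kerr_lin real_scaleR_def)
  qed
  show "slice_metric m a t0 p u v = slice_metric m a t0 p v u" for p u v
    by (simp add: slice_metric_def kerr_sym)
  show "u = 0" if "p \<in> {x. r_plus m a < norm x}" "\<And>v. slice_metric m a t0 p u v = 0" for p u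
    using kerr_spatial_pos[of p m a u t0] ext[OF e[OF that(1)]] m that(2)[of u] by (force simp: slice_metric_def)
  show "smooth_on {x. r_plus m a < norm x} (\<lambda>q. slice_metric m a t0 q u v)" for u v
    unfolding slice_metric_def using e o
    by (intro smooth_kerr smooth_on_Pair smooth_on_const smooth_on_ident) auto
qed

text \<open>In slice directions the Koszul expression differentiates spatial metric coefficients
  along the slice only. The Christoffel vectors themselves would not compare so directly.\<close>

lemma slice_koszul:
  assumes p: "r_plus m a < norm p"
  shows "koszul (slice_metric m a t0) p u v w = koszul K (t0, p) (0, u) (0, v) (0, w)"
proof -
  interpret S: metric_chart "slice_metric m a t0" "{x. r_plus m a < norm x}" by (rule slice_chart)
  have "metric_deriv (slice_metric m a t0) p u v w = metric_deriv K (t0, p) (0, u) (0, v) (0, w)" for u v w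
  proof (rule S.metric_deriv_eqI)
    have "((\<lambda>p. (t0, p)) has_derivative (\<lambda>u. (0, u))) (at p)" by (auto intro!: derivative_eq_intros)
    from has_derivative_compose[OF this metric_has_derivative] p
    show "((\<lambda>q. K (t0, q) (0, v) (0, w)) has_derivative (\<lambda>u. metric_deriv K (t0, p) (0, u) (0, v) (0, w))) (at p)"
      by (simp add: kerr_exterior_iff)
  qed (use p in \<open>auto simp: slice_metric_def\<close>)
  then show ?thesis by (simp add: koszul_def)
qed

text \<open>Transfers the assumption on the scalar mean curvature in the slice to the spacetime
  vector. By \<open>g_mean_curv\<close> both mean curvature vectors pair equally with the radial
  normal, so \<open>hc x = 0\<close> would make the one in the slice vanish.\<close>

lemma hc_nonzero:
  assumes x: "x \<in> S2" and H: "slice_mean_curv m a t0 R x \<noteq> 0"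
  shows "hc x \<noteq> 0"
proof
  assume "hc x = 0"
  let ?\<gamma> = "slice_metric m a t0"
  let ?Y = "\<lambda>x. R *\<^sub>R x :: real^3"
  let ?S = "{x::real^3. r_plus m a < norm x}"
  interpret S: metric_chart ?\<gamma> ?S by (rule slice_chart)
  obtain e f where b: "tangent_basis x e f" using meridian_basis_exists[OF x] by metis
  interpret P: surface_point K E X x e f by (rule point[OF b])
  have "spacelike_surface ?\<gamma> ?S ?Y"
    unfolding spacelike_surface_def
  proof (intro conjI ballI allI impI)
    show "smooth_on_S2 ?Y" by (rule radial_smooth)
    show "?Y ` S2 \<subseteq> ?S" using norm_Rx R by auto
    fix x v :: "real^3" assume "x \<in> S2" "x \<bullet> v = 0 \<and> v \<noteq> 0"
    then show "0 < induced_metric ?\<gamma> ?Y x v v"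
      using K_space_pos[of x "R *\<^sub>R v"] R_pos by (simp add: induced_metric_def slice_metric_def radial_tangent X_apply)
  qed
  then interpret Q: surface_point ?\<gamma> ?S ?Y x e f
    using b by unfold_locales auto
  have N: "is_normal K X x (0, x)"
    unfolding P.is_normal_iff using x P.tangent_e by (simp add: K_radial coord_sphere_tangent)
  have N': "is_normal ?\<gamma> ?Y x x"
    unfolding Q.is_normal_iff using x P.tangent_e
    using K_radial[OF x, of "(0, R *\<^sub>R e)"] K_radial[OF x, of "(0, R *\<^sub>R f)"]
    by (simp add: radial_tangent slice_metric_def X_apply)
  have u: "sderiv X x e = (0, sderiv ?Y x e)" "sderiv X x f = (0, sderiv ?Y x f)"
    by (rule coord_sphere_sderiv[OF P.x_nz])+
  have "Q.D * ?\<gamma> (?Y x) (mean_curv ?\<gamma> ?Y x) x = P.D * K (X x) (mean_curv K X x) (0, x)"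
    using slice_koszul[of "R *\<^sub>R x"] norm_Rx[OF x] R
    by (subst P.g_mean_curv[OF N], subst Q.g_mean_curv[OF N'])
      (simp add: u coord_sphere_hess[OF P.x_nz] slice_metric_def X_apply)
  also have "\<dots> = 0" using mean_curv_radial[OF x] \<open>hc x = 0\<close> kerr_lin(9)[of m a "X x" "(0, x)"] by (simp add: zero_prod_def)
  finally have 0: "?\<gamma> (?Y x) (mean_curv ?\<gamma> ?Y x) x = 0" using Q.gram_pos by simp
  \<comment> \<open>A vector orthogonal to the tangent plane and to the radial normal is orthogonal
    to everything.\<close>
  have "mean_curv ?\<gamma> ?Y x = 0"
  proof (rule S.nondeg[OF Q.Xx])
    fix v
    define w where "w = v - (x \<bullet> v) *\<^sub>R x"
    have "x \<bullet> w = 0" using x by (simp add: w_def inner_diff_right norm_eq_1)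
    then have "R * ?\<gamma> (?Y x) (mean_curv ?\<gamma> ?Y x) w = 0"
      using Q.mean_curv_normal x unfolding is_normal_def by (metis S.lin2(2)[OF Q.Xx] radial_tangent)
    then have "?\<gamma> (?Y x) (mean_curv ?\<gamma> ?Y x) w = 0" using R_pos by simp
    then show "?\<gamma> (?Y x) (mean_curv ?\<gamma> ?Y x) v = 0"
      using 0 by (simp add: w_def S.lin[OF Q.Xx])
  qed
  then show False using H by (simp add: slice_mean_curv_def Let_def S.lin[OF Q.Xx])
qed

lemma smooth_on_S2_coeffs:
  "smooth_on_S2 (\<lambda>x. rho2 a (R *\<^sub>R x))" "smooth_on_S2 (\<lambda>x. Delta m a (R *\<^sub>R x))"
  "smooth_on_S2 (\<lambda>x. kerr_K m a (R *\<^sub>R x))" "smooth_on_S2 (\<lambda>x. sin2 (R *\<^sub>R x))" "smooth_on_S2 W"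
proof -
  have s: "smooth_on (- {0}) (\<lambda>y::real^3. R *\<^sub>R (y /\<^sub>R norm y))"
    by (intro smooth_on_scaleR smooth_on_unit smooth_on_const) auto
  have r: "r_plus m a < norm (R *\<^sub>R (y /\<^sub>R norm y))" if "y \<in> - {0}" for y :: "real^3"
    using norm_Rx[OF unit_in_S2, of y] that R by auto
  note c = smooth_coeffs[OF s r]
  show "smooth_on_S2 (\<lambda>x. rho2 a (R *\<^sub>R x))" "smooth_on_S2 (\<lambda>x. Delta m a (R *\<^sub>R x))"
    "smooth_on_S2 (\<lambda>x. kerr_K m a (R *\<^sub>R x))" "smooth_on_S2 (\<lambda>x. sin2 (R *\<^sub>R x))"
    unfolding smooth_on_S2_iff by (rule c; assumption)+
  show "smooth_on_S2 W"
    unfolding smooth_on_S2_iff zamo_def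
    by (intro smooth_on_Pair smooth_on_const smooth_on_scaleR c) auto
qed

lemma lapse_sq_smooth: "smooth_on_S2 lapse_sq"
  using smooth_on_S2_coeffs unfolding smooth_on_S2_iff lapse_sq_def
  by (intro smooth_on_divide smooth_on_add smooth_on_mult smooth_on_const)
    (use zamo_denom_pos[OF Rx(1)[OF unit_in_S2], of _ m a] m in force)+

text \<open>On a patch with a smooth frame the mean curvature is given by \<open>mean_vec\<close>,
  which is smooth where the Gram determinant does not vanish; such patches cover the punctured
  space.\<close>

lemma mean_curv_smooth: "smooth_on_S2 (mean_curv K X)"
  unfolding smooth_on_S2_iff
proof (rule smooth_on_local)
  fix y\<^sub>0 :: "real^3" assume "y\<^sub>0 \<in> - {0}"
  then obtain T e f where T: "open T" "y\<^sub>0 \<in> T" "T \<subseteq> - {0}" "smooth_on T e" "smooth_on T f"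
    "\<And>y. y \<in> T \<Longrightarrow> tangent_basis (y /\<^sub>R norm y) (e y) (f y)"
    using local_tangent_frame[of y\<^sub>0] by auto
  have u: "smooth_on T (\<lambda>y. y /\<^sub>R norm y)" using T by (intro smooth_on_unit) auto
  have "smooth_on T (\<lambda>y. mean_vec K (t0, R *\<^sub>R (y /\<^sub>R norm y)) (0, R *\<^sub>R e y) (0, R *\<^sub>R f y)
      (0, - R *\<^sub>R (y /\<^sub>R norm y)) 0 (0, - R *\<^sub>R (y /\<^sub>R norm y)))"
  proof (intro u smooth_mean_vec smooth_on_Pair smooth_on_scaleR smooth_on_const T)
    fix y assume y: "y \<in> T"
    then have x: "y /\<^sub>R norm y \<in> S2" using T(3) unit_in_S2 by blast
    then show "(t0, R *\<^sub>R (y /\<^sub>R norm y)) \<in> E" using X_E by (simp only: X_apply)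
    interpret P: surface_point K E X "y /\<^sub>R norm y" "e y" "f y" by (rule point[OF T(6)[OF y]])
    show "gram (K (t0, R *\<^sub>R (y /\<^sub>R norm y))) (0, R *\<^sub>R e y) (0, R *\<^sub>R f y) \<noteq> 0"
      using P.gram_pos unfolding coord_sphere_tangent[OF P.x_S2 P.tangent_e(1)] coord_sphere_tangent[OF P.x_S2 P.tangent_e(2)] X_apply by simp
  qed
  then have "smooth_on T (\<lambda>y. mean_curv K X (y /\<^sub>R norm y))"
    by (rule smooth_on_cong) (simp only: mean_curv_formula[OF T(6)] X_apply)
  then show "\<exists>T. y\<^sub>0 \<in> T \<and> smooth_on T (\<lambda>y. mean_curv K X (y /\<^sub>R norm y))" using T(2) by blast
qed auto

lemma mean_curv_sq_smooth: "smooth_on_S2 (mean_curv_sq K X)"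
  unfolding mean_curv_sq_def[abs_def]
  by (rule smooth_on_S2_metric[OF X_smooth mean_curv_smooth mean_curv_smooth]) (use X_E in auto)

end

locale kerr_sphere_nonminimal = kerr_sphere +
  assumes H: "x \<in> S2 \<Longrightarrow> slice_mean_curv m a t0 R x \<noteq> 0"
begin

lemma H_pos: "x \<in> S2 \<Longrightarrow> 0 < mean_curv_sq K X x"
  using hc_nonzero[OF _ H] radial_sq_pos by (simp add: mean_curv_sq_X)

lemma spacelike_mean_curv: "spacelike_mean_curv K E X"
  using spacelike H_pos by (simp add: spacelike_mean_curv_def)

text \<open>Explicit form of the dual vector: the future slice normal, rescaled from square length
  \<open>- lapse_sq x\<close> to \<open>- mean_curv_sq K X x\<close>.\<close>

definition "V x = sqrt (mean_curv_sq K X x / lapse_sq x) *\<^sub>R W x"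

text \<open>For uniqueness, orthogonality to the mean curvature kills the radial component because
  \<open>hc x\<close> is nonzero, the prescribed length fixes the time component up to sign, and
  future direction fixes the sign.\<close>

lemma dual:
  assumes x: "x \<in> S2"
  shows "dual_mean_curv K X x = V x"
  unfolding dual_mean_curv_def
proof (rule the_equality)
  have H0: "K (X x) (mean_curv K X x) N = hc x * (radial_sq x * (x \<bullet> snd N))" for N
  proof -
    have "K (X x) (mean_curv K X x) N = K (X x) (hc x *\<^sub>R (0, x)) N" by (simp add: mean_curv_radial[OF x])
    then show ?thesis by (simp only: kerr_lin K_radial[OF x] radial_sq_def)
  qed
  have xW: "x \<bullet> snd (W x) = 0" by (simp add: zamo_def axial_def inner3 vector_3)
  have q: "0 < mean_curv_sq K X x / lapse_sq x" using H_pos[OF x] lapse_sq_pos[OF x] by simp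
  have VV: "K (X x) (c *\<^sub>R W x) (c *\<^sub>R W x) = - (c\<^sup>2 * lapse_sq x)" for c
    by (simp add: kerr_lin K_zamo[OF x] fst_zamo power2_eq_square)
  show "is_normal K X x (V x) \<and> K (X x) (mean_curv K X x) (V x) = 0 \<and>
      K (X x) (V x) (V x) = - mean_curv_sq K X x \<and> 0 < fst (V x)"
    using zamo_normal[OF x] q lapse_sq_pos[OF x] H0 xW
    unfolding V_def VV by (simp add: is_normal_def kerr_lin fst_zamo)
  fix N assume N: "is_normal K X x N \<and> K (X x) (mean_curv K X x) N = 0 \<and>
      K (X x) N N = - mean_curv_sq K X x \<and> 0 < fst N"
  obtain b where b: "N = (0, b *\<^sub>R x) + fst N *\<^sub>R W x" using normal_decompose[OF x] N by metis
  have "snd N = b *\<^sub>R x + fst N *\<^sub>R snd (W x)" using arg_cong[OF b, of snd] by simp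
  moreover have "x \<bullet> x = 1" using x by (simp add: norm_eq_1)
  ultimately have "x \<bullet> snd N = b" using xW by (simp add: inner_add_right)
  moreover have "hc x * (radial_sq x * (x \<bullet> snd N)) = 0" using N H0 by metis
  ultimately have "b = 0" using hc_nonzero[OF x H[OF x]] radial_sq_pos[OF x] by auto
  then have N': "N = fst N *\<^sub>R W x" using trans[OF b, of "fst N *\<^sub>R W x"] by (simp flip: zero_prod_def)
  then have "(fst N)\<^sup>2 * lapse_sq x = mean_curv_sq K X x" using N VV[of "fst N"] by simp
  then have "(fst N)\<^sup>2 = mean_curv_sq K X x / lapse_sq x" using lapse_sq_pos[OF x] by (simp add: field_simps)
  then have "fst N = sqrt (mean_curv_sq K X x / lapse_sq x)" using N by (metis abs_of_pos real_sqrt_abs)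
  then show "N = V x" using N' by (simp add: V_def)
qed

lemma V_smooth: "smooth_on_S2 V"
  using smooth_on_S2_coeffs(5) mean_curv_sq_smooth lapse_sq_smooth
  unfolding V_def smooth_on_S2_iff
  by (intro smooth_on_scaleR smooth_on_sqrt smooth_on_divide)
    (use H_pos[OF unit_in_S2] lapse_sq_pos[OF unit_in_S2] in force)+

text \<open>Stand-ins for \<open>null_l\<close> and \<open>null_k\<close>, equal to them on the
  sphere, with the \<open>THE\<close> of the dual vector replaced by the smooth field
  \<open>V\<close>.\<close>

definition "l x = (V x + mean_curv K X x) /\<^sub>R sqrt (mean_curv_sq K X x)"
definition "k x = (V x - mean_curv K X x) /\<^sub>R sqrt (mean_curv_sq K X x)"

lemma null_frame: "x \<in> S2 \<Longrightarrow> null_l K X x = l x" "x \<in> S2 \<Longrightarrow> null_k K X x = k x"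
  by (simp_all add: null_l_def null_k_def l_def k_def dual)

lemma lk_smooth: "smooth_on_S2 l" "smooth_on_S2 k"
  using V_smooth mean_curv_smooth mean_curv_sq_smooth
  unfolding l_def k_def smooth_on_S2_iff
  by (intro smooth_on_scaleR smooth_on_add smooth_on_diff smooth_on_inverse smooth_on_sqrt;
    use H_pos[OF unit_in_S2] in force)+

end

subsection \<open>Time-flatness\<close>

lemma axial_iso_sin2:
  assumes "axial_iso L \<delta>"
  shows "sin2 (L x) = sin2 x"
proof -
  have s: "sin2 y = ((norm y)\<^sup>2 - (y $ 3)\<^sup>2) / (norm y)\<^sup>2" for y by (simp add: sin2_def norm3)
  show ?thesis using assms unfolding s axial_iso_norm[OF assms] by (simp add: axial_iso_def)
qed

lemma axial_iso_invariants:
  assumes "axial_iso L \<delta>"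
  shows "rho2 a (L x) = rho2 a x" "Delta m a (L x) = Delta m a x" "kerr_K m a (L x) = kerr_K m a x"
    "frame_drag m a (L x) = frame_drag m a x"
  using assms axial_iso_norm[OF assms] axial_iso_sin2[OF assms]
  by (auto simp: axial_iso_def rho2_def Delta_def kerr_K_def frame_drag_def)

text \<open>The rotation field represents the horizontal determinant form, hence the additional sign
  under a map that reverses orientation.\<close>

lemma axial_iso_axial:
  assumes L: "axial_iso L \<delta>"
  shows "axial (L y) = \<delta> *\<^sub>R L (axial y)"
proof (rule vector_eq_rdot[THEN iffD1], rule allI)
  fix u
  obtain w where w: "u = L w" using axial_iso_surj[OF L] by (metis surj_def)
  have *: "axial y \<bullet> w = y $ 1 * w $ 2 - y $ 2 * w $ 1" for y w
    by (simp add: inner3 axial_def vector_3)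
  have "axial (L y) \<bullet> L w = \<delta> * (axial y \<bullet> w)" using L unfolding * by (simp add: axial_iso_def)
  also have "\<dots> = (\<delta> *\<^sub>R L (axial y)) \<bullet> L w" using L by (simp add: axial_iso_def)
  finally show "axial (L y) \<bullet> u = (\<delta> *\<^sub>R L (axial y)) \<bullet> u" by (simp add: w)
qed

text \<open>The factor \<open>\<delta>\<close> is there because the lift may reverse time while
  \<open>zamo\<close> always points to the future.\<close>

lemma zamo_iso:
  assumes L: "axial_iso L \<delta>"
  shows "zamo m a (L y) = \<delta> *\<^sub>R lift_iso L \<delta> (zamo m a y)"
proof -
  have "linear L" "\<delta> * \<delta> = 1" using L by (auto simp: axial_iso_def)
  then show ?thesis
    by (simp add: zamo_def axial_iso_invariants[OF L] axial_iso_axial[OF L] lift_iso_def linear_cmul)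
qed

lemma smooth_on_S2_cong: "smooth_on_S2 f \<Longrightarrow> (\<And>y. y \<in> S2 \<Longrightarrow> f y = f' y) \<Longrightarrow> smooth_on_S2 f'"
  using smooth_on_cong[of "- {0}" "\<lambda>y. f (y /\<^sub>R norm y)" "\<lambda>y. f' (y /\<^sub>R norm y)"] unit_in_S2
  unfolding smooth_on_S2_iff by blast

lemma smooth_on_S2_divide_const: "smooth_on_S2 f \<Longrightarrow> smooth_on_S2 (\<lambda>y. f y / c :: real)"
  unfolding smooth_on_S2_iff divide_inverse by (intro smooth_on_mult smooth_on_const) auto

lemma smooth_on_S2_uminus: "smooth_on_S2 f \<Longrightarrow> smooth_on_S2 (\<lambda>y. - f y)"
  unfolding smooth_on_S2_iff by (rule smooth_on_uminus)

lemma sph_S2: "sph \<theta> \<phi> \<in> S2" by (simp add: norm_sph)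

context kerr_sphere
begin

lemma sderiv_X_iso:
  assumes L: "axial_iso L \<delta>" and y: "y \<in> S2"
  shows "sderiv X (L y) (L v) = lift_iso L \<delta> (sderiv X y v)"
proof (rule sderiv_equivariant[OF X_smooth X_smooth])
  show "linear L" using L by (simp add: axial_iso_def)
  show "bounded_linear (lift_iso L \<delta>)" using lift_iso_linear[OF L] by (simp add: linear_linear)
  show "X (L z) = (t0 - \<delta> * t0, 0) + lift_iso L \<delta> (X z)" for z by (rule sphere_iso(2)[OF L, symmetric])
qed (use y in \<open>auto simp: axial_iso_norm[OF L]\<close>)

lemma K_iso:
  assumes L: "axial_iso L \<delta>"
  shows "K (X (L y)) (lift_iso L \<delta> v) (lift_iso L \<delta> w) = K (X y) v w"
  using kerr_lift_iso[OF L, of m a "t0 - \<delta> * t0" "X y" v w] by (simp only: sphere_iso(2)[OF L])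

lemma induced_iso:
  assumes L: "axial_iso L \<delta>" and y: "y \<in> S2"
  shows "induced_metric K X (L y) (L v) (L w) = induced_metric K X y v w"
  by (simp only: induced_metric_def sderiv_X_iso[OF assms] K_iso[OF L])

lemma W_iso:
  assumes L: "axial_iso L \<delta>"
  shows "W (L y) = \<delta> *\<^sub>R lift_iso L \<delta> (W y)"
proof -
  have "R *\<^sub>R L y = L (R *\<^sub>R y)" using L by (simp add: axial_iso_def linear_cmul)
  then show ?thesis by (simp only: zamo_iso[OF L])
qed

lemma lapse_sq_iso:
  assumes L: "axial_iso L \<delta>"
  shows "lapse_sq (L y) = lapse_sq y"
proof -
  have "R *\<^sub>R L y = L (R *\<^sub>R y)" using L by (simp add: axial_iso_def linear_cmul)
  then show ?thesis by (simp only: lapse_sq_def axial_iso_invariants[OF L] axial_iso_sin2[OF L])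
qed

lemma mean_curv_sq_iso:
  "axial_iso L \<delta> \<Longrightarrow> y \<in> S2 \<Longrightarrow> mean_curv_sq K X (L y) = mean_curv_sq K X y"
  by (simp only: mean_curv_sq_def mean_curv_iso K_iso)

end

context kerr_sphere_nonminimal
begin

lemma V_iso:
  assumes L: "axial_iso L \<delta>" and y: "y \<in> S2"
  shows "V (L y) = \<delta> *\<^sub>R lift_iso L \<delta> (V y)"
  unfolding V_def
  by (simp only: W_iso[OF L] lapse_sq_iso[OF L] mean_curv_sq_iso[OF assms] linear_cmul[OF lift_iso_linear[OF L]]
      scaleR_scaleR mult.commute)

text \<open>The lift preserves the mean curvature field and negates the dual field, so their sum and
  difference trade places up to sign.\<close>

lemma lk_iso:
  assumes L: "axial_iso L (- 1)" and y: "y \<in> S2"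
  shows "l (L y) = - lift_iso L (- 1) (k y)" "k (L y) = - lift_iso L (- 1) (l y)"
proof -
  note A = lift_iso_linear[OF L]
  show "l (L y) = - lift_iso L (- 1) (k y)" "k (L y) = - lift_iso L (- 1) (l y)"
    unfolding l_def k_def
    by (simp_all add: V_iso[OF assms] mean_curv_iso[OF assms] mean_curv_sq_iso[OF assms] linear_cmul[OF A]
        linear_add[OF A] linear_diff[OF A] flip: scaleR_minus_right)
qed

lemma V_sq:
  assumes x: "x \<in> S2"
  shows "K (X x) (V x) (V x) = - mean_curv_sq K X x"
proof -
  define q where "q = mean_curv_sq K X x / lapse_sq x"
  have "0 < q" using H_pos[OF x] lapse_sq_pos[OF x] by (simp add: q_def)
  then have "sqrt q * (sqrt q * lapse_sq x) = q * lapse_sq x" by (simp flip: mult.assoc)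
  also have "\<dots> = mean_curv_sq K X x" using lapse_sq_pos[OF x] by (simp add: q_def)
  finally show ?thesis
    unfolding V_def kerr_lin K_zamo[OF x] q_def[symmetric] by (simp add: fst_zamo)
qed

lemma K_lk:
  assumes x: "x \<in> S2"
  shows "K (X x) (l x) (k x) = - 2"
proof -
  define c where "c = inverse (sqrt (mean_curv_sq K X x))"
  have "c * c * mean_curv_sq K X x = 1" using H_pos[OF x] by (simp add: c_def field_simps)
  moreover have "K (X x) (l x) (k x) = c * c * (- mean_curv_sq K X x - mean_curv_sq K X x)"
    unfolding l_def k_def kerr_lin c_def[symmetric] V_sq[OF x] kerr_sym[of m a "X x" "mean_curv K X x" "V x"]
    by (simp add: mean_curv_sq_def algebra_simps)
  ultimately show ?thesis by (simp add: algebra_simps)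
qed

lemma connection_form_eq:
  assumes y: "y \<in> S2"
  shows "connection_form K X y v = - K (X y) (k y) (nabla K X l y v) / 2"
proof -
  have "sderiv (null_l K X) y v = sderiv l y v"
    by (rule sderiv_cong[OF lk_smooth(1) y]) (simp only: null_frame)
  then show ?thesis by (simp only: connection_form_def nabla_def null_frame[OF y])
qed

lemma nabla_iso:
  assumes L: "axial_iso L (- 1)" and y: "y \<in> S2"
  shows "nabla K X l (L y) (L v) = - lift_iso L (- 1) (nabla K X k y v)"
proof -
  let ?A = "lift_iso L (- 1)"
  note A = lift_iso_linear[OF L]
  have "sderiv l (L y) (L v) = - ?A (sderiv k y v)"
  proof (rule sderiv_equivariant[OF lk_smooth])
    show "linear L" using L by (simp add: axial_iso_def)
    show "bounded_linear (\<lambda>v. - ?A v)" using A by (intro bounded_linear_minus) (simp add: linear_linear)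
    show "l (L z) = 0 + - ?A (k z)" if "z \<in> S2" for z using lk_iso(1)[OF L that] by simp
  qed (use y in \<open>auto simp: axial_iso_norm[OF L]\<close>)
  moreover have "christoffel K (X (L y)) (?A (sderiv X y v)) (?A (k y)) = ?A (christoffel K (X y) (sderiv X y v) (k y))"
    using christoffel_isometry[OF sphere_iso(1)[OF L] X_E[OF y]] by (simp only: sphere_iso(2)[OF L])
  ultimately show ?thesis
    using christoffel_neg[OF X_E[OF axial_iso_S2[OF L y]]]
    by (simp add: nabla_def sderiv_X_iso[OF assms] lk_iso[OF assms] linear_add[OF A])
qed

text \<open>The product of the null fields is the constant \<open>- 2\<close>, so its derivative
  vanishes and exchanging the two fields changes the sign of the connection form. The reflection
  does exchange them, and its two minus signs cancel.\<close>

lemma connection_form_odd: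
  assumes L: "axial_iso L (- 1)" and y: "y \<in> S2"
  shows "connection_form K X (L y) (L v) = - connection_form K X y v"
proof -
  have c: "smooth_on_S2 (\<lambda>y. - 2 :: real)"
    unfolding smooth_on_S2_iff by (rule smooth_on_const) auto
  have "sderiv (\<lambda>y. K (X y) (l y) (k y)) y v = 0"
    using sderiv_cong[OF c y, of "\<lambda>y. K (X y) (l y) (k y)" v] K_lk sderiv_const[OF y, of "- 2"] by simp
  then have "K (X y) (nabla K X l y v) (k y) + K (X y) (l y) (nabla K X k y v) = 0"
    using metric_compatible[OF X_smooth image_subsetI[OF X_E] lk_smooth y, of v] by linarith
  moreover have "K (X (L y)) (k (L y)) (nabla K X l (L y) (L v)) = K (X y) (l y) (nabla K X k y v)"
    unfolding lk_iso[OF assms] nabla_iso[OF assms] kerr_lin minus_minus K_iso[OF L] ..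
  ultimately show ?thesis
    unfolding connection_form_eq[OF y] connection_form_eq[OF axial_iso_S2[OF assms]]
    using kerr_sym[of m a "X y" "k y" "nabla K X l y v"] by simp
qed

lemma connection_form_linear:
  assumes y: "y \<in> S2"
  shows "linear (connection_form K X y)"
proof -
  have "connection_form K X y = (\<lambda>v. - K (X y) (k y) (nabla K X l y v) / 2)"
    using connection_form_eq[OF y] by blast
  moreover have "linear (\<lambda>v. - K (X y) (k y) (nabla K X l y v) / 2)"
    using y by (auto intro!: linearI simp: nabla_def kerr_lin linear_add[OF sderiv_linear] linear_cmul[OF sderiv_linear]
        X_smooth lk_smooth S2_nonzero christoffel_linear[OF X_E] field_simps)
  ultimately show ?thesis by simp
qed

lemma connection_form_smooth: "smooth_on_S2 (\<lambda>y. connection_form K X y w)"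
proof (rule smooth_on_S2_cong)
  note s = smooth_on_S2_sderiv[OF lk_smooth(1), of w, unfolded smooth_on_S2_iff]
    smooth_on_S2_sderiv[OF X_smooth, of w, unfolded smooth_on_S2_iff]
    lk_smooth(1)[unfolded smooth_on_S2_iff] X_smooth[unfolded smooth_on_S2_iff]
  have "smooth_on_S2 (\<lambda>y. nabla K X l y w)"
    unfolding nabla_def smooth_on_S2_iff
    by (intro smooth_on_add smooth_christoffel s; rule X_E[OF unit_in_S2]; simp)
  then show "smooth_on_S2 (\<lambda>y. - K (X y) (k y) (nabla K X l y w) / 2)"
    using X_E by (intro smooth_on_S2_divide_const smooth_on_S2_uminus smooth_on_S2_metric X_smooth lk_smooth) auto
qed (simp add: connection_form_eq)

lemma div_zero:
  assumes x: "x \<in> S2"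
  shows "div_h K X (connection_form K X) x = 0"
proof -
  obtain e n where b: "tangent_basis x e n" and n: "n $ 3 = 0" "axial_iso (reflect n) (- 1)"
    "reflect n x = x" "reflect n e = e" "reflect n n = - n" using meridian_basis_exists[OF x] by metis
  have nn: "n \<bullet> n = 1" "n \<bullet> x = 0" using b by (auto simp: tangent_basis_def inner_commute)
  show ?thesis
  proof (rule surface_point.div_h_odd[OF point[OF b] connection_form_linear connection_form_smooth, where L = "reflect n"])
    show "linear (reflect n)" using n(2) by (simp add: axial_iso_def)
    show "norm (reflect n y) = norm y" for y by (rule axial_iso_norm[OF n(2)])
    show "x \<bullet> reflect n v = x \<bullet> v" for v using nn by (simp add: reflect_def inner_diff_right inner_commute)
    show "reflect n (reflect n v) = v" for v using nn by (simp add: reflect_def inner_diff_right algebra_simps)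
  qed (use n in \<open>auto intro: connection_form_odd[OF n(2)] induced_iso[OF n(2)]\<close>)
qed

lemma time_flat: "time_flat K E X"
  using spacelike_mean_curv div_zero by (simp add: time_flat_def)

text \<open>The integrand vanishes identically because the divergence does, so the inequality holds
  with equality.\<close>

lemma connection_compatible: "connection_compatible K E X \<beta>"
proof -
  have "surface_integral K X (\<lambda>x. \<beta> x * div_h K X (connection_form K X) x) = 0"
    unfolding surface_integral_def div_zero[OF sph_S2] by (simp add: case_prod_beta')
  then show ?thesis using spacelike_mean_curv by (simp add: connection_compatible_def)
qed

end

subsection \<open>Families of surfaces and their 2-jets\<close>

text \<open>\<open>frechet_derivative\<close> with the direction placed before the point, so that it
  can be iterated as an operator on functions.\<close>

definition dd :: "('a::real_normed_vector \<Rightarrow> 'b::real_normed_vector) \<Rightarrow> 'a \<Rightarrow> 'a \<Rightarrow> 'b" where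
  "dd f a x = frechet_derivative f (at x) a"

lemma dd_smooth: "smooth_on S f \<Longrightarrow> smooth_on S (dd f a)"
  using smooth_on_frechet[of S f a] by (simp add: dd_def[abs_def])

lemma dd_commute:
  fixes f :: "'a::real_normed_vector \<Rightarrow> 'b::euclidean_space"
  shows "smooth_on S f \<Longrightarrow> x \<in> S \<Longrightarrow> dd (dd f a) b x = dd (dd f b) a x"
  unfolding dd_def[abs_def] by (rule second_derivative_symmetric)

lemma dd_cong: "open S \<Longrightarrow> x \<in> S \<Longrightarrow> (\<And>y. y \<in> S \<Longrightarrow> f y = f' y) \<Longrightarrow> dd f a x = dd f' a x"
  unfolding dd_def by (metis frechet_derivative_cong_open)

lemma dd_eqI: "(f has_derivative f') (at x) \<Longrightarrow> dd f a x = f' a"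
  unfolding dd_def by (rule frechet_derivative_eqI)

lemma dd_linear: "smooth_on S f \<Longrightarrow> x \<in> S \<Longrightarrow> linear (\<lambda>a. dd f a x)"
  unfolding dd_def by (simp add: frechet_derivative_linear eta_contract_eq)

lemma dd_has_derivative: "smooth_on S f \<Longrightarrow> x \<in> S \<Longrightarrow> (f has_derivative (\<lambda>a. dd f a x)) (at x)"
  unfolding dd_def by (rule smooth_on_has_derivative)

lemma dd_curve:
  assumes f: "smooth_on S f" and x: "x + s *\<^sub>R a \<in> S"
  shows "((\<lambda>t. f (x + t *\<^sub>R a)) has_vector_derivative dd f a (x + s *\<^sub>R a)) (at s)"
proof -
  have "((\<lambda>t. x + t *\<^sub>R a) has_derivative (\<lambda>t. t *\<^sub>R a)) (at s)" by (auto intro!: derivative_eq_intros)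
  from has_derivative_compose[OF this dd_has_derivative[OF f x]]
  show ?thesis
    unfolding has_vector_derivative_def
    by (rule has_derivative_eq_rhs) (simp add: linear_cmul[OF dd_linear[OF f x]])
qed

lemma dd_second_linear:
  fixes f :: "'a::real_normed_vector \<Rightarrow> 'b::euclidean_space"
  assumes "smooth_on S f" "x \<in> S"
  shows "linear (\<lambda>a. dd (dd f a) b x)" "linear (\<lambda>b. dd (dd f a) b x)"
proof -
  show 1: "linear (\<lambda>b. dd (dd f a) b x)" for a
    by (rule dd_linear[OF dd_smooth[OF assms(1)] assms(2)])
  have "(\<lambda>a. dd (dd f a) b x) = (\<lambda>a. dd (dd f b) a x)" by (simp only: dd_commute[OF assms])
  then show "linear (\<lambda>a. dd (dd f a) b x)" using 1 by simp
qed

lemma smooth_on_dd_arg: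
  fixes f :: "'a::euclidean_space \<Rightarrow> 'b::real_normed_vector"
  assumes "smooth_on T f" "smooth_on S q" "smooth_on S v" "\<And>z. z \<in> S \<Longrightarrow> q z \<in> T"
  shows "smooth_on S (\<lambda>z. dd f (v z) (q z))"
  unfolding dd_def by (rule smooth_on_frechet_arg[OF assms])

lemma smooth_on_dd_dd_arg:
  fixes f :: "'a::euclidean_space \<Rightarrow> 'b::euclidean_space"
  assumes "smooth_on T f" "smooth_on S q" "smooth_on S v" "smooth_on S w" "\<And>z. z \<in> S \<Longrightarrow> q z \<in> T"
  shows "smooth_on S (\<lambda>z. dd (dd f (w z)) (v z) (q z))"
  by (rule smooth_on_linear_arg[where f="\<lambda>z c. dd (dd f c) (v z) (q z)",
        OF smooth_on_dd_arg[OF dd_smooth[OF assms(1)] assms(2,3,5)] dd_second_linear(1)[OF assms(1,5)] assms(4)])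

type_synonym 'a jet = "'a \<times> 'a \<times> 'a \<times> 'a \<times> 'a \<times> 'a"

text \<open>The fifth slot is the sum of both mixed derivatives, to match the argument
  \<open>z12\<close> of \<open>mean_vec\<close>.\<close>

definition jet2 :: "('a::real_normed_vector \<Rightarrow> 'b::real_normed_vector) \<Rightarrow> 'a \<Rightarrow> 'a \<Rightarrow> 'a \<Rightarrow> 'b jet" where
  "jet2 f x e1 e2 = (f x, dd f e1 x, dd f e2 x, dd (dd f e1) e1 x, dd (dd f e2) e1 x + dd (dd f e1) e2 x, dd (dd f e2) e2 x)"

lemma jet2_cong:
  assumes S: "open S" "x \<in> S" and eq: "\<And>y. y \<in> S \<Longrightarrow> f y = f' y"
  shows "jet2 f x e1 e2 = jet2 f' x e1 e2"
proof -
  have "dd f a y = dd f' a y" if "y \<in> S" for a y using that by (rule dd_cong[OF S(1) _ eq])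
  moreover from this have "dd (dd f a) b x = dd (dd f' a) b x" for a b by (rule dd_cong[OF S])
  ultimately show ?thesis using S(2) eq by (simp add: jet2_def)
qed

lemma hess_dd: "hess X x v w = dd (dd (sext X) w) v x"
  by (simp add: hess_def dd_def[abs_def])

lemma sderiv_dd: "sderiv X x v = dd (sext X) v x"
  by (simp add: sderiv_def dd_def)

locale smooth_family =
  fixes I :: "real set" and U :: "'a::euclidean_space set" and \<Phi> :: "real \<times> 'a \<Rightarrow> 'b::euclidean_space"
  assumes smooth_\<Phi>: "smooth_on (I \<times> U) \<Phi>" and open_I: "open I" and open_U: "open U"
begin

lemma slice_dd:
  assumes "smooth_on (I \<times> U) \<Psi>" "s \<in> I" "y \<in> U"
  shows "dd (\<lambda>y. \<Psi> (s, y)) w y = dd \<Psi> (0, w) (s, y)"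
proof -
  have "((\<lambda>y. (s, y)) has_derivative (\<lambda>w. (0, w))) (at y)" by (auto intro!: derivative_eq_intros)
  from has_derivative_compose[OF this dd_has_derivative[OF assms(1)]] assms(2,3)
  show ?thesis by (intro dd_eqI) auto
qed

lemma slice_dd_dd:
  assumes "smooth_on (I \<times> U) \<Psi>" "s \<in> I" "y \<in> U"
  shows "dd (dd (\<lambda>y. \<Psi> (s, y)) w) v y = dd (dd \<Psi> (0, w)) (0, v) (s, y)"
proof -
  have "dd (dd (\<lambda>y. \<Psi> (s, y)) w) v y = dd (\<lambda>y. dd \<Psi> (0, w) (s, y)) v y"
    by (rule dd_cong[OF open_U assms(3)]) (rule slice_dd[OF assms(1,2)])
  then show ?thesis by (simp add: slice_dd[OF dd_smooth[OF assms(1)] assms(2,3)])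
qed

lemma time_derivative:
  assumes "smooth_on (I \<times> U) \<Psi>" "s \<in> I" "y \<in> U"
  shows "((\<lambda>s. \<Psi> (s, y)) has_vector_derivative dd \<Psi> (1, 0) (s, y)) (at s)"
  using dd_curve[OF assms(1), of "(0, y)" s "(1, 0)"] assms(2,3) by simp

text \<open>Time and space derivatives commute, so the velocity of the 2-jet is the 2-jet of the
  velocity field.\<close>

lemma jet2_has_vector_derivative:
  assumes s: "s \<in> I" and x: "x \<in> U"
  shows "((\<lambda>s. jet2 (\<lambda>y. \<Phi> (s, y)) x e1 e2) has_vector_derivative jet2 (\<lambda>y. dd \<Phi> (1, 0) (s, y)) x e1 e2) (at s)"
proof -
  have sx: "(s, x) \<in> I \<times> U" using s x by simp
  have o: "open (I \<times> U)" using smooth_\<Phi> by (rule smooth_on_open)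
  have loc: "(f has_vector_derivative f') (at s)" if "(f2 has_vector_derivative f') (at s)" "\<And>r. r \<in> I \<Longrightarrow> f2 r = f r"
    for f f2 :: "real \<Rightarrow> 'b" and f'
    using that(1) unfolding has_vector_derivative_def
    by (rule has_derivative_transform_within_open[OF _ open_I s that(2)])
  have 0: "((\<lambda>s. \<Phi> (s, x)) has_vector_derivative dd \<Phi> (1, 0) (s, x)) (at s)"
    by (rule time_derivative[OF smooth_\<Phi> s x])
  have 1: "((\<lambda>s. dd (\<lambda>y. \<Phi> (s, y)) w x) has_vector_derivative dd (\<lambda>y. dd \<Phi> (1, 0) (s, y)) w x) (at s)" for w
    unfolding slice_dd[OF dd_smooth[OF smooth_\<Phi>] s x] dd_commute[OF smooth_\<Phi> sx, of "(1, 0)"]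
    by (rule loc[OF time_derivative[OF dd_smooth[OF smooth_\<Phi>] s x]]) (rule slice_dd[OF smooth_\<Phi> _ x, symmetric])
  have 2: "((\<lambda>s. dd (dd (\<lambda>y. \<Phi> (s, y)) w) v x) has_vector_derivative dd (dd (\<lambda>y. dd \<Phi> (1, 0) (s, y)) w) v x) (at s)" for v w
  proof -
    have "dd (dd (dd \<Phi> (1, 0)) (0, w)) (0, v) (s, x) = dd (dd (dd \<Phi> (0, w)) (1, 0)) (0, v) (s, x)"
      by (rule dd_cong[OF o sx]) (rule dd_commute[OF smooth_\<Phi>])
    also have "\<dots> = dd (dd (dd \<Phi> (0, w)) (0, v)) (1, 0) (s, x)"
      by (rule dd_commute[OF dd_smooth[OF smooth_\<Phi>] sx])
    finally show ?thesis
      unfolding slice_dd_dd[OF dd_smooth[OF smooth_\<Phi>] s x]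
      by (simp only:) (rule loc[OF time_derivative[OF dd_smooth[OF dd_smooth[OF smooth_\<Phi>]] s x]],
        rule slice_dd_dd[OF smooth_\<Phi> _ x, symmetric])
  qed
  show ?thesis
    unfolding jet2_def by (intro has_vector_derivative_Pair has_vector_derivative_add 0 1 2)
qed

lemma jet2_smooth:
  assumes "smooth_on T s" "smooth_on T x" "smooth_on T e1" "smooth_on T e2" "\<And>z. z \<in> T \<Longrightarrow> s z \<in> I" "\<And>z. z \<in> T \<Longrightarrow> x z \<in> U"
  shows "smooth_on T (\<lambda>z. jet2 (\<lambda>y. \<Phi> (s z, y)) (x z) (e1 z) (e2 z))"
proof (rule smooth_on_cong)
  have T: "open T" by (rule smooth_on_open[OF assms(1)])
  show "smooth_on T (\<lambda>z. (\<Phi> (s z, x z), dd \<Phi> (0, e1 z) (s z, x z), dd \<Phi> (0, e2 z) (s z, x z),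
      dd (dd \<Phi> (0, e1 z)) (0, e1 z) (s z, x z),
      dd (dd \<Phi> (0, e2 z)) (0, e1 z) (s z, x z) + dd (dd \<Phi> (0, e1 z)) (0, e2 z) (s z, x z),
      dd (dd \<Phi> (0, e2 z)) (0, e2 z) (s z, x z)))"
    using assms
    by (intro smooth_on_Pair smooth_on_add smooth_on_compose[OF smooth_\<Phi>] smooth_on_dd_dd_arg[OF smooth_\<Phi>]
        smooth_on_dd_arg[OF smooth_\<Phi>] smooth_on_const T) auto
qed (simp add: jet2_def slice_dd[OF smooth_\<Phi>] slice_dd_dd[OF smooth_\<Phi>] assms)

end

section \<open>Averages over the circle\<close>

lemma integral_periodic_shift:
  fixes f :: "real \<Rightarrow> 'b::euclidean_space"
  assumes f: "continuous_on UNIV f" and per: "\<And>x. f (x + p) = f x" and c: "0 \<le> c" "c \<le> p"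
  shows "integral {0..p} (\<lambda>x. f (x + c)) = integral {0..p} f"
proof -
  have int: "f integrable_on {a..b}" for a b
    by (rule integrable_continuous_real[OF continuous_on_subset[OF f]]) simp
  have "integral {0..p} (\<lambda>x. f (x + c)) = integral {c..p + c} f"
    using integral_shift_real_ivl[of c c "p + c" f] by simp
  also have "\<dots> = integral {c..p} f + integral {p..p + c} f"
    using c by (intro Henstock_Kurzweil_Integration.integral_combine[symmetric] int) auto
  also have "integral {p..p + c} f = integral {0..c} f"
    using integral_shift_real_ivl[of p p "p + c" f] per by simp
  also have "integral {c..p} f + integral {0..c} f = integral {0..p} f"
    using Henstock_Kurzweil_Integration.integral_combine[OF c int] by (subst add.commute)
  finally show ?thesis .
qed

text \<open>Differentiates a symmetry of fibre integrals under the integral sign. Keeping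
  \<open>G\<close> and \<open>G'\<close> apart allows a second application, to
  \<open>dd G (S w, 0)\<close> and \<open>dd G (w, 0)\<close>, which reaches order 2.\<close>

lemma fibre_integral_derivative:
  fixes G G' :: "'a::euclidean_space \<times> real \<Rightarrow> 'b::euclidean_space"
  assumes G: "smooth_on (U \<times> UNIV) G" "smooth_on (U \<times> UNIV) G'" and U: "open U"
    and S: "linear S" "\<And>y. y \<in> U \<Longrightarrow> S y \<in> U" and B: "bounded_linear B"
    and eq: "\<And>y. y \<in> U \<Longrightarrow> integral {0..p} (\<lambda>\<phi>. G (S y, \<phi>)) = B (integral {0..p} (\<lambda>\<phi>. G' (y, \<phi>)))"
    and y: "y \<in> U"
  shows "integral {0..p} (\<lambda>\<phi>. dd G (S w, 0) (S y, \<phi>)) = B (integral {0..p} (\<lambda>\<phi>. dd G' (w, 0) (y, \<phi>)))"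
proof -
  have *: "((\<lambda>t. integral {0..p} (\<lambda>\<phi>. H (z + t *\<^sub>R w, \<phi>))) has_vector_derivative
      integral {0..p} (\<lambda>\<phi>. dd H (w, 0) (z, \<phi>))) (at 0)"
    if H: "smooth_on (U \<times> UNIV) H" and z: "z \<in> U" for H :: "'a \<times> real \<Rightarrow> 'b" and z w
  proof -
    \<comment> \<open>The line through \<open>z\<close> in direction \<open>w\<close> stays in
      \<open>U\<close> only for small \<open>t\<close>, so Leibniz' rule is used on a ball around
      0.\<close>
    have "open ((\<lambda>t::real. z + t *\<^sub>R w) -` U)"
      by (intro continuous_open_vimage U) (auto intro: continuous_intros)
    moreover have "0 \<in> (\<lambda>t::real. z + t *\<^sub>R w) -` U" using z by simp
    ultimately obtain d where d: "0 < d" "ball 0 d \<subseteq> (\<lambda>t::real. z + t *\<^sub>R w) -` U"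
      by (meson open_contains_ball)
    have U': "z + t *\<^sub>R w \<in> U" if "t \<in> ball 0 d" for t using d(2) that by auto
    have cH: "continuous_on (U \<times> UNIV) H" by (rule smooth_on_continuous[OF H])
    have cD: "continuous_on (U \<times> UNIV) (dd H (w, 0))" by (rule smooth_on_continuous[OF dd_smooth[OF H]])
    have "((\<lambda>t. integral (cbox 0 p) (\<lambda>\<phi>. H (z + t *\<^sub>R w, \<phi>))) has_vector_derivative
        integral (cbox 0 p) (\<lambda>\<phi>. dd H (w, 0) (z + 0 *\<^sub>R w, \<phi>))) (at 0 within ball 0 d)"
    proof (rule leibniz_rule_vector_derivative[where f = "\<lambda>t \<phi>. H (z + t *\<^sub>R w, \<phi>)" and fx = "\<lambda>t \<phi>. dd H (w, 0) (z + t *\<^sub>R w, \<phi>)"])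
      fix t \<phi> assume "t \<in> ball (0::real) d" "\<phi> \<in> cbox 0 p"
      then have "(z, \<phi>) + t *\<^sub>R (w, 0) \<in> U \<times> UNIV" using U' by simp
      from dd_curve[OF H this]
      show "((\<lambda>t. H (z + t *\<^sub>R w, \<phi>)) has_vector_derivative dd H (w, 0) (z + t *\<^sub>R w, \<phi>)) (at t within ball 0 d)"
        by (simp add: has_vector_derivative_at_within)
    next
      fix t assume "t \<in> ball (0::real) d"
      then show "(\<lambda>\<phi>. H (z + t *\<^sub>R w, \<phi>)) integrable_on cbox 0 p"
        using U' by (intro integrable_continuous continuous_on_compose2[OF cH] continuous_intros) auto
    next
      show "continuous_on (ball 0 d \<times> cbox 0 p) (\<lambda>(t, \<phi>). dd H (w, 0) (z + t *\<^sub>R w, \<phi>))"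
        unfolding case_prod_beta' using U'
        by (intro continuous_on_compose2[OF cD] continuous_intros) auto
    qed (use d in auto)
    moreover have "at (0::real) within ball 0 d = at 0" using d(1) by (intro at_within_open) auto
    ultimately show ?thesis by (simp only: cbox_interval scaleR_zero_left add_0_right)
  qed
  have "((\<lambda>t. integral {0..p} (\<lambda>\<phi>. G (S y + t *\<^sub>R S w, \<phi>))) has_vector_derivative
      integral {0..p} (\<lambda>\<phi>. dd G (S w, 0) (S y, \<phi>))) (at 0)"
    by (rule *[OF G(1) S(2)[OF y]])
  moreover have "((\<lambda>t. integral {0..p} (\<lambda>\<phi>. G (S y + t *\<^sub>R S w, \<phi>))) has_vector_derivative
      B (integral {0..p} (\<lambda>\<phi>. dd G' (w, 0) (y, \<phi>)))) (at 0)"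
  proof -
    have b: "((\<lambda>t. B (integral {0..p} (\<lambda>\<phi>. G' (y + t *\<^sub>R w, \<phi>)))) has_vector_derivative
      B (integral {0..p} (\<lambda>\<phi>. dd G' (w, 0) (y, \<phi>)))) (at 0)"
      by (rule bounded_linear.has_vector_derivative[OF B *[OF G(2) y]])
    have o: "open ((\<lambda>t::real. y + t *\<^sub>R w) -` U)"
      by (intro continuous_open_vimage U) (auto intro: continuous_intros)
    show ?thesis
      using b unfolding has_vector_derivative_def
    proof (rule has_derivative_transform_within_open[OF _ o])
      fix t assume "t \<in> (\<lambda>t::real. y + t *\<^sub>R w) -` U"
      then have "integral {0..p} (\<lambda>\<phi>. G (S (y + t *\<^sub>R w), \<phi>)) = B (integral {0..p} (\<lambda>\<phi>. G' (y + t *\<^sub>R w, \<phi>)))"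
        by (intro eq) simp
      then show "B (integral {0..p} (\<lambda>\<phi>. G' (y + t *\<^sub>R w, \<phi>))) = integral {0..p} (\<lambda>\<phi>. G (S y + t *\<^sub>R S w, \<phi>))"
        by (simp add: linear_add[OF S(1)] linear_cmul[OF S(1)])
    qed (use y in simp)
  qed
  ultimately show ?thesis by (rule vector_derivative_unique_at)
qed

definition e_theta :: "real \<Rightarrow> real \<Rightarrow> real^3" where
  "e_theta \<theta> \<phi> = vector [cos \<theta> * cos \<phi>, cos \<theta> * sin \<phi>, - sin \<theta>]"

text \<open>Unit vector, without the factor \<open>sin \<theta>\<close> of the coordinate field:
  with that factor the frame would degenerate at the poles and the jets would leave
  \<open>jet_domain\<close>.\<close>

definition e_phi :: "real \<Rightarrow> real^3" where
  "e_phi \<phi> = vector [- sin \<phi>, cos \<phi>, 0]"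

lemma sph_tangent_basis: "tangent_basis (sph \<theta> \<phi>) (e_theta \<theta> \<phi>) (e_phi \<phi>)"
proof -
  have sc: "sin \<theta> * sin \<theta> + cos \<theta> * cos \<theta> = 1" "sin \<phi> * sin \<phi> + cos \<phi> * cos \<phi> = 1"
    using sin_cos_squared_add[of \<theta>] sin_cos_squared_add[of \<phi>] by (simp_all add: power2_eq_square)
  show ?thesis
    unfolding tangent_basis_def inner3 sph_def e_theta_def e_phi_def vector_3
    by (intro conjI) (use sc in algebra)+
qed

lemma sph_vector_derivative:
  "vector_derivative (\<lambda>\<theta>. sph \<theta> \<phi>) (at \<theta>) = e_theta \<theta> \<phi>"
  "vector_derivative (\<lambda>\<phi>. sph \<theta> \<phi>) (at \<phi>) = sin \<theta> *\<^sub>R e_phi \<phi>"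
proof -
  have bl: "bounded_linear (axis i :: real \<Rightarrow> real^3)" for i
    by (auto simp: linear_linear axis_def vec_eq_iff intro!: linearI)
  have ax: "((\<lambda>t. axis i (f t) :: real^3) has_vector_derivative axis i f') (at t)"
    if "(f has_real_derivative f') (at t)" for i f f' t
    using that bounded_linear.has_vector_derivative[OF bl]
    unfolding has_real_derivative_iff_has_vector_derivative by blast
  show "vector_derivative (\<lambda>\<theta>. sph \<theta> \<phi>) (at \<theta>) = e_theta \<theta> \<phi>"
    unfolding sph_def e_theta_def vector_3_axis
    by (intro vector_derivative_at has_vector_derivative_add ax) (auto intro!: derivative_eq_intros)
  have "sin \<theta> *\<^sub>R e_phi \<phi> = axis 1 (- sin \<theta> * sin \<phi>) + axis 2 (sin \<theta> * cos \<phi>) + axis 3 0"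
    by (simp add: e_phi_def vec_eq_iff forall_3 vector_3 axis_def)
  then show "vector_derivative (\<lambda>\<phi>. sph \<theta> \<phi>) (at \<phi>) = sin \<theta> *\<^sub>R e_phi \<phi>"
    unfolding sph_def vector_3_axis
    by (simp only:) (intro vector_derivative_at has_vector_derivative_add ax; auto intro!: derivative_eq_intros)
qed

lemma sph_smooth:
  assumes "smooth_on T \<theta>" "smooth_on T \<phi>"
  shows "smooth_on T (\<lambda>z. sph (\<theta> z) (\<phi> z))" "smooth_on T (\<lambda>z. e_theta (\<theta> z) (\<phi> z))"
  unfolding sph_def e_theta_def
  by (intro smooth_on_vector_3 smooth_on_mult smooth_on_uminus smooth_on_sin smooth_on_cos smooth_on_const assms smooth_on_open[OF assms(1)])+

lemma e_phi_smooth: "smooth_on T \<phi> \<Longrightarrow> smooth_on T (\<lambda>z. e_phi (\<phi> z))"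
  unfolding e_phi_def
  by (intro smooth_on_vector_3 smooth_on_uminus smooth_on_sin smooth_on_cos smooth_on_const) (auto intro: smooth_on_open)

lemma rot_frame:
  "rot \<phi> (sph \<theta> 0) = sph \<theta> \<phi>" "rot \<phi> (e_theta \<theta> 0) = e_theta \<theta> \<phi>" "rot \<phi> (e_phi 0) = e_phi \<phi>"
  by (simp_all add: rot_def sph_def e_theta_def e_phi_def vec_eq_iff forall_3 vector_3)

lemma rot_add: "rot \<phi> (rot \<psi> x) = rot (\<phi> + \<psi>) x"
  by (simp add: rot_def vec_eq_iff forall_3 vector_3 cos_add sin_add algebra_simps)

lemma rot_0: "rot 0 x = x"
  by (simp add: rot_def vec_eq_iff forall_3 vector_3)

lemma rot_2pi: "rot (\<phi> + 2 * pi) x = rot \<phi> x"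
  by (simp add: rot_def)

lemma smooth_on_rotate:
  assumes "smooth_on T \<phi>" "smooth_on T x"
  shows "smooth_on T (\<lambda>z. rot (\<phi> z) (x z))"
  unfolding rot_def
  by (intro smooth_on_vector_3 smooth_on_add smooth_on_diff smooth_on_mult smooth_on_nth smooth_on_sin smooth_on_cos assms)

definition flip :: "real^3 \<Rightarrow> real^3" where
  "flip = reflect (axis 2 1)"

lemma flip_apply: "flip x = vector [x $ 1, - x $ 2, x $ 3]"
  by (simp add: flip_def reflect_def vec_eq_iff forall_3 vector_3 inner3 axis_def)

lemma axial_iso_flip: "axial_iso flip (- 1)"
  unfolding flip_def by (rule axial_iso_reflect) (simp_all add: inner3 axis_def)

lemma flip_frame: "flip (sph \<theta> 0) = sph \<theta> 0" "flip (e_theta \<theta> 0) = e_theta \<theta> 0" "flip (e_phi 0) = - e_phi 0"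
  by (simp_all add: flip_apply sph_def e_theta_def e_phi_def vec_eq_iff forall_3 vector_3)

text \<open>Reflection takes azimuth psi to -psi, and so does rotation by -2 psi; \<open>C\<close>
  and \<open>D\<close> are the cosine and sine of that angle. The angle depends on \<open>y\<close>,
  so this concerns single orbits, which is enough to make rotational averages invariant under
  \<open>flip\<close>.\<close>

lemma flip_as_rotation: obtains c where "0 \<le> c" "c \<le> 2 * pi" "flip y = rot c y"
proof (cases "y $ 1 = 0 \<and> y $ 2 = 0")
  case True
  then have "flip y = rot 0 y" by (simp add: flip_apply rot_def vec_eq_iff forall_3 vector_3)
  then show ?thesis using that[of 0] by simp
next
  case False
  define q where "q = y $ 1 * y $ 1 + y $ 2 * y $ 2"
  have q: "q \<noteq> 0" using False unfolding q_def by (metis sum_squares_eq_zero_iff)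
  define C where "C = (y $ 1 * y $ 1 - y $ 2 * y $ 2) / q"
  define D where "D = - 2 * y $ 1 * y $ 2 / q"
  have CD: "C * q = y $ 1 * y $ 1 - y $ 2 * y $ 2" "D * q = - 2 * y $ 1 * y $ 2" using q by (simp_all add: C_def D_def)
  have "(C\<^sup>2 + D\<^sup>2) * q\<^sup>2 = 1 * q\<^sup>2" using CD q_def by algebra
  moreover have "q\<^sup>2 \<noteq> 0" using q by simp
  ultimately have "C\<^sup>2 + D\<^sup>2 = 1" by (metis mult_right_cancel)
  then obtain c where c: "0 \<le> c" "c \<le> 2 * pi" "C = cos c" "D = sin c"
    using sincos_total_2pi_le by metis
  have "(y $ 1 * C - y $ 2 * D) * q = y $ 1 * q" "(y $ 1 * D + y $ 2 * C) * q = - y $ 2 * q"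
    using CD q_def by algebra+
  then have "y $ 1 * C - y $ 2 * D = y $ 1" "y $ 1 * D + y $ 2 * C = - y $ 2"
    by (simp_all only: mult_right_cancel[OF q])
  then have "flip y = rot c y" by (simp add: flip_apply rot_def vec_eq_iff forall_3 vector_3 c)
  then show ?thesis using that c by metis
qed

subsection \<open>The first variation of the Willmore energy\<close>

text \<open>Here \<open>\<sigma>\<close> moves the point and its differential moves the vectors. The
  sign sits on the two slots of odd order in the second frame vector, to absorb its reversal by a
  reflection.\<close>

definition jet_act :: "('a \<Rightarrow> 'a) \<Rightarrow> ('a \<Rightarrow> 'a) \<Rightarrow> real \<Rightarrow> 'a jet \<Rightarrow> 'a::real_vector jet" where
  "jet_act \<sigma> A \<epsilon> j = (\<sigma> (fst j), A (fst (snd j)), \<epsilon> *\<^sub>R A (fst (snd (snd j))), A (fst (snd (snd (snd j)))),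
     \<epsilon> *\<^sub>R A (fst (snd (snd (snd (snd j))))), A (snd (snd (snd (snd (snd j))))))"

lemma jet_act_has_derivative:
  fixes \<sigma> :: "'a::real_normed_vector \<Rightarrow> 'a"
  assumes "bounded_linear A" "\<And>p. (\<sigma> has_derivative A) (at p)"
  shows "(jet_act \<sigma> A \<epsilon> has_derivative jet_act A A \<epsilon>) (at j)"
  unfolding jet_act_def[abs_def]
  by (intro has_derivative_Pair has_derivative_compose[OF has_derivative_fst[OF has_derivative_ident] assms(2)]
      bounded_linear.has_derivative[OF assms(1)] has_derivative_scaleR_right has_derivative_fst has_derivative_snd has_derivative_ident)

context kerr_hole
begin

definition jet_density :: "spacetime jet \<Rightarrow> real" where
  "jet_density j = surface_density (kerr m a) (fst j) (fst (snd j)) (fst (snd (snd j))) (fst (snd (snd (snd j))))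
     (fst (snd (snd (snd (snd j))))) (snd (snd (snd (snd (snd j)))))"

definition jet_domain :: "spacetime jet set" where
  "jet_domain = {j. fst j \<in> kerr_exterior m a \<and> 0 < gram (kerr m a (fst j)) (fst (snd j)) (fst (snd (snd j)))}"

lemma open_jet_domain: "open jet_domain"
proof -
  let ?S = "kerr_exterior m a \<times> (UNIV :: (spacetime \<times> spacetime \<times> spacetime \<times> spacetime \<times> spacetime) set)"
  let ?f = "\<lambda>j. gram (kerr m a (fst j)) (fst (snd j)) (fst (snd (snd j)))"
  have S: "open ?S" using open_kerr_exterior by (intro open_Times) auto
  have "smooth_on ?S ?f"
    by (intro smooth_gram smooth_on_fst smooth_on_snd smooth_on_ident S) auto
  then have "open (?S \<inter> ?f -` {0<..})"
    by (intro continuous_open_preimage smooth_on_continuous S) auto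
  also have "?S \<inter> ?f -` {0<..} = jet_domain" by (auto simp: jet_domain_def)
  finally show ?thesis .
qed

lemma smooth_jet_density: "smooth_on jet_domain jet_density"
  unfolding jet_density_def
  by (intro smooth_surface_density smooth_on_fst smooth_on_snd smooth_on_ident open_jet_domain)
    (auto simp: jet_domain_def)

lemma jet_act_domain:
  assumes "isometry_at \<sigma> A" "\<epsilon> = 1 \<or> \<epsilon> = - 1" "j \<in> jet_domain"
  shows "jet_act \<sigma> A \<epsilon> j \<in> jet_domain"
proof -
  have p: "fst j \<in> kerr_exterior m a" "\<sigma> (fst j) \<in> kerr_exterior m a"
    using assms by (auto simp: jet_domain_def isometry_at_def)
  have "gram (kerr m a (\<sigma> (fst j))) (A u) (\<epsilon> *\<^sub>R A v) = gram (kerr m a (fst j)) u v" for u v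
    using assms(2) by (elim disjE) (simp_all add: gram_def kerr_lin iso_metric[OF assms(1) p(1)])
  then show ?thesis using assms(3) p by (simp add: jet_domain_def jet_act_def)
qed

lemma jet_act_density:
  assumes "isometry_at \<sigma> A" "\<epsilon> = 1 \<or> \<epsilon> = - 1" "j \<in> jet_domain"
  shows "jet_density (jet_act \<sigma> A \<epsilon> j) = jet_density j"
proof -
  have p: "fst j \<in> kerr_exterior m a" "\<sigma> (fst j) \<in> kerr_exterior m a"
    using assms by (auto simp: jet_domain_def isometry_at_def)
  show ?thesis
    using assms(2)
    by (elim disjE)
      (simp_all add: jet_density_def jet_act_def surface_density_flip[OF p(2)] iso_surface_density[OF assms(1) p(1)])
qed

text \<open>The invariance of the density, differentiated. The tangent vector \<open>k\<close>
  transforms by the linear action, with \<open>A\<close> in the place of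
  \<open>\<sigma>\<close>.\<close>

lemma dd_jet_density:
  assumes iso: "isometry_at \<sigma> A" and \<epsilon>: "\<epsilon> = 1 \<or> \<epsilon> = - 1" and j: "j \<in> jet_domain"
  shows "dd jet_density (jet_act A A \<epsilon> k) (jet_act \<sigma> A \<epsilon> j) = dd jet_density k j"
proof -
  have \<sigma>: "(\<sigma> has_derivative A) (at p)" for p
    using iso unfolding isometry_at_def by blast
  note A = has_derivative_bounded_linear[OF \<sigma>] \<sigma>
  have "((\<lambda>j. jet_density (jet_act \<sigma> A \<epsilon> j)) has_derivative (\<lambda>k. dd jet_density (jet_act A A \<epsilon> k) (jet_act \<sigma> A \<epsilon> j))) (at j)"
    by (rule has_derivative_compose[OF jet_act_has_derivative[OF A]
        dd_has_derivative[OF smooth_jet_density jet_act_domain[OF iso \<epsilon> j]]])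
  then have "dd (\<lambda>j. jet_density (jet_act \<sigma> A \<epsilon> j)) k j = dd jet_density (jet_act A A \<epsilon> k) (jet_act \<sigma> A \<epsilon> j)"
    by (rule dd_eqI)
  moreover have "dd (\<lambda>j. jet_density (jet_act \<sigma> A \<epsilon> j)) k j = dd jet_density k j"
    by (rule dd_cong[OF open_jet_domain j]) (rule jet_act_density[OF iso \<epsilon>])
  ultimately show ?thesis by simp
qed

text \<open>Membership in the domain includes the poles, where the frame is still orthonormal. In
  the second claim \<open>sin \<theta>\<close> comes from the coordinate field of \<phi>; its
  positivity is used to take it out of the square root.\<close>

lemma surface_jet:
  assumes "spacelike_surface (kerr m a) (kerr_exterior m a) Z"
  shows "jet2 (sext Z) (sph \<theta> \<phi>) (e_theta \<theta> \<phi>) (e_phi \<phi>) \<in> jet_domain"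
    "0 < \<theta> \<Longrightarrow> \<theta> < pi \<Longrightarrow> mean_curv_sq (kerr m a) Z (sph \<theta> \<phi>) * area_density (kerr m a) Z \<theta> \<phi> =
       sin \<theta> * jet_density (jet2 (sext Z) (sph \<theta> \<phi>) (e_theta \<theta> \<phi>) (e_phi \<phi>))"
proof -
  interpret P: surface_point "kerr m a" "kerr_exterior m a" Z "sph \<theta> \<phi>" "e_theta \<theta> \<phi>" "e_phi \<phi>"
    using assms sph_tangent_basis by unfold_locales
  note j = jet2_def sderiv_dd[symmetric] hess_dd[symmetric] sext_on_S2[OF P.x_S2]
  show "jet2 (sext Z) (sph \<theta> \<phi>) (e_theta \<theta> \<phi>) (e_phi \<phi>) \<in> jet_domain"
    using P.gram_pos P.Xx by (simp add: jet_domain_def j)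
  assume "0 < \<theta>" "\<theta> < pi"
  then have s: "0 < sin \<theta>" by (rule sin_gt_zero)
  have "area_density (kerr m a) Z \<theta> \<phi> = sqrt ((sin \<theta>)\<^sup>2 * P.D)"
    by (simp add: area_density_def sph_vector_derivative Let_def induced_metric_def P.dX_lin kerr_lin gram_def
        power2_eq_square algebra_simps)
  also have "\<dots> = sin \<theta> * sqrt P.D" using s by (simp add: real_sqrt_mult)
  finally show "mean_curv_sq (kerr m a) Z (sph \<theta> \<phi>) * area_density (kerr m a) Z \<theta> \<phi> =
       sin \<theta> * jet_density (jet2 (sext Z) (sph \<theta> \<phi>) (e_theta \<theta> \<phi>) (e_phi \<phi>))"
    by (simp add: jet_density_def j surface_density_def mean_curv_sq_def P.mean_curv_eq)
qed

text \<open>Passes from the Lebesgue integral over the open rectangle to the gauge integral over the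
  closed one, to which Leibniz' rule and Fubini are applied later. Continuity up to the boundary
  gives integrability.\<close>

lemma willmore_energy_eq:
  assumes Z: "spacelike_surface (kerr m a) (kerr_exterior m a) Z"
    and c: "continuous_on (cbox (0, 0) (pi, 2 * pi))
      (\<lambda>t. sin (fst t) * jet_density (jet2 (sext Z) (sph (fst t) (snd t)) (e_theta (fst t) (snd t)) (e_phi (snd t))))"
  shows "willmore_energy (kerr m a) Z = integral (cbox (0, 0) (pi, 2 * pi))
      (\<lambda>t. sin (fst t) * jet_density (jet2 (sext Z) (sph (fst t) (snd t)) (e_theta (fst t) (snd t)) (e_phi (snd t))))"
    (is "_ = integral _ ?f")
proof -
  let ?B = "box (0, 0) (pi, 2 * pi) :: (real \<times> real) set"
  have B: "{0<..<pi} \<times> {0<..<2 * pi} = ?B"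
    by (auto simp: box_def Basis_prod_def)
  have "set_integrable lborel (cbox (0, 0) (pi, 2 * pi)) ?f"
    unfolding set_integrable_def using c by (intro borel_integrable_compact compact_cbox)
  then have i: "set_integrable lborel ?B ?f"
    by (rule set_integrable_subset) (auto simp: box_subset_cbox)
  have "willmore_energy (kerr m a) Z = set_lebesgue_integral lborel ?B ?f"
    unfolding willmore_energy_def surface_integral_def B
  proof (rule set_lebesgue_integral_cong)
    show "\<forall>t. t \<in> ?B \<longrightarrow> (case t of (\<theta>, \<phi>) \<Rightarrow> mean_curv_sq (kerr m a) Z (sph \<theta> \<phi>) * area_density (kerr m a) Z \<theta> \<phi>) = ?f t"
    proof (intro allI impI)
      fix t assume t: "t \<in> ?B"
      obtain \<theta> \<phi> where p: "t = (\<theta>, \<phi>)" by (cases t)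
      have "0 < \<theta>" "\<theta> < pi" using t unfolding B[symmetric] p by auto
      then show "(case t of (\<theta>, \<phi>) \<Rightarrow> mean_curv_sq (kerr m a) Z (sph \<theta> \<phi>) * area_density (kerr m a) Z \<theta> \<phi>) = ?f t"
        unfolding p split fst_conv snd_conv by (rule surface_jet(2)[OF Z])
    qed
  qed simp
  also have "\<dots> = integral ?B ?f" by (rule set_borel_integral_eq_integral(2)[OF i])
  finally show ?thesis by (simp add: integral_open_interval)
qed

end

lemma integral_Pair:
  fixes f :: "'a::euclidean_space \<Rightarrow> 'b::euclidean_space" and g :: "'a \<Rightarrow> 'c::euclidean_space"
  assumes "f integrable_on S" "g integrable_on S"
  shows "(\<lambda>x. (f x, g x)) integrable_on S" "integral S (\<lambda>x. (f x, g x)) = (integral S f, integral S g)"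
proof -
  have "bounded_linear (\<lambda>x::'b. (x, 0::'c))" "bounded_linear (\<lambda>y::'c. (0::'b, y))"
    by (auto intro!: bounded_linear_intros)
  from has_integral_add[OF has_integral_linear[OF integrable_integral[OF assms(1)] this(1)]
      has_integral_linear[OF integrable_integral[OF assms(2)] this(2)]]
  have "((\<lambda>x. (f x, g x)) has_integral (integral S f, integral S g)) S" by simp
  then show "(\<lambda>x. (f x, g x)) integrable_on S" "integral S (\<lambda>x. (f x, g x)) = (integral S f, integral S g)"
    by (auto simp: has_integral_iff)
qed

lemma lift_rotate_inverse: "lift_iso (rot (- \<phi>)) 1 (lift_iso (rot \<phi>) 1 v) = v"
  "lift_iso (rot \<phi>) 1 (lift_iso (rot (- \<phi>)) 1 v) = v"
  by (simp_all add: lift_iso_def rot_add rot_0)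

lemma bounded_linear_lift_rotate: "bounded_linear (lift_iso (rot \<phi>) 1)"
  using lift_iso_linear[OF axial_iso_rotate] by (simp add: linear_linear)

context kerr_sphere
begin

definition sphere_jet :: "real \<Rightarrow> real \<Rightarrow> spacetime jet" where
  "sphere_jet \<theta> \<phi> = jet2 (sext X) (sph \<theta> \<phi>) (e_theta \<theta> \<phi>) (e_phi \<phi>)"

lemma sphere_jet_eq:
  "sphere_jet \<theta> \<phi> = (X (sph \<theta> \<phi>), (0, R *\<^sub>R e_theta \<theta> \<phi>), (0, R *\<^sub>R e_phi \<phi>), (0, - R *\<^sub>R sph \<theta> \<phi>), 0, (0, - R *\<^sub>R sph \<theta> \<phi>))"
proof -
  have "e_phi \<phi> \<bullet> e_theta \<theta> \<phi> = 0" using sph_tangent_basis[of \<theta> \<phi>] by (simp add: tangent_basis_def inner_commute)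
  then show ?thesis
    using sph_tangent_basis[of \<theta> \<phi>] sph_S2[of \<theta> \<phi>]
    unfolding sphere_jet_def jet2_def sderiv_dd[symmetric] hess_dd[symmetric] tangent_basis_def
    by (simp add: sext_on_S2 coord_sphere_tangent coord_sphere_hess_tangent zero_prod_def)
qed

lemma sphere_jet_domain: "sphere_jet \<theta> \<phi> \<in> jet_domain"
  unfolding sphere_jet_def by (rule surface_jet(1)[OF spacelike])

lemma sphere_jet_rotate:
  "jet_act (lift_iso (rot \<phi>) 1) (lift_iso (rot \<phi>) 1) 1 (sphere_jet \<theta> 0) = sphere_jet \<theta> \<phi>"
proof -
  have l: "linear (rot \<phi>)" using axial_iso_rotate by (simp add: axial_iso_def)
  show ?thesis
    unfolding jet_act_def sphere_jet_eq
    by (simp add: lift_iso_def linear_cmul[OF l] linear_neg[OF l] linear_0[OF l] rot_frame X_apply zero_prod_def)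
qed

text \<open>The reflection fixes the meridian of azimuth 0 and reverses \<open>e_phi 0\<close>; the
  sign \<open>- 1\<close> in the jet action compensates.\<close>

lemma sphere_jet_flip:
  "jet_act (\<lambda>p. (t0 - - 1 * t0, 0) + lift_iso flip (- 1) p) (lift_iso flip (- 1)) (- 1) (sphere_jet \<theta> 0) = sphere_jet \<theta> 0"
proof -
  have l: "linear flip" using axial_iso_flip by (simp add: axial_iso_def)
  show ?thesis
    unfolding jet_act_def sphere_jet_eq
    by (simp add: lift_iso_def linear_cmul[OF l] linear_neg[OF l] linear_0[OF l] flip_frame X_apply zero_prod_def)
qed

text \<open>With the base jet moved to azimuth 0, the differential along a circle of latitude
  becomes one fixed linear functional, which can be pulled out of the integral.\<close>

lemma density_derivative_rotate:
  "dd jet_density k (sphere_jet \<theta> \<phi>) =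
   dd jet_density (jet_act (lift_iso (rot (- \<phi>)) 1) (lift_iso (rot (- \<phi>)) 1) 1 k) (sphere_jet \<theta> 0)"
proof -
  let ?A = "lift_iso (rot \<phi>) 1" and ?B = "lift_iso (rot (- \<phi>)) 1"
  have iso: "isometry_at ?A ?A"
    using kerr_isometry[OF kerr_hole_axioms axial_iso_rotate, of 0 \<phi>] by (simp flip: zero_prod_def)
  have "jet_act ?A ?A 1 (jet_act ?B ?B 1 k) = k"
    by (simp add: jet_act_def lift_rotate_inverse)
  then show ?thesis
    using dd_jet_density[OF iso _ sphere_jet_domain, of 1 "jet_act ?B ?B 1 k" \<theta> 0]
    by (simp add: sphere_jet_rotate)
qed

lemma density_derivative_flip:
  "dd jet_density (jet_act (lift_iso flip (- 1)) (lift_iso flip (- 1)) (- 1) k) (sphere_jet \<theta> 0) = dd jet_density k (sphere_jet \<theta> 0)"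
  using dd_jet_density[OF sphere_iso(1)[OF axial_iso_flip] _ sphere_jet_domain, of "- 1" k \<theta> 0]
  unfolding sphere_jet_flip by simp

text \<open>\<open>G\<close> is the field pulled back by the rotations, so its spatial derivatives
  are pulled back derivatives of \<open>V0\<close>. Making the angle a variable gives the joint
  smoothness needed to differentiate the average.\<close>

lemma rotated_field_jet:
  assumes V0: "smooth_on (- {0}) V0"
    and G: "G = (\<lambda>(y, \<phi>). lift_iso (rot (- \<phi>)) 1 (V0 (rot \<phi> y)))"
  shows "smooth_on ((- {0}) \<times> UNIV) G"
    "y \<noteq> 0 \<Longrightarrow> dd G (w, 0) (y, \<phi>) = lift_iso (rot (- \<phi>)) 1 (dd V0 (rot \<phi> w) (rot \<phi> y))"
    "y \<noteq> 0 \<Longrightarrow> dd (dd G (w, 0)) (v, 0) (y, \<phi>) =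
       lift_iso (rot (- \<phi>)) 1 (dd (dd V0 (rot \<phi> w)) (rot \<phi> v) (rot \<phi> y))"
proof -
  have o: "open ((- {0}) \<times> UNIV :: ((real^3) \<times> real) set)" by (intro open_Times) auto
  have nz: "rot \<phi> y \<noteq> 0" if "y \<noteq> 0" for \<phi> y using axial_iso_norm[OF axial_iso_rotate, of \<phi> y] that by auto
  show sm: "smooth_on ((- {0}) \<times> UNIV) G"
    unfolding G lift_iso_def case_prod_beta'
    by (intro smooth_on_Pair smooth_on_mult smooth_on_const o smooth_on_fst smooth_on_snd smooth_on_rotate smooth_on_uminus
        smooth_on_compose[OF V0] smooth_on_ident) (auto simp: nz)
  have l: "bounded_linear (rot \<phi>)" for \<phi> using axial_iso_rotate by (simp add: axial_iso_def linear_linear)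
  have chain: "dd H (w, 0) (y, \<phi>) = lift_iso (rot (- \<phi>)) 1 (dd V1 (rot \<phi> w) (rot \<phi> y))"
    if H: "smooth_on ((- {0}) \<times> UNIV) H" and V1: "smooth_on (- {0}) V1" and y: "y \<noteq> 0"
      and eq: "\<And>z. z \<noteq> 0 \<Longrightarrow> H (z, \<phi>) = lift_iso (rot (- \<phi>)) 1 (V1 (rot \<phi> z))" for H V1 w y \<phi>
  proof -
    have "((\<lambda>z. (z, \<phi>)) has_derivative (\<lambda>w. (w, 0))) (at y)" by (auto intro!: derivative_eq_intros)
    from has_derivative_compose[OF this dd_has_derivative[OF H]] y
    have "((\<lambda>z. H (z, \<phi>)) has_derivative (\<lambda>w. dd H (w, 0) (y, \<phi>))) (at y)" by simp
    moreover have "((\<lambda>z. lift_iso (rot (- \<phi>)) 1 (V1 (rot \<phi> z))) has_derivative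
        (\<lambda>w. lift_iso (rot (- \<phi>)) 1 (dd V1 (rot \<phi> w) (rot \<phi> y)))) (at y)"
      using nz[OF y]
      by (intro bounded_linear.has_derivative[OF bounded_linear_lift_rotate]
          has_derivative_compose[OF bounded_linear_imp_has_derivative[OF l] dd_has_derivative[OF V1]]) auto
    then have "((\<lambda>z. H (z, \<phi>)) has_derivative
        (\<lambda>w. lift_iso (rot (- \<phi>)) 1 (dd V1 (rot \<phi> w) (rot \<phi> y)))) (at y)"
      by (rule has_derivative_transform_within_open[of _ _ _ _ "- {0}"]) (auto simp: y eq)
    ultimately have "(\<lambda>w. dd H (w, 0) (y, \<phi>)) = (\<lambda>w. lift_iso (rot (- \<phi>)) 1 (dd V1 (rot \<phi> w) (rot \<phi> y)))"
      by (rule has_derivative_unique)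
    then show ?thesis by metis
  qed
  show 1: "dd G (w, 0) (y, \<phi>) = lift_iso (rot (- \<phi>)) 1 (dd V0 (rot \<phi> w) (rot \<phi> y))" if "y \<noteq> 0" for y w
    by (rule chain[OF sm V0 that]) (simp add: G)
  show "dd (dd G (w, 0)) (v, 0) (y, \<phi>) =
       lift_iso (rot (- \<phi>)) 1 (dd (dd V0 (rot \<phi> w)) (rot \<phi> v) (rot \<phi> y))" if "y \<noteq> 0"
    by (rule chain[OF dd_smooth[OF sm] dd_smooth[OF V0] that]) (rule 1)
qed

text \<open>The fields b W are exactly the normal fields in the direction of the dual mean curvature. Averaging
  over the rotations turns such a field into one that is odd under the reflection, and the
  differential of the (even) density vanishes on the 2-jet of an odd field.\<close>

lemma first_variation_fibre:
  assumes V0: "smooth_on (- {0}) V0" and VW: "\<And>y. y \<noteq> 0 \<Longrightarrow> V0 y = fst (V0 y) *\<^sub>R W (y /\<^sub>R norm y)"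
  shows "integral {0..2 * pi} (\<lambda>\<phi>. dd jet_density (jet2 V0 (sph \<theta> \<phi>) (e_theta \<theta> \<phi>) (e_phi \<phi>)) (sphere_jet \<theta> \<phi>)) = 0"
proof -
  define G where "G = (\<lambda>(y, \<phi>). lift_iso (rot (- \<phi>)) 1 (V0 (rot \<phi> y)))"
  note J = rotated_field_jet[OF V0 G_def]
  define x e f where "x = sph \<theta> 0" and "e = e_theta \<theta> 0" and "f = e_phi 0"
  have x0: "x \<noteq> 0" using sph_S2[of \<theta> 0] by (auto simp: x_def)
  let ?\<tau> = "lift_iso flip (- 1)"
  have lt: "linear ?\<tau>" by (rule lift_iso_linear[OF axial_iso_flip])
  have lf: "linear flip" using axial_iso_flip by (simp add: axial_iso_def)
  have B: "bounded_linear (\<lambda>v. - ?\<tau> v)" using lt by (intro bounded_linear_minus) (simp add: linear_linear)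
  have flip0: "flip y \<in> - {0}" if "y \<in> - {0}" for y using axial_iso_norm[OF axial_iso_flip, of y] that by auto
  have W_rot: "W (rot \<phi> u) = lift_iso (rot \<phi>) 1 (W u)" for \<phi> u
    using W_iso[OF axial_iso_rotate] by simp
  \<comment> \<open>The lifted rotations preserve \<open>W\<close>, so only the scalar coefficient
    depends on the angle and \<open>W\<close> leaves the integral.\<close>
  have GW: "G (y, \<phi>) = fst (V0 (rot \<phi> y)) *\<^sub>R W (y /\<^sub>R norm y)" if y: "y \<noteq> 0" for y \<phi>
  proof -
    have n: "norm (rot \<phi> y) = norm y" by (rule axial_iso_norm[OF axial_iso_rotate])
    have l: "linear (rot \<phi>)" using axial_iso_rotate by (simp add: axial_iso_def)
    have "V0 (rot \<phi> y) = fst (V0 (rot \<phi> y)) *\<^sub>R W (rot \<phi> (y /\<^sub>R norm y))"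
      using VW[of "rot \<phi> y"] n y by (simp add: linear_cmul[OF l]) (metis norm_eq_zero)
    then have "G (y, \<phi>) = lift_iso (rot (- \<phi>)) 1 (fst (V0 (rot \<phi> y)) *\<^sub>R lift_iso (rot \<phi>) 1 (W (y /\<^sub>R norm y)))"
      unfolding G_def W_rot by simp
    then show ?thesis
      by (simp only: linear_cmul[OF lift_iso_linear[OF axial_iso_rotate]] lift_rotate_inverse)
  qed
  have int_GW: "integral {0..2 * pi} (\<lambda>\<phi>. G (y, \<phi>)) = integral {0..2 * pi} (\<lambda>\<phi>. fst (V0 (rot \<phi> y))) *\<^sub>R W (y /\<^sub>R norm y)"
    and cont: "continuous_on UNIV (\<lambda>\<phi>. fst (V0 (rot \<phi> y)))" if y: "y \<noteq> 0" for y
  proof -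
    have "smooth_on UNIV (\<lambda>\<phi>. fst (V0 (rot \<phi> y)))"
      using y axial_iso_norm[OF axial_iso_rotate, of _ y]
      by (intro smooth_on_fst smooth_on_compose[OF V0] smooth_on_rotate smooth_on_ident smooth_on_const)
        (auto, metis norm_eq_zero)
    then show c: "continuous_on UNIV (\<lambda>\<phi>. fst (V0 (rot \<phi> y)))" by (rule smooth_on_continuous)
    then have "(\<lambda>\<phi>. fst (V0 (rot \<phi> y))) integrable_on {0..2 * pi}"
      by (intro integrable_continuous_real continuous_on_subset[OF c]) simp
    from integral_linear[OF this bounded_linear_scaleR_left, of "W (y /\<^sub>R norm y)"]
    show "integral {0..2 * pi} (\<lambda>\<phi>. G (y, \<phi>)) = integral {0..2 * pi} (\<lambda>\<phi>. fst (V0 (rot \<phi> y))) *\<^sub>R W (y /\<^sub>R norm y)"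
      by (simp add: o_def GW[OF y])
  qed
  \<comment> \<open>The scalar average is invariant, since \<open>flip\<close> is a rotation on the
    orbit of \<open>y\<close>; the sign comes from \<open>W\<close>, which time reversal turns
    around.\<close>
  have E0: "integral {0..2 * pi} (\<lambda>\<phi>. G (flip y, \<phi>)) = - ?\<tau> (integral {0..2 * pi} (\<lambda>\<phi>. G (y, \<phi>)))"
    if "y \<in> - {0}" for y
  proof -
    have y: "y \<noteq> 0" "flip y \<noteq> 0" using that flip0[OF that] by auto
    obtain c where c: "0 \<le> c" "c \<le> 2 * pi" "flip y = rot c y" by (rule flip_as_rotation)
    have "integral {0..2 * pi} (\<lambda>\<phi>. fst (V0 (rot \<phi> (flip y)))) = integral {0..2 * pi} (\<lambda>\<phi>. fst (V0 (rot (\<phi> + c) y)))"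
      unfolding c(3) by (simp add: rot_add)
    also have "\<dots> = integral {0..2 * pi} (\<lambda>\<phi>. fst (V0 (rot \<phi> y)))"
      by (rule integral_periodic_shift[OF cont[OF y(1)] _ c(1,2)]) (simp add: rot_2pi)
    finally have 1: "integral {0..2 * pi} (\<lambda>\<phi>. fst (V0 (rot \<phi> (flip y)))) = integral {0..2 * pi} (\<lambda>\<phi>. fst (V0 (rot \<phi> y)))" .
    have 2: "W (flip y /\<^sub>R norm (flip y)) = - ?\<tau> (W (y /\<^sub>R norm y))"
      using W_iso[OF axial_iso_flip, of "y /\<^sub>R norm y"] by (simp add: axial_iso_norm[OF axial_iso_flip] linear_cmul[OF lf])
    show ?thesis unfolding int_GW[OF y(1)] int_GW[OF y(2)] 1 2 by (simp add: linear_cmul[OF lt])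
  qed
  \<comment> \<open>Two differentiations carry the oddness of the average over to its first and
    second derivatives.\<close>
  note step = fibre_integral_derivative[OF _ _ _ lf flip0 B]
  have U: "open (- {0 :: real^3})" by auto
  have E1: "integral {0..2 * pi} (\<lambda>\<phi>. dd G (flip w, 0) (flip y, \<phi>)) = - ?\<tau> (integral {0..2 * pi} (\<lambda>\<phi>. dd G (w, 0) (y, \<phi>)))"
    if "y \<in> - {0}" for y w
    by (rule step[OF J(1) J(1) U _ E0 that])
  have E2: "integral {0..2 * pi} (\<lambda>\<phi>. dd (dd G (flip w, 0)) (flip v, 0) (flip y, \<phi>)) =
      - ?\<tau> (integral {0..2 * pi} (\<lambda>\<phi>. dd (dd G (w, 0)) (v, 0) (y, \<phi>)))" if "y \<in> - {0}" for y v w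
    by (rule step[OF dd_smooth[OF J(1)] dd_smooth[OF J(1)] U _ E1 that])
  have fr: "flip x = x" "flip e = e" "flip f = - f" by (simp_all add: x_def e_def f_def flip_frame)
  \<comment> \<open>The 2-jet of the pulled back field at azimuth 0; its integral is the 2-jet of
    the rotational sum.\<close>
  define \<kappa> where "\<kappa> \<phi> = (G (x, \<phi>), dd G (e, 0) (x, \<phi>), dd G (f, 0) (x, \<phi>), dd (dd G (e, 0)) (e, 0) (x, \<phi>),
    dd (dd G (f, 0)) (e, 0) (x, \<phi>) + dd (dd G (e, 0)) (f, 0) (x, \<phi>), dd (dd G (f, 0)) (f, 0) (x, \<phi>))" for \<phi>
  have \<kappa>: "jet_act (lift_iso (rot (- \<phi>)) 1) (lift_iso (rot (- \<phi>)) 1) 1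
      (jet2 V0 (sph \<theta> \<phi>) (e_theta \<theta> \<phi>) (e_phi \<phi>)) = \<kappa> \<phi>" for \<phi>
    unfolding \<kappa>_def J(2,3)[OF x0] jet_act_def jet2_def
    by (simp add: x_def e_def f_def rot_frame G_def linear_add[OF lift_iso_linear[OF axial_iso_rotate]])
  have mem: "(x, \<phi>) \<in> (- {0}) \<times> UNIV" for \<phi> :: real using x0 by simp
  have line: "continuous_on A (\<lambda>\<phi>. H (x, \<phi>))" if "smooth_on ((- {0}) \<times> UNIV) H" for H :: "(real^3) \<times> real \<Rightarrow> spacetime" and A
    by (rule continuous_on_compose2[OF smooth_on_continuous[OF that]]) (use x0 in \<open>auto intro!: continuous_intros\<close>)
  have int: "(\<lambda>\<phi>. H (x, \<phi>)) integrable_on {0..2 * pi}" if "smooth_on ((- {0}) \<times> UNIV) H" for H :: "(real^3) \<times> real \<Rightarrow> spacetime"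
    by (rule integrable_continuous_real[OF line[OF that]])
  have "continuous_on {0..2 * pi} \<kappa>"
    unfolding \<kappa>_def by (intro continuous_on_Pair continuous_on_add line J(1) dd_smooth)
  then have \<kappa>i: "\<kappa> integrable_on {0..2 * pi}" by (rule integrable_continuous_real)
  let ?I = "integral {0..2 * pi}"
  let ?T = "jet_act ?\<tau> ?\<tau> (- 1)"
  have proj: "h (?I \<kappa>) = ?I (\<lambda>\<phi>. h (\<kappa> \<phi>))" if "bounded_linear h" for h :: "_ \<Rightarrow> 'z::euclidean_space"
    using integral_linear[OF \<kappa>i that] by (simp add: o_def)
  have neg: "dd G (- f, 0) p = - dd G (f, 0) p" "dd (dd G (- f, 0)) b p = - dd (dd G (f, 0)) b p"
    "dd (dd G b) (- f, 0) p = - dd (dd G b) (f, 0) p" if "p \<in> (- {0}) \<times> UNIV" for p b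
    using linear_neg[OF dd_linear[OF J(1) that], of "(f, 0)"] linear_neg[OF dd_second_linear(1)[OF J(1) that, where b = b], of "(f, 0)"]
      linear_neg[OF dd_second_linear(2)[OF J(1) that, where a = b], of "(f, 0)"] by simp_all
  have x: "x \<in> - {0}" using x0 by simp
  \<comment> \<open>Each derivative along \<open>f\<close> contributes a sign because
    \<open>flip\<close> reverses \<open>f\<close>. The integrals with an odd number of them are
    therefore even under \<open>?\<tau>\<close>, and the sign in \<open>?T\<close> makes all slots
    odd alike.\<close>
  have c0: "?\<tau> (?I (\<lambda>\<phi>. G (x, \<phi>))) = - ?I (\<lambda>\<phi>. G (x, \<phi>))"
    using E0[OF x] fr by (metis minus_equation_iff)
  have c1: "?\<tau> (?I (\<lambda>\<phi>. dd G (e, 0) (x, \<phi>))) = - ?I (\<lambda>\<phi>. dd G (e, 0) (x, \<phi>))"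
    using E1[OF x, of e] fr by (metis minus_equation_iff)
  have c2: "?\<tau> (?I (\<lambda>\<phi>. dd G (f, 0) (x, \<phi>))) = ?I (\<lambda>\<phi>. dd G (f, 0) (x, \<phi>))"
    using E1[OF x, of f] by (simp add: fr neg[OF mem])
  have c11: "?\<tau> (?I (\<lambda>\<phi>. dd (dd G (e, 0)) (e, 0) (x, \<phi>))) = - ?I (\<lambda>\<phi>. dd (dd G (e, 0)) (e, 0) (x, \<phi>))"
    using E2[OF x, of e e] fr by (metis minus_equation_iff)
  have c12: "?\<tau> (?I (\<lambda>\<phi>. dd (dd G (f, 0)) (e, 0) (x, \<phi>))) = ?I (\<lambda>\<phi>. dd (dd G (f, 0)) (e, 0) (x, \<phi>))"
    using E2[OF x, of f e] by (simp add: fr neg[OF mem])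
  have c21: "?\<tau> (?I (\<lambda>\<phi>. dd (dd G (e, 0)) (f, 0) (x, \<phi>))) = ?I (\<lambda>\<phi>. dd (dd G (e, 0)) (f, 0) (x, \<phi>))"
    using E2[OF x, of e f] by (simp add: fr neg[OF mem])
  have c22: "?\<tau> (?I (\<lambda>\<phi>. dd (dd G (f, 0)) (f, 0) (x, \<phi>))) = - ?I (\<lambda>\<phi>. dd (dd G (f, 0)) (f, 0) (x, \<phi>))"
    using E2[OF x, of f f] by (simp add: fr neg[OF mem]) (metis minus_equation_iff)
  have add: "?I (\<lambda>\<phi>. dd (dd G (f, 0)) (e, 0) (x, \<phi>) + dd (dd G (e, 0)) (f, 0) (x, \<phi>)) =
      ?I (\<lambda>\<phi>. dd (dd G (f, 0)) (e, 0) (x, \<phi>)) + ?I (\<lambda>\<phi>. dd (dd G (e, 0)) (f, 0) (x, \<phi>))"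
    by (intro Henstock_Kurzweil_Integration.integral_add int dd_smooth J(1))
  have comps: "?I \<kappa> = (?I (\<lambda>\<phi>. G (x, \<phi>)), ?I (\<lambda>\<phi>. dd G (e, 0) (x, \<phi>)), ?I (\<lambda>\<phi>. dd G (f, 0) (x, \<phi>)),
      ?I (\<lambda>\<phi>. dd (dd G (e, 0)) (e, 0) (x, \<phi>)),
      ?I (\<lambda>\<phi>. dd (dd G (f, 0)) (e, 0) (x, \<phi>)) + ?I (\<lambda>\<phi>. dd (dd G (e, 0)) (f, 0) (x, \<phi>)),
      ?I (\<lambda>\<phi>. dd (dd G (f, 0)) (f, 0) (x, \<phi>)))"
    unfolding add[symmetric] \<kappa>_def
    by (simp add: integral_Pair int dd_smooth J(1) integrable_add)
  have T: "?T (?I \<kappa>) = - ?I \<kappa>"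
    unfolding comps jet_act_def
    by (simp add: c0 c1 c2 c11 c12 c21 c22 linear_add[OF lt])
  have lin: "linear (\<lambda>k. dd jet_density k (sphere_jet \<theta> 0))"
    by (rule dd_linear[OF smooth_jet_density sphere_jet_domain])
  have "dd jet_density (?T (?I \<kappa>)) (sphere_jet \<theta> 0) = dd jet_density (?I \<kappa>) (sphere_jet \<theta> 0)"
    by (rule density_derivative_flip)
  \<comment> \<open>The functional is even and the averaged jet is odd, so the value equals its own
    negative.\<close>
  then have "dd jet_density (?I \<kappa>) (sphere_jet \<theta> 0) = 0"
    unfolding T linear_neg[OF lin] by simp
  moreover have "dd jet_density (jet2 V0 (sph \<theta> \<phi>) (e_theta \<theta> \<phi>) (e_phi \<phi>)) (sphere_jet \<theta> \<phi>) =
      dd jet_density (\<kappa> \<phi>) (sphere_jet \<theta> 0)" for \<phi>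
    by (subst density_derivative_rotate) (simp only: \<kappa>)
  ultimately show ?thesis
    using proj[OF linear_linear[THEN iffD2, OF lin]] by simp
qed

end

context kerr_sphere_nonminimal
begin

text \<open>The velocity is a multiple of \<open>V\<close>, hence of \<open>W\<close>. As
  \<open>W\<close> has time component 1, the coefficient is the time component of the velocity
  itself, and \<open>\<alpha>\<close> drops out of what follows.\<close>

lemma variation_velocity:
  assumes F: "is_variation K E X (\<lambda>x. \<alpha> x *\<^sub>R dual_mean_curv K X x) F"
    and \<Phi>: "smooth_family I (- {0}) \<Phi>" "0 \<in> I" and \<Phi>F: "\<And>s y. \<Phi> (s, y) = sext (F s) y" and y: "y \<noteq> 0"
  shows "dd \<Phi> (1, 0) (0, y) = fst (dd \<Phi> (1, 0) (0, y)) *\<^sub>R W (y /\<^sub>R norm y)"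
proof -
  let ?u = "y /\<^sub>R norm y"
  have u: "?u \<in> S2" by (rule unit_in_S2[OF y])
  have "((\<lambda>s. F s ?u) has_vector_derivative dd \<Phi> (1, 0) (0, y)) (at 0)"
    using smooth_family.time_derivative[OF \<Phi>(1) smooth_family.smooth_\<Phi>[OF \<Phi>(1)] \<Phi>(2), of y] y
    by (simp add: \<Phi>F sext_def)
  moreover have "((\<lambda>s. F s ?u) has_vector_derivative \<alpha> ?u *\<^sub>R dual_mean_curv K X ?u) (at 0)"
    using F u by (simp add: is_variation_def)
  ultimately have "dd \<Phi> (1, 0) (0, y) = \<alpha> ?u *\<^sub>R V ?u"
    using vector_derivative_unique_at dual[OF u] by metis
  moreover have "fst (zamo m a z) = 1" for z by (simp add: zamo_def)
  ultimately show ?thesis by (simp add: V_def)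
qed

lemma willmore_derivative_zero:
  assumes F: "is_variation K E X (\<lambda>x. \<alpha> x *\<^sub>R dual_mean_curv K X x) F"
  shows "((\<lambda>s. willmore_energy K (F s)) has_real_derivative 0) (at 0)"
proof -
  obtain \<epsilon> where \<epsilon>: "0 < \<epsilon>" and sm: "smooth_on ({-\<epsilon><..<\<epsilon>} \<times> (- {0})) (\<lambda>(s, y). sext (F s) y)"
    and sp: "\<And>s. s \<in> {-\<epsilon><..<\<epsilon>} \<Longrightarrow> spacelike_surface K E (F s)"
    and F0: "\<And>x. x \<in> S2 \<Longrightarrow> F 0 x = X x"
    using F unfolding is_variation_def by blast
  define I where "I = {-\<epsilon><..<\<epsilon>}"
  define \<Phi> where "\<Phi> = (\<lambda>(s, y). sext (F s) y)"
  have \<Phi>F: "\<Phi> (s, y) = sext (F s) y" for s y by (simp add: \<Phi>_def)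
  have I: "open I" "0 \<in> I" "convex I" using \<epsilon> by (auto simp: I_def)
  have fam: "smooth_family I (- {0}) \<Phi>"
    using sm I(1) by unfold_locales (auto simp: I_def \<Phi>_def)
  interpret smooth_family I "- {0}" \<Phi> by (rule fam)
  have sph0: "sph \<theta> \<phi> \<in> - {0}" for \<theta> \<phi> using sph_S2[of \<theta> \<phi>] by auto
  define J where "J s t = jet2 (\<lambda>y. \<Phi> (s, y)) (sph (fst t) (snd t)) (e_theta (fst t) (snd t)) (e_phi (snd t))" for s t
  have J_dom: "J s t \<in> jet_domain" if "s \<in> I" for s t
    using surface_jet(1)[OF sp] that unfolding I_def J_def \<Phi>F by (simp add: eta_contract_eq)
  \<comment> \<open>The energy integrand in the angles, defined and smooth for all of them, hence
    continuous on the closed rectangle including the poles.\<close>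
  define P where "P = (\<lambda>(s, t). sin (fst t) * jet_density (J s t))"
  have o: "open (I \<times> (UNIV :: (real \<times> real) set))" using I(1) by (intro open_Times) auto
  have J_smooth: "smooth_on (I \<times> UNIV) (\<lambda>z. J (fst z) (snd z))"
    unfolding J_def using sph0
    by (intro jet2_smooth sph_smooth e_phi_smooth smooth_on_fst smooth_on_snd smooth_on_ident o) auto
  have P_smooth: "smooth_on (I \<times> UNIV) P"
    unfolding P_def case_prod_beta' using J_dom
    by (intro smooth_on_mult smooth_on_sin smooth_on_fst smooth_on_snd smooth_on_ident o
        smooth_on_compose[OF smooth_jet_density J_smooth]) auto
  have cP: "continuous_on (I \<times> UNIV) P" and cD: "continuous_on (I \<times> UNIV) (dd P (1, 0))"
    by (rule smooth_on_continuous[OF P_smooth], rule smooth_on_continuous[OF dd_smooth[OF P_smooth]])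
  let ?B = "cbox (0, 0) (pi, 2 * pi) :: (real \<times> real) set"
  have W_eq: "willmore_energy K (F s) = integral ?B (\<lambda>t. P (s, t))" if s: "s \<in> I" for s
  proof -
    have P: "P (s, t) = sin (fst t) * jet_density (jet2 (sext (F s)) (sph (fst t) (snd t)) (e_theta (fst t) (snd t)) (e_phi (snd t)))" for t
      by (simp add: P_def J_def \<Phi>F eta_contract_eq)
    have "continuous_on ?B (\<lambda>t. P (s, t))"
      using s by (intro continuous_on_compose2[OF cP] continuous_intros) auto
    then show ?thesis
      unfolding P using s by (intro willmore_energy_eq sp) (auto simp: I_def)
  qed
  have "((\<lambda>s. integral ?B (\<lambda>t. P (s, t))) has_vector_derivative integral ?B (\<lambda>t. dd P (1, 0) (0, t))) (at 0 within I)"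
  proof (rule leibniz_rule_vector_derivative[where f = "\<lambda>s t. P (s, t)" and fx = "\<lambda>s t. dd P (1, 0) (s, t)"])
    fix s t assume "s \<in> I" "t \<in> ?B"
    then show "((\<lambda>s. P (s, t)) has_vector_derivative dd P (1, 0) (s, t)) (at s within I)"
      using dd_curve[OF P_smooth, of "(0, t)" s "(1, 0)"] by (simp add: has_vector_derivative_at_within)
  next
    fix s assume "s \<in> I"
    then show "(\<lambda>t. P (s, t)) integrable_on ?B"
      by (intro integrable_continuous continuous_on_compose2[OF cP] continuous_intros) auto
  next
    show "continuous_on (I \<times> ?B) (\<lambda>(s, t). dd P (1, 0) (s, t))"
      using continuous_on_subset[OF cD, of "I \<times> ?B"] by (simp add: case_prod_beta' Sigma_mono)
  qed (use I in auto)
  moreover have "at 0 within I = at 0" using I by (intro at_within_open)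
  ultimately have deriv: "((\<lambda>s. integral ?B (\<lambda>t. P (s, t))) has_vector_derivative integral ?B (\<lambda>t. dd P (1, 0) (0, t))) (at 0)"
    by (simp only:)
  define V0 where "V0 y = dd \<Phi> (1, 0) (0, y)" for y
  have V0_smooth: "smooth_on (- {0}) V0"
    unfolding V0_def using I(2)
    by (intro smooth_on_compose[OF dd_smooth[OF smooth_\<Phi>]] smooth_on_Pair smooth_on_const smooth_on_ident) auto
  \<comment> \<open>\<open>F 0\<close> and \<open>X\<close> are only known to agree on the sphere,
    but then their degree-0 extensions agree on the punctured space, so all derivatives
    match.\<close>
  have J0: "J 0 (\<theta>, \<phi>) = sphere_jet \<theta> \<phi>" for \<theta> \<phi>
    unfolding J_def sphere_jet_def fst_conv snd_conv
  proof (rule jet2_cong[OF _ sph0])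
    fix y :: "real^3" assume "y \<in> - {0}"
    then show "\<Phi> (0, y) = sext X y" using F0[OF unit_in_S2, of y] by (simp add: \<Phi>F sext_def)
  qed auto
  \<comment> \<open>Chain rule through the 2-jet: its velocity is the 2-jet of the velocity field
    \<open>V0\<close>.\<close>
  have dP: "dd P (1, 0) (0, (\<theta>, \<phi>)) =
      sin \<theta> * dd jet_density (jet2 V0 (sph \<theta> \<phi>) (e_theta \<theta> \<phi>) (e_phi \<phi>)) (sphere_jet \<theta> \<phi>)" for \<theta> \<phi>
  proof -
    have "((\<lambda>s. J s (\<theta>, \<phi>)) has_vector_derivative jet2 V0 (sph \<theta> \<phi>) (e_theta \<theta> \<phi>) (e_phi \<phi>)) (at 0)"
      using jet2_has_vector_derivative[OF I(2) sph0] unfolding J_def V0_def by simp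
    then have "((\<lambda>s. J s (\<theta>, \<phi>)) has_derivative (\<lambda>h. h *\<^sub>R jet2 V0 (sph \<theta> \<phi>) (e_theta \<theta> \<phi>) (e_phi \<phi>))) (at 0)"
      by (simp add: has_vector_derivative_def)
    from has_derivative_compose[OF this dd_has_derivative[OF smooth_jet_density J_dom[OF I(2)]]]
    have "((\<lambda>s. jet_density (J s (\<theta>, \<phi>))) has_vector_derivative
        dd jet_density (jet2 V0 (sph \<theta> \<phi>) (e_theta \<theta> \<phi>) (e_phi \<phi>)) (J 0 (\<theta>, \<phi>))) (at 0)"
      unfolding has_vector_derivative_def
      by (rule has_derivative_eq_rhs)
        (simp add: linear_cmul[OF dd_linear[OF smooth_jet_density J_dom[OF I(2)]]])
    then have "((\<lambda>s. P (s, (\<theta>, \<phi>))) has_vector_derivative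
        sin \<theta> * dd jet_density (jet2 V0 (sph \<theta> \<phi>) (e_theta \<theta> \<phi>) (e_phi \<phi>)) (sphere_jet \<theta> \<phi>)) (at 0)"
      unfolding J0 P_def by (simp add: has_vector_derivative_mult_right)
    moreover have "((\<lambda>s. P (s, (\<theta>, \<phi>))) has_vector_derivative dd P (1, 0) (0, (\<theta>, \<phi>))) (at 0)"
      using dd_curve[OF P_smooth, of "(0, (\<theta>, \<phi>))" 0 "(1, 0)"] I(2) by simp
    ultimately show ?thesis using vector_derivative_unique_at by blast
  qed
  have "continuous_on ?B (\<lambda>t. dd P (1, 0) (0, t))"
    using I(2) by (intro continuous_on_compose2[OF cD] continuous_intros) auto
  \<comment> \<open>Fubini with the azimuth inside: the integral over each circle of latitude
    vanishes by itself.\<close>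
  then have "integral ?B (\<lambda>t. dd P (1, 0) (0, t)) =
      integral (cbox 0 pi) (\<lambda>\<theta>. integral (cbox 0 (2 * pi)) (\<lambda>\<phi>. dd P (1, 0) (0, (\<theta>, \<phi>))))"
    by (rule integral_prod_continuous)
  also have "\<dots> = integral (cbox 0 pi) (\<lambda>\<theta>. 0)"
  proof (rule integral_cong)
    fix \<theta>
    have "integral {0..2 * pi} (\<lambda>\<phi>. dd jet_density (jet2 V0 (sph \<theta> \<phi>) (e_theta \<theta> \<phi>) (e_phi \<phi>)) (sphere_jet \<theta> \<phi>)) = 0"
      using variation_velocity[OF F fam I(2) \<Phi>F]
      by (intro first_variation_fibre V0_smooth) (simp add: V0_def)
    then show "integral (cbox 0 (2 * pi)) (\<lambda>\<phi>. dd P (1, 0) (0, (\<theta>, \<phi>))) = 0"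
      unfolding dP by simp
  qed
  finally have zero: "integral ?B (\<lambda>t. dd P (1, 0) (0, t)) = 0" by simp
  have "((\<lambda>s. willmore_energy K (F s)) has_derivative (\<lambda>h. h *\<^sub>R (0::real))) (at 0)"
    using deriv unfolding zero has_vector_derivative_def
    by (rule has_derivative_transform_within_open[OF _ I(1,2)]) (simp add: W_eq)
  then show ?thesis by (simp add: has_field_derivative_def lambda_zero)
qed

lemma willmore_critical: "willmore_critical_dual K E X"
  using spacelike_mean_curv willmore_derivative_zero by (auto simp: willmore_critical_dual_def)

end

theorem proposition6p3:
  fixes m a t0 R :: real
  assumes "0 < m" and "\<bar>a\<bar> \<le> m" and "r_plus m a < R"
    and "\<forall>x\<in>S2. slice_mean_curv m a t0 R x \<noteq> 0"
  shows "willmore_critical_dual (kerr m a) (kerr_exterior m a) (coord_sphere t0 R)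
       \<and> time_flat (kerr m a) (kerr_exterior m a) (coord_sphere t0 R)
       \<and> (\<forall>\<beta>. smooth_on_S2 \<beta> \<longrightarrow>
            connection_compatible (kerr m a) (kerr_exterior m a) (coord_sphere t0 R) \<beta>)"
proof -
  interpret kerr_sphere_nonminimal m a t0 R
    using assms by unfold_locales auto
  show ?thesis using willmore_critical time_flat connection_compatible by blast
qed

end
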